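(* For every $k \in \omega$ with $k \geq 3$, $\mathsf{RCA}_0 \vdash \mathsf{RWKL} \leftrightarrow \mathsf{RCOLOR}_k \leftrightarrow \mathsf{LRCOLOR}_k$; that is, the three statements $\mathsf{RWKL}$, $\mathsf{RCOLOR}_k$ and $\mathsf{LRCOLOR}_k$ are pairwise equivalent over $\mathsf{RCA}_0$.
   Context: $\mathsf{RCA}_0$ is the subsystem of second-order arithmetic axiomatized by the basic axioms of arithmetic, $\Sigma^0_1$ induction and $\Delta^0_1$ comprehension. $\mathbb{N}$ denotes the first-order part of a possibly nonstandard model, and $\omega$ denotes the standard natural numbers (so $k$ is a fixed standard number). A tree is a set of finite strings closed under initial segments. A set $H \subseteq \mathbb{N}$ is homogeneous for $\sigma \in 2^{<\mathbb{N}}$ if $(\exists c < 2)(\forall i \in H)(i < |\sigma| \rightarrow \sigma(i) = c)$, and $H$ is homogeneous for an infinite tree $T \subseteq 2^{<\mathbb{N}}$ if the tree $\{\sigma \in T : H \text{ is homogeneous for } \sigma\}$ is infinite. $\mathsf{RWKL}$ is the statement "for every infinite tree $T \subseteq 2^{<\mathbb{N}}$, there is an infinite $H \subseteq \mathbb{N}$ that is homogeneous for $T$." Let $G = (V,E)$ be a graph (with $V \subseteq \mathbb{N}$). A function $f \colon V \to \{0,\dots,k-1\}$ is a $k$-coloring of $G$ if $(\forall x,y \in V)((x,y) \in E \rightarrow f(x) \neq f(y))$. $G$ is $k$-colorable if it has a $k$-coloring, and locally $k$-colorable if every finite subgraph is $k$-colorable. A set $H \subseteq V$ is $k$-homogeneous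 for $G$ if every finite $V_0 \subseteq V$ induces a subgraph that is $k$-colorable by a coloring that colors every vertex in $V_0 \cap H$ color $0$. $\mathsf{RCOLOR}_k$ is the statement "for every infinite, locally $k$-colorable graph $G = (V,E)$, there is an infinite $H \subseteq V$ that is $k$-homogeneous for $G$." $\mathsf{LRCOLOR}_k$ is the statement "for every infinite, locally $k$-colorable graph $G = (V,E)$ and every infinite $X \subseteq V$, there is an infinite $H \subseteq X$ that is $k$-homogeneous for $G$." *)

theory Defs
  imports Main
begin

text \<open>
  The language of second-order arithmetic. Number variables and set variables are two separate
  families of de Bruijn indices: \<open>AllN\<close> binds number index 0 and leaves set indices alone,
  \<open>AllS\<close> binds set index 0 and leaves number indices alone. As usual in this language, equality
  is primitive for numbers only.
\<close>

datatype tm = Var nat | Zero | One | Plus tm tm (infixl "\<^bold>+" 65) | Times tm tm (infixl "\<^bold>*" 70)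

datatype fm =
    FF
  | Eq tm tm (infix "\<^bold>=" 50)
  | Less tm tm (infix "\<^bold><" 50)
  | Mem tm nat (infix "\<^bold>\<in>" 50)
  | Imp fm fm (infixr "\<^bold>\<longrightarrow>" 25)
  | AllN fm
  | AllS fm

definition Neg :: "fm \<Rightarrow> fm" ("\<^bold>\<not> _" [40] 40) where
  "Neg \<phi> = (\<phi> \<^bold>\<longrightarrow> FF)"

definition Conj :: "fm \<Rightarrow> fm \<Rightarrow> fm" (infixr "\<^bold>\<and>" 35) where
  "Conj \<phi> \<psi> = (\<^bold>\<not> (\<phi> \<^bold>\<longrightarrow> \<^bold>\<not> \<psi>))"

definition Disj :: "fm \<Rightarrow> fm \<Rightarrow> fm" (infixr "\<^bold>\<or>" 30) where
  "Disj \<phi> \<psi> = (\<^bold>\<not> \<phi> \<^bold>\<longrightarrow> \<psi>)"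

definition Iff :: "fm \<Rightarrow> fm \<Rightarrow> fm" (infixr "\<^bold>\<longleftrightarrow>" 25) where
  "Iff \<phi> \<psi> = ((\<phi> \<^bold>\<longrightarrow> \<psi>) \<^bold>\<and> (\<psi> \<^bold>\<longrightarrow> \<phi>))"

definition ExN :: "fm \<Rightarrow> fm" where
  "ExN \<phi> = (\<^bold>\<not> AllN (\<^bold>\<not> \<phi>))"

definition ExS :: "fm \<Rightarrow> fm" where
  "ExS \<phi> = (\<^bold>\<not> AllS (\<^bold>\<not> \<phi>))"


subsection \<open>Substitution\<close>

primrec tsubst :: "(nat \<Rightarrow> tm) \<Rightarrow> tm \<Rightarrow> tm" where
  "tsubst \<sigma> (Var i) = \<sigma> i"
| "tsubst \<sigma> Zero = Zero"
| "tsubst \<sigma> One = One"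
| "tsubst \<sigma> (s \<^bold>+ t) = tsubst \<sigma> s \<^bold>+ tsubst \<sigma> t"
| "tsubst \<sigma> (s \<^bold>* t) = tsubst \<sigma> s \<^bold>* tsubst \<sigma> t"

text \<open>The term \<open>t\<close> moved under \<open>n\<close> additional number quantifiers.\<close>

definition shift :: "tm \<Rightarrow> nat \<Rightarrow> tm" (infixl "\<up>" 80) where
  "t \<up> n = tsubst (\<lambda>i. Var (i + n)) t"

text \<open>Simultaneous capture-avoiding substitution of number terms and of set variables.\<close>

primrec subst :: "(nat \<Rightarrow> tm) \<Rightarrow> (nat \<Rightarrow> nat) \<Rightarrow> fm \<Rightarrow> fm" where
  "subst \<sigma> \<rho> FF = FF"
| "subst \<sigma> \<rho> (s \<^bold>= t) = (tsubst \<sigma> s \<^bold>= tsubst \<sigma> t)"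
| "subst \<sigma> \<rho> (s \<^bold>< t) = (tsubst \<sigma> s \<^bold>< tsubst \<sigma> t)"
| "subst \<sigma> \<rho> (t \<^bold>\<in> X) = (tsubst \<sigma> t \<^bold>\<in> \<rho> X)"
| "subst \<sigma> \<rho> (\<phi> \<^bold>\<longrightarrow> \<psi>) = (subst \<sigma> \<rho> \<phi> \<^bold>\<longrightarrow> subst \<sigma> \<rho> \<psi>)"
| "subst \<sigma> \<rho> (AllN \<phi>) = AllN (subst (case_nat (Var 0) (\<lambda>i. \<sigma> i \<up> 1)) \<rho> \<phi>)"
| "subst \<sigma> \<rho> (AllS \<phi>) = AllS (subst \<sigma> (case_nat 0 (\<lambda>X. Suc (\<rho> X))) \<phi>)"

definition liftN :: "fm \<Rightarrow> fm" where
  "liftN \<phi> = subst (\<lambda>i. Var (Suc i)) (\<lambda>X. X) \<phi>"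

definition liftS :: "fm \<Rightarrow> fm" where
  "liftS \<phi> = subst Var Suc \<phi>"

definition instN :: "tm \<Rightarrow> fm \<Rightarrow> fm" where
  "instN t \<phi> = subst (case_nat t Var) (\<lambda>X. X) \<phi>"

definition instS :: "nat \<Rightarrow> fm \<Rightarrow> fm" where
  "instS Y \<phi> = subst Var (case_nat Y (\<lambda>X. X)) \<phi>"


subsection \<open>Provability\<close>

text \<open>
  A Hilbert calculus for classical two-sorted first-order logic with equality. Because of the
  generalisation rules, axioms in \<open>A\<close> with free variables count as universally closed.
\<close>

inductive provable :: "fm set \<Rightarrow> fm \<Rightarrow> bool" (infix "\<turnstile>" 20) for A :: "fm set" where
  Axiom: "\<phi> \<in> A \<Longrightarrow> A \<turnstile> \<phi>"
| K: "A \<turnstile> \<phi> \<^bold>\<longrightarrow> \<psi> \<^bold>\<longrightarrow> \<phi>"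
| S: "A \<turnstile> (\<phi> \<^bold>\<longrightarrow> \<psi> \<^bold>\<longrightarrow> \<chi>) \<^bold>\<longrightarrow> (\<phi> \<^bold>\<longrightarrow> \<psi>) \<^bold>\<longrightarrow> \<phi> \<^bold>\<longrightarrow> \<chi>"
| DN: "A \<turnstile> \<^bold>\<not> (\<^bold>\<not> \<phi>) \<^bold>\<longrightarrow> \<phi>"
| EqRefl: "A \<turnstile> t \<^bold>= t"
| EqSubst: "A \<turnstile> s \<^bold>= t \<^bold>\<longrightarrow> instN s \<phi> \<^bold>\<longrightarrow> instN t \<phi>"
| InstN: "A \<turnstile> AllN \<phi> \<^bold>\<longrightarrow> instN t \<phi>"
| InstS: "A \<turnstile> AllS \<phi> \<^bold>\<longrightarrow> instS Y \<phi>"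
| DistN: "A \<turnstile> AllN (liftN \<phi> \<^bold>\<longrightarrow> \<psi>) \<^bold>\<longrightarrow> \<phi> \<^bold>\<longrightarrow> AllN \<psi>"
| DistS: "A \<turnstile> AllS (liftS \<phi> \<^bold>\<longrightarrow> \<psi>) \<^bold>\<longrightarrow> \<phi> \<^bold>\<longrightarrow> AllS \<psi>"
| MP: "A \<turnstile> \<phi> \<^bold>\<longrightarrow> \<psi> \<Longrightarrow> A \<turnstile> \<phi> \<Longrightarrow> A \<turnstile> \<psi>"
| GenN: "A \<turnstile> \<phi> \<Longrightarrow> A \<turnstile> AllN \<phi>"
| GenS: "A \<turnstile> \<phi> \<Longrightarrow> A \<turnstile> AllS \<phi>"


subsection \<open>The axioms of \<open>RCA\<^sub>0\<close>\<close>

inductive Delta0 :: "fm \<Rightarrow> bool" where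
  "Delta0 FF"
| "Delta0 (s \<^bold>= t)"
| "Delta0 (s \<^bold>< t)"
| "Delta0 (t \<^bold>\<in> X)"
| "Delta0 \<phi> \<Longrightarrow> Delta0 \<psi> \<Longrightarrow> Delta0 (\<phi> \<^bold>\<longrightarrow> \<psi>)"
| "Delta0 \<phi> \<Longrightarrow> Delta0 (AllN (Var 0 \<^bold>< t \<up> 1 \<^bold>\<longrightarrow> \<phi>))"
| "Delta0 \<phi> \<Longrightarrow> Delta0 (ExN (Var 0 \<^bold>< t \<up> 1 \<^bold>\<and> \<phi>))"

definition Sigma1 :: "fm \<Rightarrow> bool" where
  "Sigma1 \<phi> \<longleftrightarrow> (\<exists>\<theta>. Delta0 \<theta> \<and> \<phi> = ExN \<theta>)"

definition Pi1 :: "fm \<Rightarrow> bool" where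
  "Pi1 \<phi> \<longleftrightarrow> (\<exists>\<theta>. Delta0 \<theta> \<and> \<phi> = AllN \<theta>)"

definition basic_axioms :: "fm set" where
  "basic_axioms =
    {\<^bold>\<not> (Var 0 \<^bold>+ One \<^bold>= Zero),
     Var 0 \<^bold>+ One \<^bold>= Var 1 \<^bold>+ One \<^bold>\<longrightarrow> Var 0 \<^bold>= Var 1,
     Var 0 \<^bold>+ Zero \<^bold>= Var 0,
     Var 0 \<^bold>+ (Var 1 \<^bold>+ One) \<^bold>= (Var 0 \<^bold>+ Var 1) \<^bold>+ One,
     Var 0 \<^bold>* Zero \<^bold>= Zero,
     Var 0 \<^bold>* (Var 1 \<^bold>+ One) \<^bold>= Var 0 \<^bold>* Var 1 \<^bold>+ Var 0,
     \<^bold>\<not> (Var 0 \<^bold>< Zero),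
     Var 0 \<^bold>< Var 1 \<^bold>+ One \<^bold>\<longleftrightarrow> Var 0 \<^bold>< Var 1 \<^bold>\<or> Var 0 \<^bold>= Var 1}"

text \<open>In both schemes number index 0 is the distinguished variable; all other variables,
  of either sort, are parameters.\<close>

definition induction_axiom :: "fm \<Rightarrow> fm" where
  "induction_axiom \<phi> =
    (instN Zero \<phi> \<^bold>\<and> AllN (\<phi> \<^bold>\<longrightarrow> subst (case_nat (Var 0 \<^bold>+ One) (\<lambda>i. Var (Suc i))) (\<lambda>X. X) \<phi>)
      \<^bold>\<longrightarrow> AllN \<phi>)"

definition Delta1_comprehension_axiom :: "fm \<Rightarrow> fm \<Rightarrow> fm" where
  "Delta1_comprehension_axiom \<phi> \<psi> =
    (AllN (\<phi> \<^bold>\<longleftrightarrow> \<psi>) \<^bold>\<longrightarrow> ExS (AllN (Var 0 \<^bold>\<in> 0 \<^bold>\<longleftrightarrow> liftS \<phi>)))"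

definition RCA0 :: "fm set" where
  "RCA0 = basic_axioms
    \<union> {induction_axiom \<phi> | \<phi>. Sigma1 \<phi>}
    \<union> {Delta1_comprehension_axiom \<phi> \<psi> | \<phi> \<psi>. Sigma1 \<phi> \<and> Pi1 \<psi>}"


subsection \<open>Numerals, pairs, finite sets and functions\<close>

primrec num :: "nat \<Rightarrow> tm" where
  "num 0 = Zero"
| "num (Suc n) = num n \<^bold>+ One"

definition pair :: "tm \<Rightarrow> tm \<Rightarrow> tm" where
  "pair s t = (s \<^bold>+ t) \<^bold>* (s \<^bold>+ t) \<^bold>+ s"

text \<open>\<open>ExUniqueN \<phi>\<close> is \<open>\<exists>y. \<forall>z. \<phi>(z) \<longleftrightarrow> z = y\<close>; the substitution makes room for \<open>y\<close> at index 1.\<close>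

definition ExUniqueN :: "fm \<Rightarrow> fm" where
  "ExUniqueN \<phi> =
    ExN (AllN (subst (case_nat (Var 0) (\<lambda>i. Var (i + 2))) (\<lambda>X. X) \<phi> \<^bold>\<longleftrightarrow> Var 0 \<^bold>= Var 1))"

definition Subset :: "nat \<Rightarrow> nat \<Rightarrow> fm" where
  "Subset X Y = AllN (Var 0 \<^bold>\<in> X \<^bold>\<longrightarrow> Var 0 \<^bold>\<in> Y)"

definition Finite :: "nat \<Rightarrow> fm" where
  "Finite X = ExN (AllN (Var 0 \<^bold>\<in> X \<^bold>\<longrightarrow> Var 0 \<^bold>< Var 1))"

definition Infinite :: "nat \<Rightarrow> fm" where
  "Infinite X = (\<^bold>\<not> Finite X)"

text \<open>The set \<open>f\<close> is (the graph of) a function from the set \<open>X\<close> to \<open>{0, ..., k - 1}\<close>.\<close>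

definition Function :: "nat \<Rightarrow> nat \<Rightarrow> nat \<Rightarrow> fm" where
  "Function k X f =
    (AllN (Var 0 \<^bold>\<in> f \<^bold>\<longrightarrow>
        ExN (ExN (Var 1 \<^bold>\<in> X \<^bold>\<and> Var 0 \<^bold>< num k \<^bold>\<and> Var 2 \<^bold>= pair (Var 1) (Var 0))))
     \<^bold>\<and> AllN (Var 0 \<^bold>\<in> X \<^bold>\<longrightarrow> ExUniqueN (pair (Var 1) (Var 0) \<^bold>\<in> f)))"


subsection \<open>Finite strings\<close>

text \<open>
  The usual coding: a number \<open>c = (k, (m, n))\<close> represents the finite set of all \<open>i < k\<close> such that
  \<open>m (i + 1) + 1\<close> divides \<open>n\<close>, and the code of a finite set is the least number representing it.
  Numbers not of the form \<open>(k, (m, n))\<close> represent the empty set here; this creates no further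
  codes, because \<open>0 = (0, (0, 0))\<close>. Strings have unique codes, so a set of strings is infinite
  iff the set of codes is.
\<close>

definition Divides :: "tm \<Rightarrow> tm \<Rightarrow> fm" where
  "Divides s t = ExN (s \<up> 1 \<^bold>* Var 0 \<^bold>= t \<up> 1)"

definition Elem :: "tm \<Rightarrow> tm \<Rightarrow> fm" where
  "Elem i c = ExN (ExN (ExN
    (c \<up> 3 \<^bold>= pair (Var 2) (pair (Var 1) (Var 0))
     \<^bold>\<and> i \<up> 3 \<^bold>< Var 2
     \<^bold>\<and> Divides (Var 1 \<^bold>* (i \<up> 3 \<^bold>+ One) \<^bold>+ One) (Var 0))))"

definition FinSetCode :: "tm \<Rightarrow> fm" where
  "FinSetCode c =
    AllN (Var 0 \<^bold>< c \<up> 1 \<^bold>\<longrightarrow> \<^bold>\<not> AllN (Elem (Var 0) (Var 1) \<^bold>\<longleftrightarrow> Elem (Var 0) (c \<up> 2)))"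

text \<open>\<open>String s l\<close>: \<open>s\<close> codes (the graph of) a finite string of length \<open>l\<close>.\<close>

definition String :: "tm \<Rightarrow> tm \<Rightarrow> fm" where
  "String s l =
    (FinSetCode s
     \<^bold>\<and> AllN (Elem (Var 0) (s \<up> 1) \<^bold>\<longrightarrow>
          ExN (ExN (Var 1 \<^bold>< l \<up> 3 \<^bold>\<and> Var 2 \<^bold>= pair (Var 1) (Var 0))))
     \<^bold>\<and> AllN (Var 0 \<^bold>< l \<up> 1 \<^bold>\<longrightarrow> ExUniqueN (Elem (pair (Var 1) (Var 0)) (s \<up> 2))))"

definition BinString :: "tm \<Rightarrow> fm" where
  "BinString s =
    (ExN (String (s \<up> 1) (Var 0))
     \<^bold>\<and> AllN (AllN (Elem (pair (Var 1) (Var 0)) (s \<up> 2) \<^bold>\<longrightarrow> Var 0 \<^bold>< num 2)))"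

text \<open>\<open>s\<close> is an initial segment of \<open>t\<close>: whenever \<open>s(i) = c\<close>, also \<open>t(i) = c\<close>.\<close>

definition InitSeg :: "tm \<Rightarrow> tm \<Rightarrow> fm" where
  "InitSeg s t =
    AllN (AllN (Elem (pair (Var 1) (Var 0)) (s \<up> 2) \<^bold>\<longrightarrow> Elem (pair (Var 1) (Var 0)) (t \<up> 2)))"


subsection \<open>The Ramsey-type weak Koenig lemma\<close>

definition BinTree :: "nat \<Rightarrow> fm" where
  "BinTree T =
    (AllN (Var 0 \<^bold>\<in> T \<^bold>\<longrightarrow> BinString (Var 0))
     \<^bold>\<and> AllN (AllN (Var 1 \<^bold>\<in> T \<^bold>\<and> BinString (Var 0) \<^bold>\<and> InitSeg (Var 0) (Var 1) \<^bold>\<longrightarrow> Var 0 \<^bold>\<in> T)))"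

text \<open>The bound variables are the colour (index 2), the length of \<open>s\<close> (index 1) and \<open>i \<in> H\<close>
  (index 0).\<close>

definition HomogeneousString :: "nat \<Rightarrow> tm \<Rightarrow> fm" where
  "HomogeneousString H s =
    ExN (Var 0 \<^bold>< num 2 \<^bold>\<and>
      ExN (String (s \<up> 2) (Var 0) \<^bold>\<and>
        AllN (Var 0 \<^bold>\<in> H \<^bold>\<longrightarrow> Var 0 \<^bold>< Var 1 \<^bold>\<longrightarrow> Elem (pair (Var 0) (Var 2)) (s \<up> 3))))"

text \<open>\<open>{s \<in> T. H is homogeneous for s}\<close> is infinite.\<close>

definition HomogeneousTree :: "nat \<Rightarrow> nat \<Rightarrow> fm" where
  "HomogeneousTree H T =
    (\<^bold>\<not> ExN (AllN (Var 0 \<^bold>\<in> T \<^bold>\<and> HomogeneousString H (Var 0) \<^bold>\<longrightarrow> Var 0 \<^bold>< Var 1)))"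

definition RWKL :: fm where
  "RWKL = AllS (BinTree 0 \<^bold>\<and> Infinite 0 \<^bold>\<longrightarrow> ExS (Infinite 0 \<^bold>\<and> HomogeneousTree 0 1))"


subsection \<open>Ramsey-type graph colouring\<close>

text \<open>Simple undirected graphs: the edge relation is a symmetric irreflexive relation on \<open>V\<close>.\<close>

definition Graph :: "nat \<Rightarrow> nat \<Rightarrow> fm" where
  "Graph V E =
    (AllN (Var 0 \<^bold>\<in> E \<^bold>\<longrightarrow> ExN (ExN (Var 1 \<^bold>\<in> V \<^bold>\<and> Var 0 \<^bold>\<in> V \<^bold>\<and> Var 2 \<^bold>= pair (Var 1) (Var 0))))
     \<^bold>\<and> AllN (\<^bold>\<not> (pair (Var 0) (Var 0) \<^bold>\<in> E))
     \<^bold>\<and> AllN (AllN (pair (Var 1) (Var 0) \<^bold>\<in> E \<^bold>\<longrightarrow> pair (Var 0) (Var 1) \<^bold>\<in> E)))"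

text \<open>Edges of \<open>E\<close> leaving \<open>V\<close> are ignored, so for \<open>V\<^sub>0 \<subseteq> V\<close> the formula \<open>Coloring k V\<^sub>0 E f\<close>
  speaks about the subgraph of \<open>(V, E)\<close> induced by \<open>V\<^sub>0\<close>.\<close>

definition Coloring :: "nat \<Rightarrow> nat \<Rightarrow> nat \<Rightarrow> nat \<Rightarrow> fm" where
  "Coloring k V E f =
    (Function k V f
     \<^bold>\<and> AllN (AllN (Var 1 \<^bold>\<in> V \<^bold>\<and> Var 0 \<^bold>\<in> V \<^bold>\<and> pair (Var 1) (Var 0) \<^bold>\<in> E \<^bold>\<longrightarrow>
          \<^bold>\<not> ExN (pair (Var 2) (Var 0) \<^bold>\<in> f \<^bold>\<and> pair (Var 1) (Var 0) \<^bold>\<in> f))))"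

definition Colorable :: "nat \<Rightarrow> nat \<Rightarrow> nat \<Rightarrow> fm" where
  "Colorable k V E = ExS (Coloring k (Suc V) (Suc E) 0)"

text \<open>Under the two set quantifiers, \<open>(1, 0)\<close> is the finite subgraph and \<open>(V + 2, E + 2)\<close> the
  given graph.\<close>

definition LocallyColorable :: "nat \<Rightarrow> nat \<Rightarrow> nat \<Rightarrow> fm" where
  "LocallyColorable k V E =
    AllS (AllS (Graph 1 0 \<^bold>\<and> Finite 1 \<^bold>\<and> Subset 1 (V + 2) \<^bold>\<and> Subset 0 (E + 2) \<^bold>\<longrightarrow> Colorable k 1 0))"

text \<open>Under the two set quantifiers, \<open>1\<close> is the finite set \<open>V\<^sub>0 \<subseteq> V\<close> and \<open>0\<close> the colouring.\<close>

definition HomogeneousGraph :: "nat \<Rightarrow> nat \<Rightarrow> nat \<Rightarrow> nat \<Rightarrow> fm" where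
  "HomogeneousGraph k V E H =
    (Subset H V
     \<^bold>\<and> AllS (Finite 0 \<^bold>\<and> Subset 0 (V + 1) \<^bold>\<longrightarrow>
          ExS (Coloring k 1 (E + 2) 0
               \<^bold>\<and> AllN (Var 0 \<^bold>\<in> 1 \<^bold>\<and> Var 0 \<^bold>\<in> (H + 2) \<^bold>\<longrightarrow> pair (Var 0) Zero \<^bold>\<in> 0))))"

text \<open>Set indices: \<open>V = 1\<close> and \<open>E = 0\<close>, respectively \<open>V = 2\<close>, \<open>E = 1\<close> and \<open>H = 0\<close>.\<close>

definition RCOLOR :: "nat \<Rightarrow> fm" where
  "RCOLOR k =
    AllS (AllS (Graph 1 0 \<^bold>\<and> Infinite 1 \<^bold>\<and> LocallyColorable k 1 0 \<^bold>\<longrightarrow>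
      ExS (Infinite 0 \<^bold>\<and> HomogeneousGraph k 2 1 0)))"

text \<open>Set indices: \<open>V = 2\<close>, \<open>E = 1\<close> and \<open>X = 0\<close>, respectively \<open>V = 3\<close>, \<open>E = 2\<close>, \<open>X = 1\<close> and
  \<open>H = 0\<close>.\<close>

definition LRCOLOR :: "nat \<Rightarrow> fm" where
  "LRCOLOR k =
    AllS (AllS (AllS
      (Graph 2 1 \<^bold>\<and> Infinite 2 \<^bold>\<and> LocallyColorable k 2 1 \<^bold>\<and> Subset 0 2 \<^bold>\<and> Infinite 0 \<^bold>\<longrightarrow>
        ExS (Infinite 0 \<^bold>\<and> Subset 0 1 \<^bold>\<and> HomogeneousGraph k 3 2 0))))"

end

theory Submission
  imports Defs "HOL-Library.Countable_Set"
begin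

text \<open>
  By completeness of the calculus it suffices to show that the equivalences hold in every model of
  \<open>RCA\<^sub>0\<close>, so that the argument can be carried out by ordinary mathematics inside such a model. Its
  numbers form an ordered semiring, and its sets are used through two notions: a predicate is
  decidable if its extension is a set of the model, and a function is computable if its graph is one.
  \<open>\<Delta>\<^sub>1\<close> comprehension makes these notions closed under Boolean operations, bounded quantification,
  composition and minimisation, and \<open>\<Sigma>\<^sub>1\<close> induction then yields codes for bounded sets, primitive
  recursion, and a computable bound on the codes of subsets of \<open>{0, ..., n - 1}\<close>. With that bound, the
  existence of a finite colouring with given properties is a decidable question.

  \<open>RWKL\<close> gives \<open>LRCOLOR\<close> by removing one colour at a time. Call \<open>H\<close> good for a set \<open>C\<close> of colours if
  every finite part of the graph has a colouring that uses only colours from \<open>C\<close> on \<open>H\<close>. A given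
  infinite set is good for the set of all \<open>k\<close> colours. If it is good for \<open>C \<union> {c}\<close>, then the
  patterns that say which of its elements have colour \<open>c\<close> form an infinite binary tree, and a
  homogeneous set for the tree is an infinite subset that is good for \<open>C\<close> or for \<open>{c}\<close>
  (\<open>good_split\<close>). A single remaining colour can be renamed to 0.

  \<open>LRCOLOR\<close> contains \<open>RCOLOR\<close> as the case \<open>X = V\<close>.

  \<open>RCOLOR\<close> gives \<open>RWKL\<close> by a graph whose 3-colourings describe paths of the tree. The difficulty is that
  a homogeneous set may consist of auxiliary vertices only. Therefore every vertex outside of a
  finite set is attached to some bit \<open>n\<close> of the path in such a way that its colour always determines
  this bit (\<open>decode\<close>), while only finitely many vertices are attached to each bit. An infinite set of
  vertices of the same colour then determines infinitely many bits, and so infinitely many bits that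
  have the same value. The constraints that can be imposed by such vertices are weak. They suffice
  because the graph has a vertex for every string, which says whether the string is on the path: given
  the bits, it is enough to pass this mark on from a string to its extensions, and to forbid it for the
  strings outside of the tree.
\<close>

section \<open>Substitution\<close>

lemma tsubst_tsubst [simp]: "tsubst \<sigma> (tsubst \<tau> t) = tsubst (\<lambda>i. tsubst \<sigma> (\<tau> i)) t"
  by (induction t) auto

lemma tsubst_Var [simp]: "tsubst Var t = t"
  by (induction t) auto

lemma tsubst_shift [simp]: "tsubst \<sigma> (t \<up> n) = tsubst (\<lambda>i. \<sigma> (i + n)) t"
  by (simp add: shift_def)

lemma subst_subst:
  "subst \<sigma> \<rho> (subst \<sigma>' \<rho>' \<phi>) = subst (\<lambda>i. tsubst \<sigma> (\<sigma>' i)) (\<lambda>X. \<rho> (\<rho>' X)) \<phi>"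
proof (induction \<phi> arbitrary: \<sigma> \<rho> \<sigma>' \<rho>')
  case (AllN \<phi>)
  have "(\<lambda>i. tsubst (case_nat (Var 0) (\<lambda>i. \<sigma> i \<up> Suc 0)) (case_nat (Var 0) (\<lambda>i. \<sigma>' i \<up> Suc 0) i))
      = case_nat (Var 0) (\<lambda>i. tsubst \<sigma> (\<sigma>' i) \<up> Suc 0)"
    by (rule ext) (auto split: nat.split simp: shift_def)
  with AllN show ?case by simp
next
  case (AllS \<phi>)
  have "(\<lambda>X. case_nat 0 (\<lambda>X. Suc (\<rho> X)) (case_nat 0 (\<lambda>X. Suc (\<rho>' X)) X))
      = case_nat 0 (\<lambda>X. Suc (\<rho> (\<rho>' X)))"
    by (rule ext) (auto split: nat.split)
  with AllS show ?case by simp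
qed auto

lemma subst_Var [simp]: "subst Var (\<lambda>X. X) \<phi> = \<phi>"
proof (induction \<phi>)
  case (AllN \<phi>)
  have "case_nat (Var 0) (\<lambda>i. Var i \<up> Suc 0) = Var"
    by (rule ext) (auto split: nat.split simp: shift_def)
  with AllN show ?case by simp
next
  case (AllS \<phi>)
  have "case_nat 0 Suc = (\<lambda>X. X)"
    by (rule ext) (auto split: nat.split)
  with AllS show ?case by simp
qed auto

text \<open>
  All variables of the term, respectively all free variables of the formula, have indices below the given
  bounds. Bounds are all that is needed to find fresh variables.
\<close>

primrec tbounded :: "nat \<Rightarrow> tm \<Rightarrow> bool" where
  "tbounded n (Var i) \<longleftrightarrow> i < n"
| "tbounded n Zero \<longleftrightarrow> True"
| "tbounded n One \<longleftrightarrow> True"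
| "tbounded n (s \<^bold>+ t) \<longleftrightarrow> tbounded n s \<and> tbounded n t"
| "tbounded n (s \<^bold>* t) \<longleftrightarrow> tbounded n s \<and> tbounded n t"

primrec bounded :: "nat \<Rightarrow> nat \<Rightarrow> fm \<Rightarrow> bool" where
  "bounded n m FF \<longleftrightarrow> True"
| "bounded n m (s \<^bold>= t) \<longleftrightarrow> tbounded n s \<and> tbounded n t"
| "bounded n m (s \<^bold>< t) \<longleftrightarrow> tbounded n s \<and> tbounded n t"
| "bounded n m (t \<^bold>\<in> X) \<longleftrightarrow> tbounded n t \<and> X < m"
| "bounded n m (\<phi> \<^bold>\<longrightarrow> \<psi>) \<longleftrightarrow> bounded n m \<phi> \<and> bounded n m \<psi>"
| "bounded n m (AllN \<phi>) \<longleftrightarrow> bounded (Suc n) m \<phi>"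
| "bounded n m (AllS \<phi>) \<longleftrightarrow> bounded n (Suc m) \<phi>"

lemma tbounded_mono: "tbounded n t \<Longrightarrow> n \<le> n' \<Longrightarrow> tbounded n' t"
  by (induction t) auto

lemma bounded_mono: "bounded n m \<phi> \<Longrightarrow> n \<le> n' \<Longrightarrow> m \<le> m' \<Longrightarrow> bounded n' m' \<phi>"
  by (induction \<phi> arbitrary: n m n' m') (auto intro: tbounded_mono)

lemma ex_tbounded: "\<exists>n. tbounded n t"
proof (induction t)
  case (Plus s t)
  then show ?case by (metis tbounded_mono nat_le_linear tbounded.simps(4))
next
  case (Times s t)
  then show ?case by (metis tbounded_mono nat_le_linear tbounded.simps(5))
qed (auto intro: exI[of _ "Suc _"])

lemma ex_tbounded2: "\<exists>n. tbounded n s \<and> tbounded n t"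
  by (metis ex_tbounded tbounded_mono nat_le_linear)

lemma ex_bounded: "\<exists>n. bounded n n \<phi>"
proof (induction \<phi>)
  case (Mem t X)
  obtain n where "tbounded n t" using ex_tbounded by blast
  then have "tbounded (max n (Suc X)) t" by (rule tbounded_mono) simp
  then have "bounded (max n (Suc X)) (max n (Suc X)) (t \<^bold>\<in> X)" by simp
  then show ?case ..
next
  case (Imp \<phi> \<psi>)
  then obtain n m where "bounded n n \<phi>" "bounded m m \<psi>" by blast
  then have "bounded (max n m) (max n m) (\<phi> \<^bold>\<longrightarrow> \<psi>)" by (auto intro: bounded_mono)
  then show ?case ..
next
  case (AllN \<phi>)
  then obtain n where "bounded n n \<phi>" by blast
  then have "bounded n n (AllN \<phi>)" by (auto intro: bounded_mono)
  then show ?case ..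
next
  case (AllS \<phi>)
  then obtain n where "bounded n n \<phi>" by blast
  then have "bounded n n (AllS \<phi>)" by (auto intro: bounded_mono)
  then show ?case ..
qed (auto simp: ex_tbounded2)

lemma tsubst_cong: "tbounded n t \<Longrightarrow> (\<And>i. i < n \<Longrightarrow> \<sigma> i = \<sigma>' i) \<Longrightarrow> tsubst \<sigma> t = tsubst \<sigma>' t"
  by (induction t) auto

lemma subst_cong:
  "bounded n m \<phi> \<Longrightarrow> (\<And>i. i < n \<Longrightarrow> \<sigma> i = \<sigma>' i) \<Longrightarrow> (\<And>X. X < m \<Longrightarrow> \<rho> X = \<rho>' X)
    \<Longrightarrow> subst \<sigma> \<rho> \<phi> = subst \<sigma>' \<rho>' \<phi>"
proof (induction \<phi> arbitrary: n m \<sigma> \<sigma>' \<rho> \<rho>')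
  case (AllN \<phi>)
  show ?case
    by (simp, rule AllN.IH[of "Suc n" m]) (use AllN.prems in \<open>auto split: nat.split\<close>)
next
  case (AllS \<phi>)
  show ?case
    by (simp, rule AllS.IH[of n "Suc m"]) (use AllS.prems in \<open>auto split: nat.split\<close>)
next
  case (Imp \<phi> \<psi>)
  then show ?case by (metis bounded.simps(5) subst.simps(5))
qed (auto intro: tsubst_cong)

text \<open>
  Provability is closed under simultaneous substitution although the calculus only instantiates
  the outermost variable: instantiating variable 0 moves all other variables down, so \<open>k\<close> such steps
  deal with the variables below \<open>k\<close> in turn, provided that the term put in at step \<open>j\<close> is shifted up
  by the number of steps still to come.
\<close>

lemma provable_substN:
  assumes "A \<turnstile> \<phi>"
  shows "A \<turnstile> subst \<sigma> (\<lambda>X. X) \<phi>"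
proof -
  obtain k where k: "bounded k k \<phi>" using ex_bounded by blast
  define \<tau> where "\<tau> j i = (if i < j then \<sigma> i \<up> (k - j) else Var (i - j))" for j i
  have "j \<le> k \<Longrightarrow> A \<turnstile> subst (\<tau> j) (\<lambda>X. X) \<phi>" for j
  proof (induction j)
    case 0
    have "\<tau> 0 = Var" by (auto simp: \<tau>_def)
    then show ?case using assms by simp
  next
    case (Suc j)
    have "A \<turnstile> instN (\<sigma> j \<up> (k - Suc j)) (subst (\<tau> j) (\<lambda>X. X) \<phi>)"
      using Suc by (intro MP[OF InstN] GenN) simp
    moreover have "(\<lambda>i. tsubst (case_nat (\<sigma> j \<up> (k - Suc j)) Var) (\<tau> j i)) = \<tau> (Suc j)"
    proof
      fix i
      show "tsubst (case_nat (\<sigma> j \<up> (k - Suc j)) Var) (\<tau> j i) = \<tau> (Suc j) i"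
      proof (cases "i < j")
        case True
        have "k - j = Suc (k - Suc j)" using Suc by simp
        then have "case_nat (\<sigma> j \<up> (k - Suc j)) Var (n + (k - j)) = Var (n + (k - Suc j))" for n
          by simp
        with True show ?thesis by (simp add: \<tau>_def) (simp add: shift_def)
      next
        case False
        then show ?thesis by (cases "i = j") (auto simp: \<tau>_def Suc_diff_Suc split: nat.split)
      qed
    qed
    ultimately show ?case by (simp add: instN_def subst_subst)
  qed
  from this[of k] have "A \<turnstile> subst (\<tau> k) (\<lambda>X. X) \<phi>" by simp
  moreover have "subst (\<tau> k) (\<lambda>X. X) \<phi> = subst \<sigma> (\<lambda>X. X) \<phi>"
    by (rule subst_cong[OF k]) (auto simp: \<tau>_def shift_def)
  ultimately show ?thesis by simp
qed

lemma provable_substS: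
  assumes "A \<turnstile> \<phi>"
  shows "A \<turnstile> subst Var \<rho> \<phi>"
proof -
  obtain k where k: "bounded k k \<phi>" using ex_bounded by blast
  define \<tau> where "\<tau> j X = (if X < j then \<rho> X + (k - j) else X - j)" for j X
  have "j \<le> k \<Longrightarrow> A \<turnstile> subst Var (\<tau> j) \<phi>" for j
  proof (induction j)
    case 0
    have "\<tau> 0 = (\<lambda>X. X)" by (auto simp: \<tau>_def)
    then show ?case using assms by simp
  next
    case (Suc j)
    have "A \<turnstile> instS (\<rho> j + (k - Suc j)) (subst Var (\<tau> j) \<phi>)"
      using Suc by (intro MP[OF InstS] GenS) simp
    moreover have "(\<lambda>X. case_nat (\<rho> j + (k - Suc j)) (\<lambda>X. X) (\<tau> j X)) = \<tau> (Suc j)"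
    proof
      fix X
      consider "X < j" | "X = j" | n where "X = Suc (j + n)"
        by (metis less_iff_Suc_add linorder_neqE_nat)
      then show "case_nat (\<rho> j + (k - Suc j)) (\<lambda>X. X) (\<tau> j X) = \<tau> (Suc j) X"
      proof cases
        case 1
        have "k - j = Suc (k - Suc j)" using Suc by simp
        with 1 show ?thesis by (simp add: \<tau>_def)
      qed (simp_all add: \<tau>_def)
    qed
    ultimately show ?case by (simp add: instS_def subst_subst)
  qed
  from this[of k] have "A \<turnstile> subst Var (\<tau> k) \<phi>" by simp
  moreover have "subst Var (\<tau> k) \<phi> = subst Var \<rho> \<phi>"
    by (rule subst_cong[OF k]) (auto simp: \<tau>_def)
  ultimately show ?thesis by simp
qed

lemma provable_subst: "A \<turnstile> \<phi> \<Longrightarrow> A \<turnstile> subst \<sigma> \<rho> \<phi>"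
  using provable_substS[OF provable_substN[of A \<phi> \<sigma>], of \<rho>] by (simp add: subst_subst)


section \<open>Completeness\<close>

text \<open>
  Consequences of \<open>\<Gamma>\<close> whose free variables are read as constants: generalisation is not applied to
  the members of \<open>\<Gamma>\<close>, and therefore the deduction theorem holds for open formulas.
\<close>

inductive derivable :: "fm set \<Rightarrow> fm set \<Rightarrow> fm \<Rightarrow> bool" for A \<Gamma> where
  Prov: "A \<turnstile> \<phi> \<Longrightarrow> derivable A \<Gamma> \<phi>"
| Hyp: "\<phi> \<in> \<Gamma> \<Longrightarrow> derivable A \<Gamma> \<phi>"
| DMP: "derivable A \<Gamma> (\<phi> \<^bold>\<longrightarrow> \<psi>) \<Longrightarrow> derivable A \<Gamma> \<phi> \<Longrightarrow> derivable A \<Gamma> \<psi>"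

lemma derivable_mono: "derivable A \<Gamma> \<phi> \<Longrightarrow> \<Gamma> \<subseteq> \<Delta> \<Longrightarrow> derivable A \<Delta> \<phi>"
  by (induction rule: derivable.induct) (auto intro: derivable.intros)

lemma derivable_empty: "derivable A {} \<phi> \<Longrightarrow> A \<turnstile> \<phi>"
  by (induction rule: derivable.induct) (auto intro: MP)

lemma derivable_finite:
  "derivable A \<Gamma> \<phi> \<Longrightarrow> \<exists>\<Delta>. finite \<Delta> \<and> \<Delta> \<subseteq> \<Gamma> \<and> derivable A \<Delta> \<phi>"
proof (induction rule: derivable.induct)
  case (Prov \<phi>)
  then show ?case by (intro exI[of _ "{}"]) (auto intro: derivable.Prov)
next
  case (Hyp \<phi>)
  then show ?case by (intro exI[of _ "{\<phi>}"]) (auto intro: derivable.Hyp)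
next
  case (DMP \<phi> \<psi>)
  then obtain \<Delta> \<Delta>' where "finite \<Delta>" "\<Delta> \<subseteq> \<Gamma>" "derivable A \<Delta> (\<phi> \<^bold>\<longrightarrow> \<psi>)"
    "finite \<Delta>'" "\<Delta>' \<subseteq> \<Gamma>" "derivable A \<Delta>' \<phi>" by blast
  then show ?case
    by (intro exI[of _ "\<Delta> \<union> \<Delta>'"]) (auto intro: derivable.DMP derivable_mono)
qed

lemma provable_refl: "A \<turnstile> \<phi> \<^bold>\<longrightarrow> \<phi>"
  by (rule MP[OF MP[OF S K] K[of _ \<phi> \<phi>]])

lemma deduction: "derivable A (insert \<chi> \<Gamma>) \<phi> \<Longrightarrow> derivable A \<Gamma> (\<chi> \<^bold>\<longrightarrow> \<phi>)"
proof (induction rule: derivable.induct)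
  case (Prov \<phi>)
  then show ?case by (intro derivable.Prov MP[OF K])
next
  case (Hyp \<phi>)
  then show ?case
    by (auto intro: derivable.Prov provable_refl derivable.DMP[OF derivable.Prov[OF K]] derivable.Hyp)
next
  case (DMP \<phi> \<psi>)
  then show ?case by (blast intro: derivable.DMP derivable.Prov[OF S])
qed

lemma derivable_subst:
  "derivable A \<Gamma> \<phi> \<Longrightarrow> derivable A (subst \<sigma> \<rho> ` \<Gamma>) (subst \<sigma> \<rho> \<phi>)"
proof (induction rule: derivable.induct)
  case (DMP \<phi> \<psi>)
  then show ?case using derivable.DMP by fastforce
qed (auto intro: derivable.Prov derivable.Hyp provable_subst)

lemma derivable_GenN:
  "finite \<Gamma> \<Longrightarrow> derivable A (liftN ` \<Gamma>) \<phi> \<Longrightarrow> derivable A \<Gamma> (AllN \<phi>)"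
proof (induction \<Gamma> arbitrary: \<phi> rule: finite_induct)
  case empty
  then show ?case by (auto intro: derivable.Prov GenN derivable_empty)
next
  case (insert \<chi> \<Gamma>)
  have "derivable A \<Gamma> (AllN (liftN \<chi> \<^bold>\<longrightarrow> \<phi>))"
    using insert by (auto intro: deduction)
  then have "derivable A \<Gamma> (\<chi> \<^bold>\<longrightarrow> AllN \<phi>)"
    by (rule derivable.DMP[OF derivable.Prov[OF DistN]])
  then have "derivable A (insert \<chi> \<Gamma>) (\<chi> \<^bold>\<longrightarrow> AllN \<phi>)" by (rule derivable_mono) auto
  then show ?case by (auto intro: derivable.DMP derivable.Hyp)
qed

lemma derivable_GenS:
  "finite \<Gamma> \<Longrightarrow> derivable A (liftS ` \<Gamma>) \<phi> \<Longrightarrow> derivable A \<Gamma> (AllS \<phi>)"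
proof (induction \<Gamma> arbitrary: \<phi> rule: finite_induct)
  case empty
  then show ?case by (auto intro: derivable.Prov GenS derivable_empty)
next
  case (insert \<chi> \<Gamma>)
  have "derivable A \<Gamma> (AllS (liftS \<chi> \<^bold>\<longrightarrow> \<phi>))"
    using insert by (auto intro: deduction)
  then have "derivable A \<Gamma> (\<chi> \<^bold>\<longrightarrow> AllS \<phi>)"
    by (rule derivable.DMP[OF derivable.Prov[OF DistS]])
  then have "derivable A (insert \<chi> \<Gamma>) (\<chi> \<^bold>\<longrightarrow> AllS \<phi>)" by (rule derivable_mono) auto
  then show ?case by (auto intro: derivable.DMP derivable.Hyp)
qed

text \<open>A fresh variable is as good as a bound one: rename it to index 0 and all others one up.\<close>

lemma derivable_freshN:
  assumes "finite \<Gamma>" and \<Gamma>: "\<forall>\<chi>\<in>\<Gamma>. bounded x x \<chi>" and \<phi>: "bounded x x (AllN \<phi>)"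
    and "derivable A \<Gamma> (instN (Var x) \<phi>)"
  shows "derivable A \<Gamma> (AllN \<phi>)"
proof (rule derivable_GenN[OF \<open>finite \<Gamma>\<close>])
  define \<sigma> where "\<sigma> i = (if i = x then Var 0 else Var (Suc i))" for i
  have "subst \<sigma> (\<lambda>X. X) \<chi> = liftN \<chi>" if "\<chi> \<in> \<Gamma>" for \<chi>
    unfolding liftN_def by (rule subst_cong[OF \<Gamma>[rule_format, OF that]]) (auto simp: \<sigma>_def)
  then have "subst \<sigma> (\<lambda>X. X) ` \<Gamma> = liftN ` \<Gamma>" by auto
  moreover have "subst \<sigma> (\<lambda>X. X) (instN (Var x) \<phi>) = \<phi>"
  proof -
    have "subst (\<lambda>i. tsubst \<sigma> (case_nat (Var x) Var i)) (\<lambda>X. X) \<phi> = subst Var (\<lambda>X. X) \<phi>"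
      by (rule subst_cong[OF \<phi>[simplified]]) (auto simp: \<sigma>_def split: nat.split)
    then show ?thesis by (simp add: instN_def subst_subst)
  qed
  ultimately show "derivable A (liftN ` \<Gamma>) \<phi>"
    using derivable_subst[OF assms(4), of \<sigma> "\<lambda>X. X"] by simp
qed

lemma derivable_freshS:
  assumes "finite \<Gamma>" and \<Gamma>: "\<forall>\<chi>\<in>\<Gamma>. bounded x x \<chi>" and \<phi>: "bounded x x (AllS \<phi>)"
    and "derivable A \<Gamma> (instS x \<phi>)"
  shows "derivable A \<Gamma> (AllS \<phi>)"
proof (rule derivable_GenS[OF \<open>finite \<Gamma>\<close>])
  define \<rho> where "\<rho> i = (if i = x then 0 else Suc i)" for i
  have "subst Var \<rho> \<chi> = liftS \<chi>" if "\<chi> \<in> \<Gamma>" for \<chi>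
    unfolding liftS_def by (rule subst_cong[OF \<Gamma>[rule_format, OF that]]) (auto simp: \<rho>_def)
  then have "subst Var \<rho> ` \<Gamma> = liftS ` \<Gamma>" by auto
  moreover have "subst Var \<rho> (instS x \<phi>) = \<phi>"
  proof -
    have "subst (\<lambda>i. Var i) (\<lambda>X. \<rho> (case_nat x (\<lambda>X. X) X)) \<phi> = subst Var (\<lambda>X. X) \<phi>"
      by (rule subst_cong[OF \<phi>[simplified]]) (auto simp: \<rho>_def split: nat.split)
    then show ?thesis by (simp add: instS_def subst_subst)
  qed
  ultimately show "derivable A (liftS ` \<Gamma>) \<phi>"
    using derivable_subst[OF assms(4), of Var \<rho>] by simp
qed

definition consistent :: "fm set \<Rightarrow> fm set \<Rightarrow> bool" where
  "consistent A \<Gamma> \<longleftrightarrow> \<not> derivable A \<Gamma> FF"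

lemma derivable_DN: "derivable A \<Gamma> (\<^bold>\<not> (\<^bold>\<not> \<phi>)) \<Longrightarrow> derivable A \<Gamma> \<phi>"
  by (rule derivable.DMP[OF derivable.Prov[OF DN]])

lemma consistent_Neg: "consistent A (insert (\<^bold>\<not> \<phi>) \<Gamma>) \<longleftrightarrow> \<not> derivable A \<Gamma> \<phi>"
proof
  assume c: "consistent A (insert (\<^bold>\<not> \<phi>) \<Gamma>)"
  show "\<not> derivable A \<Gamma> \<phi>"
  proof
    assume "derivable A \<Gamma> \<phi>"
    then have "derivable A (insert (\<^bold>\<not> \<phi>) \<Gamma>) \<phi>" by (rule derivable_mono) auto
    moreover have "derivable A (insert (\<^bold>\<not> \<phi>) \<Gamma>) (\<phi> \<^bold>\<longrightarrow> FF)"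
      by (rule derivable.Hyp) (simp add: Neg_def)
    ultimately show False using c by (auto simp: consistent_def intro: derivable.DMP)
  qed
next
  assume "\<not> derivable A \<Gamma> \<phi>"
  then show "consistent A (insert (\<^bold>\<not> \<phi>) \<Gamma>)"
    unfolding consistent_def using deduction derivable_DN by (metis Neg_def)
qed

text \<open>
  The counterexample that \<open>\<not> \<forall>\<close> promises is named by a variable; negation is implication of falsity.
\<close>

fun witness :: "nat \<Rightarrow> fm \<Rightarrow> fm set" where
  "witness x (AllN \<phi> \<^bold>\<longrightarrow> FF) = {\<^bold>\<not> instN (Var x) \<phi>}"
| "witness x (AllS \<phi> \<^bold>\<longrightarrow> FF) = {\<^bold>\<not> instS x \<phi>}"
| "witness x _ = {}"

lemma finite_witness: "finite (witness x \<phi>)"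
  by (cases "(x, \<phi>)" rule: witness.cases) auto

lemma consistent_witness:
  assumes "finite \<Gamma>" "\<phi> \<in> \<Gamma>" "consistent A \<Gamma>" and b: "\<forall>\<chi>\<in>\<Gamma>. bounded x x \<chi>"
  shows "consistent A (\<Gamma> \<union> witness x \<phi>)"
proof (cases "(x, \<phi>)" rule: witness.cases)
  case (1 x' \<psi>)
  have "\<not> derivable A \<Gamma> (AllN \<psi>)"
    using assms 1 by (auto simp: consistent_def intro: derivable.DMP derivable.Hyp)
  moreover have "bounded x x (AllN \<psi>)" using b \<open>\<phi> \<in> \<Gamma>\<close> 1 by fastforce
  ultimately show ?thesis using 1 derivable_freshN[OF assms(1) b] by (auto simp: consistent_Neg)
next
  case (2 x' \<psi>)
  have "\<not> derivable A \<Gamma> (AllS \<psi>)"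
    using assms 2 by (auto simp: consistent_def intro: derivable.DMP derivable.Hyp)
  moreover have "bounded x x (AllS \<psi>)" using b \<open>\<phi> \<in> \<Gamma>\<close> 2 by fastforce
  ultimately show ?thesis using 2 derivable_freshS[OF assms(1) b] by (auto simp: consistent_Neg)
qed (use assms in auto)

definition fresh :: "fm set \<Rightarrow> nat" where
  "fresh \<Gamma> = (SOME x. \<forall>\<chi>\<in>\<Gamma>. bounded x x \<chi>)"

lemma fresh: "finite \<Gamma> \<Longrightarrow> \<forall>\<chi>\<in>\<Gamma>. bounded (fresh \<Gamma>) (fresh \<Gamma>) \<chi>"
  unfolding fresh_def
proof (rule someI_ex, induction rule: finite_induct)
  case (insert \<chi> \<Gamma>)
  then obtain x y where "\<forall>\<chi>\<in>\<Gamma>. bounded x x \<chi>" "bounded y y \<chi>" using ex_bounded by blast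
  then have "\<forall>\<chi>'\<in>insert \<chi> \<Gamma>. bounded (max x y) (max x y) \<chi>'"
    by (auto intro: bounded_mono)
  then show ?case ..
qed simp

instance tm :: countable by countable_datatype
instance fm :: countable by countable_datatype

text \<open>
  Only finitely many formulas are present at each stage, so that the free variables not yet used can
  play the role of the Henkin constants.
\<close>

primrec henkin_stage :: "fm set \<Rightarrow> fm set \<Rightarrow> nat \<Rightarrow> fm set" where
  "henkin_stage A \<Gamma> 0 = \<Gamma>"
| "henkin_stage A \<Gamma> (Suc n) =
    (let \<Delta> = insert (from_nat n) (henkin_stage A \<Gamma> n)
     in if consistent A \<Delta> then \<Delta> \<union> witness (fresh \<Delta>) (from_nat n) else henkin_stage A \<Gamma> n)"

text \<open>
  The properties of the set of formulas that are true under an assignment which names all numbers by terms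
  and all sets by set variables; they are what the induction in \<open>henkin_model\<close> consumes.
\<close>

definition henkin_theory :: "fm set \<Rightarrow> fm set \<Rightarrow> bool" where
  "henkin_theory A \<Theta> \<longleftrightarrow>
    (\<forall>\<phi>. (A \<turnstile> \<phi>) \<longrightarrow> \<phi> \<in> \<Theta>) \<and> FF \<notin> \<Theta>
    \<and> (\<forall>\<phi> \<psi>. (\<phi> \<^bold>\<longrightarrow> \<psi>) \<in> \<Theta> \<longleftrightarrow> (\<phi> \<in> \<Theta> \<longrightarrow> \<psi> \<in> \<Theta>))
    \<and> (\<forall>\<phi>. AllN \<phi> \<in> \<Theta> \<longleftrightarrow> (\<forall>t. instN t \<phi> \<in> \<Theta>))
    \<and> (\<forall>\<phi>. AllS \<phi> \<in> \<Theta> \<longleftrightarrow> (\<forall>Y. instS Y \<phi> \<in> \<Theta>))"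

theorem henkin_extension:
  assumes "finite \<Gamma>" "consistent A \<Gamma>"
  shows "\<exists>\<Theta>. \<Gamma> \<subseteq> \<Theta> \<and> henkin_theory A \<Theta>"
proof -
  let ?H = "henkin_stage A \<Gamma>"
  define \<Theta> where "\<Theta> = (\<Union>n. ?H n)"
  have fin: "finite (?H n)" for n
    using assms(1) by (induction n) (auto simp: Let_def finite_witness)
  have con: "consistent A (?H n)" for n
  proof (induction n)
    case (Suc n)
    then show ?case
      using consistent_witness[OF _ _ _ fresh, of "insert (from_nat n) (?H n)" "from_nat n" A]
      by (auto simp: Let_def fin)
  qed (use assms in auto)
  have Suc: "?H n \<subseteq> ?H (Suc n)" for n by (auto simp: Let_def)
  have mono: "?H n \<subseteq> ?H m" if "n \<le> m" for n m
    by (rule lift_Suc_mono_le[of ?H, OF Suc that])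
  have sub: "\<exists>n. \<Delta> \<subseteq> ?H n" if "finite \<Delta>" "\<Delta> \<subseteq> \<Theta>" for \<Delta>
    using that
  proof (induction rule: finite_induct)
    case (insert \<chi> \<Delta>)
    then obtain n m where "\<Delta> \<subseteq> ?H n" "\<chi> \<in> ?H m" by (auto simp: \<Theta>_def)
    then have "insert \<chi> \<Delta> \<subseteq> ?H (max n m)" using mono[of n "max n m"] mono[of m "max n m"] by auto
    then show ?case ..
  qed auto
  have con\<Theta>: "consistent A \<Theta>"
    unfolding consistent_def
  proof
    assume "derivable A \<Theta> FF"
    then obtain \<Delta> n where "derivable A \<Delta> FF" "\<Delta> \<subseteq> ?H n"
      using derivable_finite sub by metis
    then show False using con[of n] derivable_mono by (auto simp: consistent_def)
  qed
  have max: "\<phi> \<in> \<Theta> \<and> (\<exists>x. witness x \<phi> \<subseteq> \<Theta>)" if c: "consistent A (insert \<phi> \<Theta>)" for \<phi>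
  proof -
    define n where "n = to_nat \<phi>"
    then have n: "from_nat n = \<phi>" by simp
    have "consistent A (insert \<phi> (?H n))"
      using c derivable_mono[of A "insert \<phi> (?H n)" FF "insert \<phi> \<Theta>"]
      by (auto simp: consistent_def \<Theta>_def)
    then have "insert \<phi> (witness (fresh (insert \<phi> (?H n))) \<phi>) \<subseteq> ?H (Suc n)"
      by (auto simp: Let_def n)
    then show ?thesis unfolding \<Theta>_def by blast
  qed
  have closed: "\<phi> \<in> \<Theta>" if d: "derivable A \<Theta> \<phi>" for \<phi>
  proof -
    have "consistent A (insert \<phi> \<Theta>)"
      using con\<Theta> derivable.DMP[OF deduction d, of FF] by (auto simp: consistent_def)
    then show ?thesis using max by blast
  qed
  have neg: "(\<^bold>\<not> \<phi>) \<in> \<Theta> \<longleftrightarrow> \<phi> \<notin> \<Theta>" for \<phi>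
  proof
    show "\<phi> \<notin> \<Theta>" if "(\<^bold>\<not> \<phi>) \<in> \<Theta>"
      using con\<Theta> derivable.DMP[OF derivable.Hyp[OF that[unfolded Neg_def]] derivable.Hyp, of A]
      by (auto simp: consistent_def)
    show "(\<^bold>\<not> \<phi>) \<in> \<Theta>" if "\<phi> \<notin> \<Theta>"
      using max[of "\<^bold>\<not> \<phi>"] closed[of \<phi>] that by (auto simp: consistent_Neg)
  qed
  have imp: "(\<phi> \<^bold>\<longrightarrow> \<psi>) \<in> \<Theta> \<longleftrightarrow> (\<phi> \<in> \<Theta> \<longrightarrow> \<psi> \<in> \<Theta>)" for \<phi> \<psi>
  proof
    show "\<phi> \<in> \<Theta> \<longrightarrow> \<psi> \<in> \<Theta>" if "(\<phi> \<^bold>\<longrightarrow> \<psi>) \<in> \<Theta>"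
      using closed[OF derivable.DMP[OF derivable.Hyp[OF that] derivable.Hyp]] by simp
    assume "\<phi> \<in> \<Theta> \<longrightarrow> \<psi> \<in> \<Theta>"
    then show "(\<phi> \<^bold>\<longrightarrow> \<psi>) \<in> \<Theta>"
    proof (cases "\<phi> \<in> \<Theta>")
      case True
      with \<open>\<phi> \<in> \<Theta> \<longrightarrow> \<psi> \<in> \<Theta>\<close> have "derivable A (insert \<phi> \<Theta>) \<psi>"
        by (auto intro: derivable.Hyp)
      then show ?thesis by (intro closed deduction)
    next
      case False
      then have "derivable A \<Theta> (\<phi> \<^bold>\<longrightarrow> FF)" using neg by (auto simp: Neg_def intro: derivable.Hyp)
      then have "derivable A (insert (\<^bold>\<not> \<psi>) (insert \<phi> \<Theta>)) (\<phi> \<^bold>\<longrightarrow> FF)"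
        by (rule derivable_mono) auto
      then have "derivable A (insert (\<^bold>\<not> \<psi>) (insert \<phi> \<Theta>)) FF"
        by (rule derivable.DMP) (simp add: derivable.Hyp)
      then have "derivable A (insert \<phi> \<Theta>) \<psi>"
        using consistent_Neg[of A \<psi> "insert \<phi> \<Theta>"] by (simp add: consistent_def)
      then show ?thesis by (intro closed deduction)
    qed
  qed
  have allN: "AllN \<phi> \<in> \<Theta> \<longleftrightarrow> (\<forall>t. instN t \<phi> \<in> \<Theta>)" for \<phi>
  proof
    assume "AllN \<phi> \<in> \<Theta>"
    then show "\<forall>t. instN t \<phi> \<in> \<Theta>"
      by (auto intro: closed derivable.DMP[OF derivable.Prov[OF InstN]] derivable.Hyp)
  next
    assume *: "\<forall>t. instN t \<phi> \<in> \<Theta>"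
    show "AllN \<phi> \<in> \<Theta>"
    proof (rule ccontr)
      assume "AllN \<phi> \<notin> \<Theta>"
      then have "consistent A (insert (\<^bold>\<not> AllN \<phi>) \<Theta>)" using closed by (auto simp: consistent_Neg)
      then obtain x where "(\<^bold>\<not> instN (Var x) \<phi>) \<in> \<Theta>" using max[of "\<^bold>\<not> AllN \<phi>"] by (auto simp: Neg_def)
      then show False using * neg by blast
    qed
  qed
  have allS: "AllS \<phi> \<in> \<Theta> \<longleftrightarrow> (\<forall>Y. instS Y \<phi> \<in> \<Theta>)" for \<phi>
  proof
    assume "AllS \<phi> \<in> \<Theta>"
    then show "\<forall>Y. instS Y \<phi> \<in> \<Theta>"
      by (auto intro: closed derivable.DMP[OF derivable.Prov[OF InstS]] derivable.Hyp)
  next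
    assume *: "\<forall>Y. instS Y \<phi> \<in> \<Theta>"
    show "AllS \<phi> \<in> \<Theta>"
    proof (rule ccontr)
      assume "AllS \<phi> \<notin> \<Theta>"
      then have "consistent A (insert (\<^bold>\<not> AllS \<phi>) \<Theta>)" using closed by (auto simp: consistent_Neg)
      then obtain x where "(\<^bold>\<not> instS x \<phi>) \<in> \<Theta>" using max[of "\<^bold>\<not> AllS \<phi>"] by (auto simp: Neg_def)
      then show False using * neg by blast
    qed
  qed
  have "henkin_theory A \<Theta>"
    unfolding henkin_theory_def
    using con\<Theta> by (auto simp: consistent_def imp allN allS intro: closed derivable.Prov derivable.Hyp)
  moreover have "\<Gamma> \<subseteq> \<Theta>" unfolding \<Theta>_def by (auto intro!: exI[of _ 0])
  ultimately show ?thesis by blast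
qed

text \<open>The numbers are a whole type, so that they can later be given the structure of an ordered semiring.\<close>

record 'a so_structure =
  zero_of :: 'a
  one_of :: 'a
  plus_of :: "'a \<Rightarrow> 'a \<Rightarrow> 'a"
  times_of :: "'a \<Rightarrow> 'a \<Rightarrow> 'a"
  less_of :: "'a \<Rightarrow> 'a \<Rightarrow> bool"
  sets_of :: "'a set set"

primrec tval :: "'a so_structure \<Rightarrow> (nat \<Rightarrow> 'a) \<Rightarrow> tm \<Rightarrow> 'a" where
  "tval M e (Var i) = e i"
| "tval M e Zero = zero_of M"
| "tval M e One = one_of M"
| "tval M e (s \<^bold>+ t) = plus_of M (tval M e s) (tval M e t)"
| "tval M e (s \<^bold>* t) = times_of M (tval M e s) (tval M e t)"

primrec sat :: "'a so_structure \<Rightarrow> (nat \<Rightarrow> 'a) \<Rightarrow> (nat \<Rightarrow> 'a set) \<Rightarrow> fm \<Rightarrow> bool" where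
  "sat M e E FF \<longleftrightarrow> False"
| "sat M e E (s \<^bold>= t) \<longleftrightarrow> tval M e s = tval M e t"
| "sat M e E (s \<^bold>< t) \<longleftrightarrow> less_of M (tval M e s) (tval M e t)"
| "sat M e E (t \<^bold>\<in> X) \<longleftrightarrow> tval M e t \<in> E X"
| "sat M e E (\<phi> \<^bold>\<longrightarrow> \<psi>) \<longleftrightarrow> (sat M e E \<phi> \<longrightarrow> sat M e E \<psi>)"
| "sat M e E (AllN \<phi>) \<longleftrightarrow> (\<forall>x. sat M (case_nat x e) E \<phi>)"
| "sat M e E (AllS \<phi>) \<longleftrightarrow> (\<forall>X\<in>sets_of M. sat M e (case_nat X E) \<phi>)"

definition models :: "'a so_structure \<Rightarrow> fm set \<Rightarrow> bool" where
  "models M A \<longleftrightarrow> sets_of M \<noteq> {} \<and> (\<forall>\<phi>\<in>A. \<forall>e E. range E \<subseteq> sets_of M \<longrightarrow> sat M e E \<phi>)"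

lemma tval_tsubst [simp]: "tval M e (tsubst \<sigma> t) = tval M (\<lambda>i. tval M e (\<sigma> i)) t"
  by (induction t) auto

lemma tval_shift [simp]: "tval M e (t \<up> n) = tval M (\<lambda>i. e (i + n)) t"
  by (simp add: shift_def)

lemma sat_subst:
  "sat M e E (subst \<sigma> \<rho> \<phi>) \<longleftrightarrow> sat M (\<lambda>i. tval M e (\<sigma> i)) (\<lambda>X. E (\<rho> X)) \<phi>"
proof (induction \<phi> arbitrary: e E \<sigma> \<rho>)
  case (AllN \<phi>)
  have "(\<lambda>i. tval M (case_nat x e) (case_nat (Var 0) (\<lambda>i. \<sigma> i \<up> Suc 0) i)) = case_nat x (\<lambda>i. tval M e (\<sigma> i))" for x
    by (rule ext) (auto split: nat.split)
  with AllN show ?case by simp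
next
  case (AllS \<phi>)
  have "(\<lambda>i. case_nat X E (case_nat 0 (\<lambda>X. Suc (\<rho> X)) i)) = case_nat X (\<lambda>i. E (\<rho> i))" for X
    by (rule ext) (auto split: nat.split)
  with AllS show ?case by simp
qed auto

text \<open>
  The term model. Its numbers are the terms modulo the equations of the theory, which enter through a
  surjection \<open>d\<close> onto a type of our choice, and its sets are the denotations of the set variables.
\<close>

lemma henkin_model:
  fixes d :: "tm \<Rightarrow> 'a"
  assumes \<Theta>: "henkin_theory A \<Theta>" and d: "surj d" "\<And>s t. d s = d t \<longleftrightarrow> (s \<^bold>= t) \<in> \<Theta>"
  shows "\<exists>M :: 'a so_structure. models M A \<and> (\<forall>\<phi>\<in>\<Theta>. \<exists>e E. range E \<subseteq> sets_of M \<and> sat M e E \<phi>)"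
proof -
  have prov: "A \<turnstile> \<phi> \<Longrightarrow> \<phi> \<in> \<Theta>" and FF: "FF \<notin> \<Theta>"
    and imp: "(\<phi> \<^bold>\<longrightarrow> \<psi>) \<in> \<Theta> \<longleftrightarrow> (\<phi> \<in> \<Theta> \<longrightarrow> \<psi> \<in> \<Theta>)"
    and allN: "AllN \<phi> \<in> \<Theta> \<longleftrightarrow> (\<forall>t. instN t \<phi> \<in> \<Theta>)"
    and allS: "AllS \<phi> \<in> \<Theta> \<longleftrightarrow> (\<forall>Y. instS Y \<phi> \<in> \<Theta>)" for \<phi> \<psi>
    using \<Theta> by (auto simp: henkin_theory_def)
  have eq: "instN s \<phi> \<in> \<Theta> \<longleftrightarrow> instN t \<phi> \<in> \<Theta>" if "d s = d t" for s t \<phi>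
  proof -
    have "instN s \<phi> \<in> \<Theta> \<Longrightarrow> instN t \<phi> \<in> \<Theta>" if "d s = d t" for s t
      using prov[OF EqSubst[of A s t \<phi>]] that d(2) imp by blast
    with that show ?thesis by metis
  qed
  have inst_t: "tsubst (case_nat t Var) (s \<up> Suc 0) = s" for s t by simp
  define r where "r = inv d"
  have dr [simp]: "d (r a) = a" for a using d(1) by (simp add: r_def surj_f_inv_f)
  have all_d: "(\<forall>x. P x) \<longleftrightarrow> (\<forall>t. P (d t))" for P
    using dr by metis
  have rd [simp]: "d (r (d t)) = d t" for t by simp
  let ?S = "\<lambda>X. {d t | t. (t \<^bold>\<in> X) \<in> \<Theta>}"
  define M where "M = \<lparr>zero_of = d Zero, one_of = d One, plus_of = (\<lambda>a b. d (r a \<^bold>+ r b)),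
    times_of = (\<lambda>a b. d (r a \<^bold>* r b)), less_of = (\<lambda>a b. (r a \<^bold>< r b) \<in> \<Theta>), sets_of = range ?S\<rparr>"
  note inst = instN_def inst_t
  have plus: "d (s \<^bold>+ t) = d (s' \<^bold>+ t')" if "d s = d s'" "d t = d t'" for s t s' t'
    using eq[OF that(1), of "(s \<^bold>+ t) \<up> Suc 0 \<^bold>= Var 0 \<^bold>+ t \<up> Suc 0"] eq[OF that(2), of "(s \<^bold>+ t) \<up> Suc 0 \<^bold>= s' \<up> Suc 0 \<^bold>+ Var 0"]
      prov[OF EqRefl[of A "s \<^bold>+ t"]] d(2) by (simp add: instN_def)
  have times: "d (s \<^bold>* t) = d (s' \<^bold>* t')" if "d s = d s'" "d t = d t'" for s t s' t'
    using eq[OF that(1), of "(s \<^bold>* t) \<up> Suc 0 \<^bold>= Var 0 \<^bold>* t \<up> Suc 0"] eq[OF that(2), of "(s \<^bold>* t) \<up> Suc 0 \<^bold>= s' \<up> Suc 0 \<^bold>* Var 0"]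
      prov[OF EqRefl[of A "s \<^bold>* t"]] d(2) by (simp add: instN_def)
  have less: "(s \<^bold>< t) \<in> \<Theta> \<longleftrightarrow> (s' \<^bold>< t') \<in> \<Theta>" if "d s = d s'" "d t = d t'" for s t s' t'
    using eq[OF that(1), of "Var 0 \<^bold>< t \<up> Suc 0"] eq[OF that(2), of "s' \<up> Suc 0 \<^bold>< Var 0"]
    by (simp add: instN_def)
  have mem: "(s \<^bold>\<in> X) \<in> \<Theta> \<longleftrightarrow> (t \<^bold>\<in> X) \<in> \<Theta>" if "d s = d t" for s t X
    using eq[OF that, of "Var 0 \<^bold>\<in> X"] by (simp add: instN_def)
  have tval: "tval M (\<lambda>i. d (\<sigma> i)) t = d (tsubst \<sigma> t)" for \<sigma> t
    by (induction t) (auto simp: M_def intro: plus times)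
  have truth: "sat M (\<lambda>i. d (\<sigma> i)) (\<lambda>X. ?S (\<rho> X)) \<phi> \<longleftrightarrow> subst \<sigma> \<rho> \<phi> \<in> \<Theta>" for \<sigma> \<rho> \<phi>
  proof (induction \<phi> arbitrary: \<sigma> \<rho>)
    case (AllN \<phi>)
    have "case_nat (d t) (\<lambda>i. d (\<sigma> i)) = (\<lambda>i. d (case_nat t \<sigma> i))" for t
      by (rule ext) (auto split: nat.split)
    then have 1: "sat M (case_nat (d t) (\<lambda>i. d (\<sigma> i))) (\<lambda>X. ?S (\<rho> X)) \<phi> \<longleftrightarrow> subst (case_nat t \<sigma>) \<rho> \<phi> \<in> \<Theta>" for t
      by (simp only: AllN)
    have 2: "sat M (\<lambda>i. d (\<sigma> i)) (\<lambda>X. ?S (\<rho> X)) (AllN \<phi>)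
        \<longleftrightarrow> (\<forall>t. sat M (case_nat (d t) (\<lambda>i. d (\<sigma> i))) (\<lambda>X. ?S (\<rho> X)) \<phi>)"
      unfolding sat.simps(6) by (rule all_d)
    have 3: "instN t (subst (case_nat (Var 0) (\<lambda>i. \<sigma> i \<up> Suc 0)) \<rho> \<phi>) = subst (case_nat t \<sigma>) \<rho> \<phi>" for t
    proof -
      have "(\<lambda>i. tsubst (case_nat t Var) (case_nat (Var 0) (\<lambda>i. \<sigma> i \<up> Suc 0) i)) = case_nat t \<sigma>"
        by (rule ext) (auto split: nat.split)
      then show ?thesis by (simp add: instN_def subst_subst)
    qed
    show ?case unfolding 2 unfolding 1 unfolding subst.simps allN One_nat_def 3 ..
  next
    case (AllS \<phi>)
    have "case_nat (?S Y) (\<lambda>i. ?S (\<rho> i)) = (\<lambda>i. ?S (case_nat Y \<rho> i))" for Y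
      by (rule ext) (auto split: nat.split)
    then have 1: "sat M (\<lambda>i. d (\<sigma> i)) (case_nat (?S Y) (\<lambda>X. ?S (\<rho> X))) \<phi> \<longleftrightarrow> subst \<sigma> (case_nat Y \<rho>) \<phi> \<in> \<Theta>" for Y
      by (simp only: AllS)
    have 2: "sat M (\<lambda>i. d (\<sigma> i)) (\<lambda>X. ?S (\<rho> X)) (AllS \<phi>)
        \<longleftrightarrow> (\<forall>Y. sat M (\<lambda>i. d (\<sigma> i)) (case_nat (?S Y) (\<lambda>X. ?S (\<rho> X))) \<phi>)"
      by (simp add: M_def)
    have 3: "instS Y (subst \<sigma> (case_nat 0 (\<lambda>X. Suc (\<rho> X))) \<phi>) = subst \<sigma> (case_nat Y \<rho>) \<phi>" for Y
    proof -
      have "(\<lambda>i. case_nat Y (\<lambda>X. X) (case_nat 0 (\<lambda>X. Suc (\<rho> X)) i)) = case_nat Y \<rho>"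
        by (rule ext) (auto split: nat.split)
      then show ?thesis by (simp add: instS_def subst_subst)
    qed
    show ?case unfolding 2 unfolding 1 unfolding subst.simps allS 3 ..
  next
    case (Eq s t)
    then show ?case by (simp add: tval d(2))
  next
    case (Less s t)
    have "sat M (\<lambda>i. d (\<sigma> i)) (\<lambda>X. ?S (\<rho> X)) (s \<^bold>< t) \<longleftrightarrow> (r (d (tsubst \<sigma> s)) \<^bold>< r (d (tsubst \<sigma> t))) \<in> \<Theta>"
      by (simp add: tval) (simp add: M_def)
    also have "\<dots> \<longleftrightarrow> (tsubst \<sigma> s \<^bold>< tsubst \<sigma> t) \<in> \<Theta>" by (rule less) simp_all
    finally show ?case by simp
  next
    case (Mem t X)
    have "d s \<in> ?S Y \<longleftrightarrow> (s \<^bold>\<in> Y) \<in> \<Theta>" for s Y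
      unfolding mem_Collect_eq by (rule iffI, metis mem, metis)
    then show ?case by (simp only: sat.simps tval subst.simps)
  qed (auto simp: FF imp)
  have "models M A"
    unfolding models_def
  proof (intro conjI ballI allI impI)
    show "sets_of M \<noteq> {}" by (simp add: M_def)
    fix \<phi> and e :: "nat \<Rightarrow> 'a" and E :: "nat \<Rightarrow> 'a set" assume "\<phi> \<in> A" "range E \<subseteq> sets_of M"
    from \<open>range E \<subseteq> sets_of M\<close> have "E X \<in> range ?S" for X
      unfolding M_def by (simp add: subsetD[OF _ rangeI])
    then have "\<forall>X. \<exists>Y. E X = ?S Y" by (meson rangeE)
    then obtain \<rho> where "\<forall>X. E X = ?S (\<rho> X)" by (rule choice[THEN exE])
    then have \<rho>: "E = (\<lambda>X. ?S (\<rho> X))" by blast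
    have e: "e = (\<lambda>i. d (r (e i)))" by simp
    have "subst (\<lambda>i. r (e i)) \<rho> \<phi> \<in> \<Theta>" using \<open>\<phi> \<in> A\<close> by (intro prov provable_subst Axiom)
    then show "sat M e E \<phi>" unfolding truth[symmetric] \<rho>[symmetric] e[symmetric] .
  qed
  moreover have "\<forall>\<phi>\<in>\<Theta>. \<exists>e E. range E \<subseteq> sets_of M \<and> sat M e E \<phi>"
  proof (intro ballI exI conjI)
    fix \<phi> assume that: "\<phi> \<in> \<Theta>"
    show "range ?S \<subseteq> sets_of M" by (simp add: M_def)
    show "sat M (\<lambda>i. d (Var i)) ?S \<phi>" 
      by (rule truth[of Var "\<lambda>X. X" \<phi>, unfolded subst_Var, THEN iffD2, OF that])
  qed
  ultimately show ?thesis by (intro exI conjI)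
qed

section \<open>Models of \<open>RCA\<^sub>0\<close> as a type class\<close>

text \<open>
  The domain of a model is made a type with its own arithmetical operations. In this way the simplifier's
  rules for ordered semirings apply to the numbers of the model.
\<close>

class second_order = zero + one + plus + times + ord +
  fixes sets :: "'a set set"

definition ambient :: "'a::second_order so_structure" where
  "ambient = \<lparr>zero_of = 0, one_of = 1, plus_of = (+), times_of = (*), less_of = (<), sets_of = sets\<rparr>"

lemma ambient_simps [simp]:
  "zero_of ambient = 0" "one_of ambient = 1" "plus_of ambient = (+)" "times_of ambient = (*)"
  "less_of ambient = (<)" "sets_of ambient = sets"
  by (simp_all add: ambient_def)

class rca0 = second_order +
  assumes models_RCA0: "models ambient RCA0"
    and le_iff_less_or_eq: "x \<le> y \<longleftrightarrow> x < y \<or> x = y"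

lemma sat_connectives [simp]:
  "sat M e E (\<^bold>\<not> \<phi>) \<longleftrightarrow> \<not> sat M e E \<phi>"
  "sat M e E (\<phi> \<^bold>\<and> \<psi>) \<longleftrightarrow> sat M e E \<phi> \<and> sat M e E \<psi>"
  "sat M e E (\<phi> \<^bold>\<or> \<psi>) \<longleftrightarrow> sat M e E \<phi> \<or> sat M e E \<psi>"
  "sat M e E (\<phi> \<^bold>\<longleftrightarrow> \<psi>) \<longleftrightarrow> (sat M e E \<phi> \<longleftrightarrow> sat M e E \<psi>)"
  "sat M e E (ExN \<phi>) \<longleftrightarrow> (\<exists>x. sat M (case_nat x e) E \<phi>)"
  "sat M e E (ExS \<phi>) \<longleftrightarrow> (\<exists>X\<in>sets_of M. sat M e (case_nat X E) \<phi>)"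
  by (auto simp: Neg_def Conj_def Disj_def Iff_def ExN_def ExS_def)

lemma tval_case_nat: "(\<lambda>i. tval M e (case_nat t \<sigma> i)) = case_nat (tval M e t) (\<lambda>i. tval M e (\<sigma> i))"
  by (rule ext) (auto split: nat.split)

definition some_set :: "'a::rca0 set" where
  "some_set = (SOME X. X \<in> sets)"

lemma some_set: "(some_set :: 'a::rca0 set) \<in> sets"
proof -
  have "(sets :: 'a set set) \<noteq> {}" using models_RCA0 by (auto simp: models_def)
  then show ?thesis unfolding some_set_def by (simp add: some_in_eq)
qed

lemma RCA0_sat:
  "\<phi> \<in> RCA0 \<Longrightarrow> range E \<subseteq> sets \<Longrightarrow> sat (ambient :: 'a::rca0 so_structure) e E \<phi>"
  using models_RCA0[where 'a='a] by (auto simp: models_def)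

text \<open>
  The axiom schemes for predicates of the metalogic that are described by a formula. The formula has the
  quantified variable at index 0, the distinguished variable at index 1, and parameters from \<open>e\<close> and \<open>E\<close>.
\<close>

lemma sigma1_induct:
  fixes e :: "nat \<Rightarrow> 'a::rca0"
  assumes "Delta0 \<theta>" and "range E \<subseteq> sets"
    and P: "\<And>x. P x \<longleftrightarrow> (\<exists>y. sat ambient (case_nat y (case_nat x e)) E \<theta>)"
    and "P 0" "\<And>x. P x \<Longrightarrow> P (x + 1)"
  shows "P x"
proof -
  have "induction_axiom (ExN \<theta>) \<in> RCA0"
    using assms(1) by (auto simp: RCA0_def Sigma1_def)
  from RCA0_sat[OF this assms(2), of e] have "P 0 \<and> (\<forall>x. P x \<longrightarrow> P (x + 1)) \<longrightarrow> (\<forall>x. P x)"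
    unfolding induction_axiom_def instN_def sat_connectives sat_subst tval_case_nat sat.simps tval.simps
      nat.case ambient_simps P .
  with assms(4,5) show ?thesis by blast
qed

lemmas open_induct = sigma1_induct[where E = "\<lambda>_. some_set"]

lemma open_env: "range (\<lambda>_::nat. some_set) \<subseteq> (sets :: 'a::rca0 set set)"
  by (auto simp: some_set)

lemma Delta1_comprehension:
  fixes e :: "nat \<Rightarrow> 'a::rca0"
  assumes "Delta0 \<theta>" "Delta0 \<theta>'" and "range E \<subseteq> sets"
    and P: "\<And>x. P x \<longleftrightarrow> (\<exists>y. sat ambient (case_nat y (case_nat x e)) E \<theta>)"
    and P': "\<And>x. P x \<longleftrightarrow> (\<forall>y. sat ambient (case_nat y (case_nat x e)) E \<theta>')"
  shows "{x. P x} \<in> sets"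
proof -
  have "Delta1_comprehension_axiom (ExN \<theta>) (AllN \<theta>') \<in> RCA0"
    using assms(1,2) by (auto simp: RCA0_def Sigma1_def Pi1_def)
  from RCA0_sat[OF this assms(3), of e] have "\<exists>X\<in>sets. \<forall>x. x \<in> X \<longleftrightarrow> P x"
    unfolding Delta1_comprehension_axiom_def liftS_def sat_connectives sat_subst sat.simps tval.simps
      nat.case ambient_simps P[symmetric] P'[symmetric] by simp
  then show ?thesis by (metis mem_Collect_eq subsetI subset_antisym)
qed


section \<open>Arithmetic\<close>

context
  fixes a b c :: "'a::rca0"
begin

lemma basic_sat: "\<phi> \<in> basic_axioms \<Longrightarrow> sat ambient (case_nat a (\<lambda>_. b)) (\<lambda>_. some_set) \<phi>"
  by (rule RCA0_sat[OF _ open_env]) (simp add: RCA0_def)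

lemma add_zero: "a + 0 = a"
  using basic_sat[of "Var 0 \<^bold>+ Zero \<^bold>= Var 0"] by (simp add: basic_axioms_def)

lemma add_succ: "a + (b + 1) = (a + b) + 1"
  using basic_sat[of "Var 0 \<^bold>+ (Var 1 \<^bold>+ One) \<^bold>= (Var 0 \<^bold>+ Var 1) \<^bold>+ One"] by (simp add: basic_axioms_def)

lemma mult_zero: "a * 0 = 0"
  using basic_sat[of "Var 0 \<^bold>* Zero \<^bold>= Zero"] by (simp add: basic_axioms_def)

lemma mult_succ: "a * (b + 1) = a * b + a"
  using basic_sat[of "Var 0 \<^bold>* (Var 1 \<^bold>+ One) \<^bold>= Var 0 \<^bold>* Var 1 \<^bold>+ Var 0"] by (simp add: basic_axioms_def)

lemma succ_neq_zero: "a + 1 \<noteq> 0"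
  using basic_sat[of "\<^bold>\<not> (Var 0 \<^bold>+ One \<^bold>= Zero)"] by (simp add: basic_axioms_def)

lemma succ_inj: "a + 1 = b + 1 \<Longrightarrow> a = b"
  using basic_sat[of "Var 0 \<^bold>+ One \<^bold>= Var 1 \<^bold>+ One \<^bold>\<longrightarrow> Var 0 \<^bold>= Var 1"] by (simp add: basic_axioms_def)

lemma not_less_zero: "\<not> a < 0"
  using basic_sat[of "\<^bold>\<not> (Var 0 \<^bold>< Zero)"] by (simp add: basic_axioms_def)

lemma less_succ_iff: "a < b + 1 \<longleftrightarrow> a < b \<or> a = b"
  using basic_sat[of "Var 0 \<^bold>< Var 1 \<^bold>+ One \<^bold>\<longleftrightarrow> Var 0 \<^bold>< Var 1 \<^bold>\<or> Var 0 \<^bold>= Var 1"]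
  by (simp add: basic_axioms_def)

end

lemma zero_add: "0 + (a::'a::rca0) = a"
  by (rule open_induct[where \<theta> = "Zero \<^bold>+ Var 1 \<^bold>= Var 1"])
    (auto intro: Delta0.intros simp: some_set add_zero add_succ)

lemma add_assoc': "(a + b) + c = a + (b + (c::'a::rca0))"
  by (rule open_induct[where \<theta> = "(Var 2 \<^bold>+ Var 3) \<^bold>+ Var 1 \<^bold>= Var 2 \<^bold>+ (Var 3 \<^bold>+ Var 1)"
        and e = "case_nat a (\<lambda>_. b)"])
    (auto intro: Delta0.intros simp: some_set add_zero add_succ)

lemma succ_add: "(a + 1) + b = (a + b) + (1::'a::rca0)"
  by (rule open_induct[where \<theta> = "(Var 2 \<^bold>+ One) \<^bold>+ Var 1 \<^bold>= (Var 2 \<^bold>+ Var 1) \<^bold>+ One"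
        and e = "\<lambda>_. a"])
    (auto intro: Delta0.intros simp: some_set add_zero add_succ)

lemma add_comm': "a + b = b + (a::'a::rca0)"
  by (rule open_induct[where \<theta> = "Var 2 \<^bold>+ Var 1 \<^bold>= Var 1 \<^bold>+ Var 2" and e = "\<lambda>_. a"])
    (auto intro: Delta0.intros simp: some_set add_zero zero_add add_succ succ_add)

lemma add_left_comm': "a + (b + c) = b + (a + (c::'a::rca0))"
  by (metis add_assoc' add_comm')

lemmas add_ac' = add_assoc' add_comm' add_left_comm'

lemma zero_mult: "0 * (a::'a::rca0) = 0"
  by (rule open_induct[where \<theta> = "Zero \<^bold>* Var 1 \<^bold>= Zero"])
    (auto intro: Delta0.intros simp: some_set add_zero mult_zero mult_succ)

lemma succ_mult: "(a + 1) * b = a * b + (b::'a::rca0)"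
  by (rule open_induct[where \<theta> = "(Var 2 \<^bold>+ One) \<^bold>* Var 1 \<^bold>= Var 2 \<^bold>* Var 1 \<^bold>+ Var 1" and e = "\<lambda>_. a"])
    (auto intro: Delta0.intros simp: some_set add_zero mult_zero mult_succ add_ac')

lemma mult_comm': "a * b = b * (a::'a::rca0)"
  by (rule open_induct[where \<theta> = "Var 2 \<^bold>* Var 1 \<^bold>= Var 1 \<^bold>* Var 2" and e = "\<lambda>_. a"])
    (auto intro: Delta0.intros simp: some_set mult_zero zero_mult mult_succ succ_mult)

lemma distrib_left': "a * (b + c) = a * b + a * (c::'a::rca0)"
proof (rule open_induct[where \<theta> = "Var 2 \<^bold>* (Var 3 \<^bold>+ Var 1) \<^bold>= Var 2 \<^bold>* Var 3 \<^bold>+ Var 2 \<^bold>* Var 1"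
      and e = "case_nat a (\<lambda>_. b)" and x = c])
  fix x assume "a * (b + x) = a * b + a * x"
  then have "a * (b + (x + 1)) = (a * b + a * x) + a" by (simp add: add_succ mult_succ)
  then show "a * (b + (x + 1)) = a * b + a * (x + 1)" by (simp add: mult_succ add_assoc')
qed (auto intro: Delta0.intros simp: some_set add_zero mult_zero)

lemma one_mult: "1 * (a::'a::rca0) = a"
  using succ_mult[of 0 a] by (simp add: zero_add zero_mult)

lemma mult_one: "a * 1 = (a::'a::rca0)"
  by (simp add: mult_comm'[of a 1] one_mult)

lemma mult_assoc': "(a * b) * c = a * (b * (c::'a::rca0))"
  by (rule open_induct[where \<theta> = "(Var 2 \<^bold>* Var 3) \<^bold>* Var 1 \<^bold>= Var 2 \<^bold>* (Var 3 \<^bold>* Var 1)"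
        and e = "case_nat a (\<lambda>_. b)" and x = c])
    (auto intro: Delta0.intros simp: some_set mult_zero mult_one distrib_left')

lemma add_cancel': "a + c = b + c \<longleftrightarrow> a = (b::'a::rca0)"
proof
  have "a + c = b + c \<longrightarrow> a = b"
    by (rule open_induct[where \<theta> = "Var 2 \<^bold>+ Var 1 \<^bold>= Var 3 \<^bold>+ Var 1 \<^bold>\<longrightarrow> Var 2 \<^bold>= Var 3"
          and e = "case_nat a (\<lambda>_. b)" and x = c])
      (auto intro: Delta0.intros simp: some_set add_zero add_succ dest: succ_inj)
  then show "a + c = b + c \<Longrightarrow> a = b" by simp
qed simp

lemma zero_or_succ: "(a::'a::rca0) = 0 \<or> (\<exists>b. a = b + 1)"
proof -
  have "\<exists>y. a = 0 \<or> a = y + 1"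
    by (rule open_induct[where \<theta> = "Var 1 \<^bold>= Zero \<^bold>\<or> Var 1 \<^bold>= Var 0 \<^bold>+ One" and x = a])
      (auto intro!: Delta0.intros simp: some_set Disj_def Neg_def)
  then show ?thesis by blast
qed

text \<open>
  All order properties are read off from this description of the order and from its totality.
\<close>

lemma less_iff_add: "a < b \<longleftrightarrow> (\<exists>z. b = a + z + (1::'a::rca0))"
proof
  have "\<exists>z. a < b \<longrightarrow> b = a + z + 1"
  proof (rule open_induct[where \<theta> = "Var 2 \<^bold>< Var 1 \<^bold>\<longrightarrow> Var 1 \<^bold>= Var 2 \<^bold>+ Var 0 \<^bold>+ One" and e = "\<lambda>_. a" and x = b])
    fix b assume "\<exists>z. a < b \<longrightarrow> b = a + z + 1"
    then show "\<exists>z. a < b + 1 \<longrightarrow> b + 1 = a + z + 1"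
      by (metis less_succ_iff add_succ add_zero)
  qed (auto intro: Delta0.intros simp: some_set not_less_zero)
  then show "a < b \<Longrightarrow> \<exists>z. b = a + z + 1" by blast
next
  have "a < a + z + 1" for z
    by (rule open_induct[where \<theta> = "Var 2 \<^bold>< Var 2 \<^bold>+ Var 1 \<^bold>+ One" and e = "\<lambda>_. a" and x = z])
      (auto intro: Delta0.intros simp: some_set less_succ_iff add_zero add_succ)
  then show "\<exists>z. b = a + z + 1 \<Longrightarrow> a < b" by blast
qed

lemma add_succ_neq: "a + z + 1 \<noteq> (a::'a::rca0)"
  by (metis add_assoc' add_cancel' add_comm' succ_neq_zero zero_add)

lemma less_trans': "a < b \<Longrightarrow> b < c \<Longrightarrow> a < (c::'a::rca0)"
  unfolding less_iff_add by (metis add_assoc')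

lemma less_linear': "a < b \<or> a = b \<or> b < (a::'a::rca0)"
proof -
  have "\<exists>z. a = b + z \<or> b = a + z"
  proof (rule open_induct[where \<theta> = "Var 1 \<^bold>= Var 2 \<^bold>+ Var 0 \<^bold>\<or> Var 2 \<^bold>= Var 1 \<^bold>+ Var 0" and e = "\<lambda>_. b" and x = a])
    show "\<exists>z. 0 = b + z \<or> b = 0 + z" by (auto simp: zero_add)
    fix a assume "\<exists>z. a = b + z \<or> b = a + z"
    then obtain z where "a = b + z \<or> b = a + z" by blast
    then show "\<exists>z. a + 1 = b + z \<or> b = a + 1 + z"
      using zero_or_succ[of z] by (metis add_succ add_zero succ_add)
  qed (auto intro!: Delta0.intros simp: some_set Disj_def Neg_def)
  then show ?thesis using zero_or_succ unfolding less_iff_add by (metis add_succ add_zero)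
qed

lemma mult_less: "a < b \<Longrightarrow> 0 < c \<Longrightarrow> c * a < c * (b::'a::rca0)"
  unfolding less_iff_add by (auto simp: zero_add succ_mult distrib_left' mult_succ) (metis add_assoc')

text \<open>Truncated subtraction, which the order-theoretic classes ask for.\<close>

definition monus :: "'a::rca0 \<Rightarrow> 'a \<Rightarrow> 'a" where
  "monus a b = (if b \<le> a then THE z. a = b + z else 0)"

lemma le_iff_add: "a \<le> b \<longleftrightarrow> (\<exists>z. b = a + (z::'a::rca0))"
  unfolding le_iff_less_or_eq less_iff_add using zero_or_succ by (metis add_succ add_zero)

lemma monus_add [simp]: "monus (a + b) a = (b::'a::rca0)"
  unfolding monus_def using le_iff_add
  by (auto intro!: the_equality) (metis add_cancel' add_comm')

lemma monus_zero: "\<not> b \<le> a \<Longrightarrow> monus a b = (0::'a::rca0)"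
  by (simp add: monus_def)

class arithmetic = linordered_semidom + canonically_ordered_monoid_add + rca0

lemma less_succ [simp]: "a < b + 1 \<longleftrightarrow> a \<le> (b::'a::arithmetic)"
  by (simp add: less_succ_iff le_less)

lemma succ_le [simp]: "a + 1 \<le> b \<longleftrightarrow> a < (b::'a::arithmetic)"
  by (meson less_succ not_less)

lemma one_le [simp]: "1 \<le> a \<longleftrightarrow> a \<noteq> (0::'a::arithmetic)"
  using succ_le[of 0 a] by (simp add: zero_less_iff_neq_zero)

lemma less_one [simp]: "a < 1 \<longleftrightarrow> a = (0::'a::arithmetic)"
  using one_le[of a] by (simp add: not_le[symmetric])

lemma le_square: "a \<le> a * (a::'a::arithmetic)"
proof (cases "a = 0")
  case False
  then have "a * 1 \<le> a * a" by (intro mult_left_mono) auto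
  then show ?thesis by simp
qed simp


section \<open>Pairs\<close>

definition pr :: "'a::arithmetic \<Rightarrow> 'a \<Rightarrow> 'a" where
  "pr s t = (s + t) * (s + t) + s"

lemma tval_pair [simp]: "tval ambient e (pair s t) = pr (tval ambient e s) (tval ambient e t)"
  by (simp add: pair_def pr_def)

text \<open>
  \<open>pr s t\<close> lies in the interval from \<open>(s + t)\<^sup>2\<close> to \<open>(s + t + 1)\<^sup>2 - 1\<close>; hence the code determines the
  sum of the components.
\<close>

lemma pr_less: "s + t < s' + t' \<Longrightarrow> pr s t < pr s' (t'::'a::arithmetic)"
proof -
  assume "s + t < s' + t'"
  then have "s + t + 1 \<le> s' + t'" by simp
  then have "(s + t + 1) * (s + t + 1) \<le> (s' + t') * (s' + t')" by (intro mult_mono) auto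
  moreover have "(s + t + 1) * (s + t + 1) = pr s t + (s + t + t + 1)"
    by (simp add: pr_def algebra_simps)
  ultimately have "pr s t + (s + t + t + 1) \<le> (s' + t') * (s' + t')" by simp
  then have "pr s t + (s + t + t) < (s' + t') * (s' + t')" by (simp add: add.assoc[symmetric])
  moreover have "pr s t \<le> pr s t + (s + t + t)" by simp
  moreover have "(s' + t') * (s' + t') \<le> pr s' t'" by (simp add: pr_def)
  ultimately show ?thesis by order
qed

lemma pr_inject [simp]: "pr s t = pr s' t' \<longleftrightarrow> s = s' \<and> t = (t'::'a::arithmetic)"
proof
  assume eq: "pr s t = pr s' t'"
  then have "s + t = s' + t'" using pr_less[of s t s' t'] pr_less[of s' t' s t] by (metis less_irrefl neqE)
  then show "s = s' \<and> t = t'" using eq by (auto simp: pr_def)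
qed simp

lemma pr_ge1 [simp]: "s \<le> pr s (t::'a::arithmetic)"
  by (simp add: pr_def)

lemma pr_ge2 [simp]: "t \<le> pr s (t::'a::arithmetic)"
proof -
  have "t \<le> s + t" by simp
  also have "\<dots> \<le> (s + t) * (s + t)" by (rule le_square)
  also have "\<dots> \<le> pr s t" by (simp add: pr_def)
  finally show ?thesis .
qed

text \<open>
  The components of a pair, with value 0 for numbers that do not code a pair.
\<close>

definition p1 :: "'a::arithmetic \<Rightarrow> 'a" where
  "p1 z = (if \<exists>s t. z = pr s t then THE s. \<exists>t. z = pr s t else 0)"

definition p2 :: "'a::arithmetic \<Rightarrow> 'a" where
  "p2 z = (if \<exists>s t. z = pr s t then THE t. \<exists>s. z = pr s t else 0)"

lemma p1_pr [simp]: "p1 (pr s t) = s"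
  unfolding p1_def by auto

lemma p2_pr [simp]: "p2 (pr s t) = t"
  unfolding p2_def by auto

lemma p1_default: "\<nexists>s t. z = pr s t \<Longrightarrow> p1 z = 0"
  and p2_default: "\<nexists>s t. z = pr s t \<Longrightarrow> p2 z = 0"
  unfolding p1_def p2_def by auto


section \<open>Decidable predicates and computable functions of a model\<close>

text \<open>
  Predicates and functions of several arguments are represented by those of one argument: the argument is
  the current environment, a nested pair whose components are read by \<open>p1\<close> and \<open>p2\<close>. A quantifier
  extends the environment by one component in front. The rules collected under \<open>definable_intros\<close> follow
  the syntax of a predicate, much like rules for measurability or continuity.
\<close>

definition decidable :: "('a::arithmetic \<Rightarrow> bool) \<Rightarrow> bool" where
  "decidable P \<longleftrightarrow> {x. P x} \<in> sets"

definition graph :: "('a::arithmetic \<Rightarrow> 'a) \<Rightarrow> 'a set" where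
  "graph f = {z. \<exists>x. z = pr x (f x)}"

definition computable :: "('a::arithmetic \<Rightarrow> 'a) \<Rightarrow> bool" where
  "computable f \<longleftrightarrow> graph f \<in> sets"

lemma pr_in_graph [simp]: "pr x y \<in> graph f \<longleftrightarrow> y = f x"
  by (auto simp: graph_def)

definition BEx :: "tm \<Rightarrow> fm \<Rightarrow> fm" where
  "BEx t \<phi> = ExN (Var 0 \<^bold>< t \<up> 1 \<^bold>\<and> \<phi>)"

definition BAll :: "tm \<Rightarrow> fm \<Rightarrow> fm" where
  "BAll t \<phi> = AllN (Var 0 \<^bold>< t \<up> 1 \<^bold>\<longrightarrow> \<phi>)"

abbreviation "LEx i \<equiv> BEx (Var i \<^bold>+ One)"
abbreviation "LAll i \<equiv> BAll (Var i \<^bold>+ One)"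

lemma sat_BEx [simp]:
  "sat ambient e E (BEx t \<phi>) \<longleftrightarrow> (\<exists>x<tval ambient e t. sat ambient (case_nat x e) E \<phi>)"
  "sat ambient e E (BAll t \<phi>) \<longleftrightarrow> (\<forall>x<tval ambient e t. sat ambient (case_nat x e) E \<phi>)"
  by (auto simp: BEx_def BAll_def)

lemma Delta0_connectives [simp, intro]:
  "Delta0 FF" "Delta0 (s \<^bold>= t)" "Delta0 (s \<^bold>< t)" "Delta0 (t \<^bold>\<in> X)"
  "Delta0 \<phi> \<Longrightarrow> Delta0 \<psi> \<Longrightarrow> Delta0 (\<phi> \<^bold>\<longrightarrow> \<psi>)"
  "Delta0 \<phi> \<Longrightarrow> Delta0 (\<^bold>\<not> \<phi>)"
  "Delta0 \<phi> \<Longrightarrow> Delta0 \<psi> \<Longrightarrow> Delta0 (\<phi> \<^bold>\<and> \<psi>)"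
  "Delta0 \<phi> \<Longrightarrow> Delta0 \<psi> \<Longrightarrow> Delta0 (\<phi> \<^bold>\<or> \<psi>)"
  by (simp_all add: Neg_def Conj_def Disj_def Delta0.intros(1-5))

lemma Delta0_bounded [simp, intro]:
  "Delta0 \<phi> \<Longrightarrow> Delta0 (BEx t \<phi>)" "Delta0 \<phi> \<Longrightarrow> Delta0 (BAll t \<phi>)"
  unfolding BEx_def BAll_def by (intro Delta0.intros; assumption)+

named_theorems definable_intros

lemma decidable_mem_id: "X \<in> sets \<Longrightarrow> decidable (\<lambda>x. x \<in> X)"
  by (simp add: decidable_def)

lemma decidable_not [definable_intros]: "decidable P \<Longrightarrow> decidable (\<lambda>x. \<not> P x)"
  unfolding decidable_def
  by (rule Delta1_comprehension[where \<theta> = "\<^bold>\<not> (Var 1 \<^bold>\<in> 0)" and \<theta>' = "\<^bold>\<not> (Var 1 \<^bold>\<in> 0)"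
        and E = "\<lambda>_. {x. P x}"]) auto

lemma decidable_and [definable_intros]:
  "decidable P \<Longrightarrow> decidable Q \<Longrightarrow> decidable (\<lambda>x. P x \<and> Q x)"
  unfolding decidable_def
  by (rule Delta1_comprehension[where \<theta> = "Var 1 \<^bold>\<in> 0 \<^bold>\<and> Var 1 \<^bold>\<in> 1" and \<theta>' = "Var 1 \<^bold>\<in> 0 \<^bold>\<and> Var 1 \<^bold>\<in> 1"
        and E = "case_nat {x. P x} (\<lambda>_. {x. Q x})"]) (auto split: nat.split)

lemma decidable_subst:
  "decidable P \<Longrightarrow> computable f \<Longrightarrow> decidable (\<lambda>x. P (f x))"
  unfolding decidable_def computable_def
  by (rule Delta1_comprehension[where \<theta> = "pair (Var 1) (Var 0) \<^bold>\<in> 0 \<^bold>\<and> Var 0 \<^bold>\<in> 1"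
        and \<theta>' = "pair (Var 1) (Var 0) \<^bold>\<in> 0 \<^bold>\<longrightarrow> Var 0 \<^bold>\<in> 1"
        and E = "case_nat (graph f) (\<lambda>_. {x. P x})"]) (auto split: nat.split)

text \<open>
  A number is the code of at most one pair, and so the pair can be moved out of the quantifier over \<open>u\<close>.
\<close>

lemma all_bounded_pair:
  "(\<forall>u. \<exists>x\<le>z. \<exists>y\<le>z. z = pr x y \<and> Q u x y) \<longleftrightarrow> (\<exists>x y. z = pr x y \<and> (\<forall>u. Q u x y))"
  for z :: "'a::arithmetic"
proof
  assume *: "\<forall>u. \<exists>x\<le>z. \<exists>y\<le>z. z = pr x y \<and> Q u x y"
  then obtain x y where z: "z = pr x y" by blast
  have "Q u x y" for u using *[rule_format, of u] z by auto
  with z show "\<exists>x y. z = pr x y \<and> (\<forall>u. Q u x y)" by blast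
qed auto

lemma computable_subst:
  assumes "computable f" "computable g"
  shows "computable (\<lambda>x. f (g x))"
  unfolding computable_def graph_def
  by (rule Delta1_comprehension[where
        \<theta> = "LEx 1 (LEx 2 (Var 3 \<^bold>= pair (Var 1) (Var 0) \<^bold>\<and> pair (Var 1) (Var 2) \<^bold>\<in> 1 \<^bold>\<and> pair (Var 2) (Var 0) \<^bold>\<in> 0))"
        and \<theta>' = "LEx 1 (LEx 2 (Var 3 \<^bold>= pair (Var 1) (Var 0) \<^bold>\<and> (pair (Var 1) (Var 2) \<^bold>\<in> 1 \<^bold>\<longrightarrow> pair (Var 2) (Var 0) \<^bold>\<in> 0)))"
        and E = "case_nat (graph f) (\<lambda>_. graph g)"])
    (use assms in \<open>auto simp: computable_def all_bounded_pair split: nat.split\<close>)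

lemma computable_id [definable_intros]: "computable (\<lambda>x. x)"
  unfolding computable_def graph_def
  by (rule Delta1_comprehension[where \<theta> = "LEx 1 (Var 2 \<^bold>= pair (Var 0) (Var 0))"
        and \<theta>' = "LEx 1 (Var 2 \<^bold>= pair (Var 0) (Var 0))" and E = "\<lambda>_. some_set"])
    (auto simp: some_set)

lemma computable_const [definable_intros]: "computable (\<lambda>x. c)"
  unfolding computable_def graph_def
  by (rule Delta1_comprehension[where \<theta> = "LEx 1 (Var 2 \<^bold>= pair (Var 0) (Var 3))"
        and \<theta>' = "LEx 1 (Var 2 \<^bold>= pair (Var 0) (Var 3))" and E = "\<lambda>_. some_set" and e = "\<lambda>_. c"])
    (auto simp: some_set)

text \<open>
  Operations given by a term, and relations given by a bounded formula, in the variables 1 and 0. The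
  extra unbounded variable \<open>u\<close> is there to bound the values of \<open>f\<close> and \<open>g\<close>, so that the other
  quantifiers over values become bounded.
\<close>

lemma computable_term:
  assumes f: "computable f" and g: "computable g"
    and t: "\<And>a b e. tval ambient (case_nat b (case_nat a e)) t = h a b"
  shows "computable (\<lambda>x. h (f x) (g x))"
  unfolding computable_def graph_def
proof (rule Delta1_comprehension)
  let ?\<theta> = "LEx 1 (LEx 2 (Var 3 \<^bold>= pair (Var 1) (Var 0) \<^bold>\<and> LEx 2 (LEx 3
        (pair (Var 3) (Var 1) \<^bold>\<in> 0 \<^bold>\<and> pair (Var 3) (Var 0) \<^bold>\<in> 1 \<^bold>\<and> Var 2 \<^bold>= t))))"
  let ?\<theta>' = "LEx 1 (LEx 2 (Var 3 \<^bold>= pair (Var 1) (Var 0) \<^bold>\<and> LAll 2 (LAll 3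
        (pair (Var 3) (Var 1) \<^bold>\<in> 0 \<^bold>\<longrightarrow> pair (Var 3) (Var 0) \<^bold>\<in> 1 \<^bold>\<longrightarrow> Var 2 \<^bold>= t))))"
  let ?E = "case_nat (graph f) (\<lambda>_. graph g)"
  show "Delta0 ?\<theta>" "Delta0 ?\<theta>'" by auto
  show "range ?E \<subseteq> sets" using f g by (auto simp: computable_def split: nat.split)
  show "(\<exists>x. z = pr x (h (f x) (g x))) \<longleftrightarrow> (\<exists>y. sat ambient (case_nat y (case_nat z (\<lambda>_. 0))) ?E ?\<theta>)" for z
    by (auto simp: t) (metis add_increasing add_increasing2 order_refl zero_le)
  show "(\<exists>x. z = pr x (h (f x) (g x))) \<longleftrightarrow> (\<forall>y. sat ambient (case_nat y (case_nat z (\<lambda>_. 0))) ?E ?\<theta>')" for z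
  proof
    assume "\<forall>y. sat ambient (case_nat y (case_nat z (\<lambda>_. 0))) ?E ?\<theta>'"
    then have *: "\<exists>x y. z = pr x y \<and> (f x \<le> u \<longrightarrow> g x \<le> u \<longrightarrow> y = h (f x) (g x))" for u
      by (auto simp: t)
    from *[of 0] obtain x y where z: "z = pr x y" by blast
    show "\<exists>x. z = pr x (h (f x) (g x))" using *[of "f x + g x"] z by auto
  qed (auto simp: t)
qed

lemma decidable_formula:
  assumes f: "computable f" and g: "computable g" and "Delta0 \<rho>"
    and \<rho>: "\<And>a b e E. sat ambient (case_nat b (case_nat a e)) E \<rho> \<longleftrightarrow> R a b"
  shows "decidable (\<lambda>x. R (f x) (g x))"
  unfolding decidable_def
proof (rule Delta1_comprehension)
  let ?\<theta> = "LEx 0 (LEx 1 (pair (Var 3) (Var 1) \<^bold>\<in> 0 \<^bold>\<and> pair (Var 3) (Var 0) \<^bold>\<in> 1 \<^bold>\<and> \<rho>))"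
  let ?\<theta>' = "LAll 0 (LAll 1 (pair (Var 3) (Var 1) \<^bold>\<in> 0 \<^bold>\<longrightarrow> pair (Var 3) (Var 0) \<^bold>\<in> 1 \<^bold>\<longrightarrow> \<rho>))"
  let ?E = "case_nat (graph f) (\<lambda>_. graph g)"
  show "Delta0 ?\<theta>" "Delta0 ?\<theta>'" using assms(3) by auto
  show "range ?E \<subseteq> sets" using f g by (auto simp: computable_def split: nat.split)
  show "R (f z) (g z) \<longleftrightarrow> (\<exists>y. sat ambient (case_nat y (case_nat z (\<lambda>_. 0))) ?E ?\<theta>)" for z
    by (auto simp: \<rho> intro!: exI[of _ "f z + g z"])
  show "R (f z) (g z) \<longleftrightarrow> (\<forall>y. sat ambient (case_nat y (case_nat z (\<lambda>_. 0))) ?E ?\<theta>')" for z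
    by (auto simp: \<rho> dest!: spec[of _ "f z + g z"])
qed

lemma computable_add [definable_intros]:
    "computable f \<Longrightarrow> computable g \<Longrightarrow> computable (\<lambda>x. f x + g x)"
  and computable_mult [definable_intros]:
    "computable f \<Longrightarrow> computable g \<Longrightarrow> computable (\<lambda>x. f x * g x)"
  and computable_pr [definable_intros]:
    "computable f \<Longrightarrow> computable g \<Longrightarrow> computable (\<lambda>x. pr (f x) (g x))"
  by (rule computable_term[where h = "(+)" and t = "Var 1 \<^bold>+ Var 0"], assumption, assumption, simp)
     (rule computable_term[where h = "(*)" and t = "Var 1 \<^bold>* Var 0"], assumption, assumption, simp,
      rule computable_term[where h = pr and t = "pair (Var 1) (Var 0)"], assumption, assumption, simp)

lemma decidable_less [definable_intros]:
    "computable f \<Longrightarrow> computable g \<Longrightarrow> decidable (\<lambda>x. f x < g x)"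
  and decidable_eq [definable_intros]:
    "computable f \<Longrightarrow> computable g \<Longrightarrow> decidable (\<lambda>x. f x = g x)"
  by (rule decidable_formula[where R = "(<)" and \<rho> = "Var 1 \<^bold>< Var 0"], assumption, assumption, blast, simp)
     (rule decidable_formula[where R = "(=)" and \<rho> = "Var 1 \<^bold>= Var 0"], assumption, assumption, blast, simp)

lemma decidable_le [definable_intros]:
  "computable f \<Longrightarrow> computable g \<Longrightarrow> decidable (\<lambda>x. f x \<le> g x)"
  using decidable_not[OF decidable_less[of g f]] by (simp add: not_less)

lemma decidable_or [definable_intros]:
  "decidable P \<Longrightarrow> decidable Q \<Longrightarrow> decidable (\<lambda>x. P x \<or> Q x)"
  using decidable_not[OF decidable_and[OF decidable_not decidable_not, of P Q]] by simp

lemma decidable_imp [definable_intros]: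
  "decidable P \<Longrightarrow> decidable Q \<Longrightarrow> decidable (\<lambda>x. P x \<longrightarrow> Q x)"
  using decidable_not[OF decidable_and[OF _ decidable_not, of P Q]] by simp

lemma decidable_iff [definable_intros]:
  "decidable P \<Longrightarrow> decidable Q \<Longrightarrow> decidable (\<lambda>x. P x \<longleftrightarrow> Q x)"
  using decidable_and[OF decidable_imp[of P Q] decidable_imp[of Q P]] by (simp add: iff_conv_conj_imp)

lemma decidable_mem [definable_intros]:
  "X \<in> sets \<Longrightarrow> computable f \<Longrightarrow> decidable (\<lambda>x. f x \<in> X)"
  by (rule decidable_subst[OF decidable_mem_id])

lemma decidable_const [definable_intros]: "decidable (\<lambda>x. b)"
proof (cases b)
  case True
  then show ?thesis using decidable_eq[OF computable_id computable_id] by simp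
next
  case False
  then show ?thesis using decidable_not[OF decidable_eq[OF computable_id computable_id]] by simp
qed

lemma pair_cases: obtains (Pair) s t where "z = pr s t" | (Default) "\<nexists>s t. z = pr s t" by blast

lemma no_bounded_pair:
  "(\<forall>a\<le>x. \<forall>b\<le>x. x \<noteq> pr a b) \<longleftrightarrow> (\<forall>a b. x \<noteq> pr a b)" for x :: "'a::arithmetic"
proof
  show "\<forall>a b. x \<noteq> pr a b" if "\<forall>a\<le>x. \<forall>b\<le>x. x \<noteq> pr a b"
    using that pr_ge1 pr_ge2 by blast
qed blast

lemma computable_p1_id: "computable (p1 :: 'a::arithmetic \<Rightarrow> 'a)"
  and computable_p2_id: "computable (p2 :: 'a::arithmetic \<Rightarrow> 'a)"
proof -
  let ?\<theta> = "\<lambda>i. LEx 1 (LEx 2 (Var 3 \<^bold>= pair (Var 1) (Var 0) \<^bold>\<and>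
    (LEx 1 (LEx 2 (Var 3 \<^bold>= pair (Var 1) (Var 0) \<^bold>\<and> Var 2 \<^bold>= Var i)) \<^bold>\<or>
     (\<^bold>\<not> LEx 1 (LEx 2 (Var 3 \<^bold>= pair (Var 1) (Var 0)))) \<^bold>\<and> Var 0 \<^bold>= Zero)))"
  have D: "Delta0 (?\<theta> i)" for i by auto
  have E: "range (\<lambda>_::nat. some_set) \<subseteq> (sets :: 'a set set)" by (auto simp: some_set)
  have 1: "(\<exists>x. z = pr x (p1 x)) \<longleftrightarrow> sat ambient (case_nat y (case_nat z (\<lambda>_. 0))) (\<lambda>_. some_set) (?\<theta> 1)" for y z :: 'a
  proof -
    have key: "(\<exists>a\<le>x. \<exists>b\<le>x. x = pr a b \<and> y = a) \<or> (\<forall>a\<le>x. \<forall>b\<le>x. x \<noteq> pr a b) \<and> y = 0 \<longleftrightarrow> y = p1 x" for x y :: 'a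
      unfolding no_bounded_pair by (cases rule: pair_cases[of x]) (auto simp: p1_default)
    show ?thesis by (auto simp: key)
  qed
  have 2: "(\<exists>x. z = pr x (p2 x)) \<longleftrightarrow> sat ambient (case_nat y (case_nat z (\<lambda>_. 0))) (\<lambda>_. some_set) (?\<theta> 0)" for y z :: 'a
  proof -
    have 1: "p2 x \<le> x" for x :: 'a
      by (cases rule: pair_cases[of x]) (auto simp: p2_default)
    have 2: "p2 x = 0" if "\<forall>a\<le>x. \<forall>b\<le>x. x \<noteq> pr a b" for x :: 'a
      using that unfolding no_bounded_pair by (intro p2_default) blast
    have 3: "p2 x = 0" if "\<forall>a\<le>x. x \<noteq> pr a (p2 x)" for x :: 'a
    proof (cases rule: pair_cases[of x])
      case (Pair s t)
      then show ?thesis using that[rule_format, of s] by simp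
    qed (rule p2_default)
    show ?thesis by (auto simp: 1 dest: 2) (rule 3, assumption)
  qed
  show "computable (p1 :: 'a \<Rightarrow> 'a)"
    unfolding computable_def graph_def
    by (rule Delta1_comprehension[OF D[of 1] D[of 1] E, where e = "\<lambda>_. 0"]) (use 1 in blast)+
  show "computable (p2 :: 'a \<Rightarrow> 'a)"
    unfolding computable_def graph_def
    by (rule Delta1_comprehension[OF D[of 0] D[of 0] E, where e = "\<lambda>_. 0"]) (use 2 in blast)+
qed

lemma computable_p1 [definable_intros]: "computable f \<Longrightarrow> computable (\<lambda>x. p1 (f x))"
  and computable_p2 [definable_intros]: "computable f \<Longrightarrow> computable (\<lambda>x. p2 (f x))"
  by (rule computable_subst[OF computable_p1_id], assumption) (rule computable_subst[OF computable_p2_id])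

lemma decidable_ex_less [definable_intros]:
  assumes "decidable (\<lambda>z. P (p2 z) (p1 z))" and "computable b"
  shows "decidable (\<lambda>x. \<exists>y<b x. P x y)"
  unfolding decidable_def
  by (rule Delta1_comprehension[where
        \<theta> = "pair (Var 1) (Var 0) \<^bold>\<in> 0 \<^bold>\<and> BEx (Var 0) (pair (Var 0) (Var 2) \<^bold>\<in> 1)"
        and \<theta>' = "pair (Var 1) (Var 0) \<^bold>\<in> 0 \<^bold>\<longrightarrow> BEx (Var 0) (pair (Var 0) (Var 2) \<^bold>\<in> 1)"
        and E = "case_nat (graph b) (\<lambda>_. {z. P (p2 z) (p1 z)})"])
    (use assms in \<open>auto simp: computable_def decidable_def split: nat.split\<close>)

lemma decidable_all_less [definable_intros]:
  assumes "decidable (\<lambda>z. P (p2 z) (p1 z))" and "computable b"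
  shows "decidable (\<lambda>x. \<forall>y<b x. P x y)"
  using decidable_not[OF decidable_ex_less[OF decidable_not[OF assms(1)] assms(2)]] by simp

lemma decidable_ex_le [definable_intros]:
  assumes "decidable (\<lambda>z. P (p2 z) (p1 z))" and "computable b"
  shows "decidable (\<lambda>x. \<exists>y\<le>b x. P x y)"
  using decidable_ex_less[OF assms(1) computable_add[OF assms(2) computable_const[of 1]]] by simp

lemma decidable_all_le [definable_intros]:
  assumes "decidable (\<lambda>z. P (p2 z) (p1 z))" and "computable b"
  shows "decidable (\<lambda>x. \<forall>y\<le>b x. P x y)"
  using decidable_all_less[OF assms(1) computable_add[OF assms(2) computable_const[of 1]]] by simp

lemma decidable_delta1:
  assumes "decidable (\<lambda>z. P (p2 z) (p1 z))" "decidable (\<lambda>z. Q (p2 z) (p1 z))"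
    and "\<And>x. (\<exists>y. P x y) \<longleftrightarrow> (\<forall>y. Q x y)"
  shows "decidable (\<lambda>x. \<exists>y. P x y)"
  unfolding decidable_def
  by (rule Delta1_comprehension[where \<theta> = "pair (Var 0) (Var 1) \<^bold>\<in> 0" and \<theta>' = "pair (Var 0) (Var 1) \<^bold>\<in> 1"
        and E = "case_nat {z. P (p2 z) (p1 z)} (\<lambda>_. {z. Q (p2 z) (p1 z)})"])
    (use assms in \<open>auto simp: decidable_def split: nat.split\<close>)

lemma Sigma1_induct [consumes 1, case_names zero succ]:
  assumes "decidable (\<lambda>z. P (p2 z) (p1 z))"
    and "\<exists>y. P 0 y" "\<And>x. \<exists>y. P x y \<Longrightarrow> \<exists>y. P (x + 1) y"
  shows "\<exists>y. P x y"
  by (rule sigma1_induct[where P = "\<lambda>x. \<exists>y. P x y" and \<theta> = "pair (Var 0) (Var 1) \<^bold>\<in> 0"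
        and E = "\<lambda>_. {z. P (p2 z) (p1 z)}"])
    (use assms in \<open>auto simp: decidable_def\<close>)

lemma decidable_induct [consumes 1, case_names zero succ]:
  assumes "decidable P" and "P 0" "\<And>x. P x \<Longrightarrow> P (x + 1)"
  shows "P x"
  by (rule sigma1_induct[where P = P and \<theta> = "Var 1 \<^bold>\<in> 0" and E = "\<lambda>_. {z. P z}"])
    (use assms in \<open>auto simp: decidable_def\<close>)

text \<open>
  The least number principle, by induction on the statement that no number below \<open>n\<close> has the property.
\<close>

lemma decidable_least:
  assumes "decidable P" "P a"
  shows "\<exists>m. P m \<and> (\<forall>y<m. \<not> P y)"
proof (rule ccontr)
  assume *: "\<nexists>m. P m \<and> (\<forall>y<m. \<not> P y)"
  have "decidable (\<lambda>n. \<forall>y<n. \<not> P y)"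
    by (intro definable_intros decidable_subst[OF assms(1)])
  then have "\<forall>y<a+1. \<not> P y"
  proof (rule decidable_induct)
    fix n assume "\<forall>y<n. \<not> P y"
    then show "\<forall>y<n + 1. \<not> P y" using * by (auto simp: le_less)
  qed simp
  then show False using assms(2) by auto
qed

lemma decidable_Least:
  assumes "decidable P" "P a"
  shows "P (LEAST y. P y)" and "P y \<Longrightarrow> (LEAST y. P y) \<le> y"
proof -
  obtain m where m: "P m" "\<forall>y<m. \<not> P y" using decidable_least[OF assms] by blast
  have eq: "(LEAST y. P y) = m"
    using m by (intro Least_equality) (auto simp: not_less[symmetric])
  show "P (LEAST y. P y)" using m eq by simp
  show "P y \<Longrightarrow> (LEAST y. P y) \<le> y" using m eq by (metis not_less)
qed

lemma decidable_subst2: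
  assumes "decidable (\<lambda>z. R (p1 z) (p2 z))" "computable f" "computable g"
  shows "decidable (\<lambda>x. R (f x) (g x))"
  using decidable_subst[OF assms(1) computable_pr[OF assms(2,3)]] by simp

lemma computable_subst2:
  assumes "computable (\<lambda>z. h (p1 z) (p2 z))" "computable f" "computable g"
  shows "computable (\<lambda>x. h (f x) (g x))"
  using computable_subst[OF assms(1) computable_pr[OF assms(2,3)]] by simp

text \<open>
  It suffices to decide equations \<open>y = f x\<close> through projections: the numbers that are not pairs, for which
  the projections have default values, are sorted out here once.
\<close>

lemma computableI:
  assumes "decidable (\<lambda>z. p2 z = f (p1 z))"
  shows "computable f"
proof -
  have "decidable (\<lambda>z. pr (p1 z) (p2 z) = z \<and> p2 z = f (p1 z))"
    by (intro definable_intros assms)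
  moreover have "{z. pr (p1 z) (p2 z) = z \<and> p2 z = f (p1 z)} = graph f"
    unfolding graph_def by (auto, metis)
  ultimately show ?thesis by (simp add: computable_def decidable_def)
qed

lemma computable_if [definable_intros]:
  assumes P: "decidable P" and f: "computable f" and g: "computable g"
  shows "computable (\<lambda>x. if P x then f x else g x)"
proof (rule computableI)
  have "decidable (\<lambda>z. (P (p1 z) \<longrightarrow> p2 z = f (p1 z)) \<and> (\<not> P (p1 z) \<longrightarrow> p2 z = g (p1 z)))"
    by (intro definable_intros decidable_subst[OF P] computable_subst[OF f] computable_subst[OF g])
  moreover have "(p2 z = (if P (p1 z) then f (p1 z) else g (p1 z))) \<longleftrightarrow>
      (P (p1 z) \<longrightarrow> p2 z = f (p1 z)) \<and> (\<not> P (p1 z) \<longrightarrow> p2 z = g (p1 z))" for z by auto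
  ultimately show "decidable (\<lambda>z. p2 z = (if P (p1 z) then f (p1 z) else g (p1 z)))" by presburger
qed

text \<open>
  Minimisation: being the least witness is a decidable property, since only smaller numbers need be checked.
\<close>

lemma computable_Least:
  assumes P: "decidable (\<lambda>z. P (p2 z) (p1 z))" and ex: "\<And>x. \<exists>y. P x y"
  shows "computable (\<lambda>x. LEAST y. P x y)"
proof (rule computableI)
  have d: "decidable (\<lambda>y. P x y)" for x
    using decidable_subst2[OF P computable_id computable_const[of x]] by simp
  have "decidable (\<lambda>z. P (p1 z) (p2 z) \<and> (\<forall>y<p2 z. \<not> P (p1 z) y))"
    by (intro definable_intros decidable_subst2[where R = "\<lambda>y x. P x y", OF P])
  moreover have "p2 z = (LEAST y. P (p1 z) y) \<longleftrightarrow> P (p1 z) (p2 z) \<and> (\<forall>y<p2 z. \<not> P (p1 z) y)" for z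
  proof -
    obtain a where a: "P (p1 z) a" using ex by blast
    show ?thesis
      using decidable_Least[OF d a] by (metis linorder_not_less order.order_iff_strict)
  qed
  ultimately show "decidable (\<lambda>z. p2 z = (LEAST y. P (p1 z) y))" by presburger
qed

section \<open>Coding finite sets\<close>

lemma dvd_imp_le': "a dvd b \<Longrightarrow> b \<noteq> 0 \<Longrightarrow> a \<le> (b::'a::arithmetic)"
proof -
  assume "a dvd b" "b \<noteq> 0"
  then obtain q where q: "b = a * q" "q \<noteq> 0" by (auto elim: dvdE)
  then have "a * 1 \<le> a * q" by (intro mult_left_mono) auto
  with q show ?thesis by simp
qed

lemma dvd_bounded: "a dvd b \<longleftrightarrow> (\<exists>q\<le>b. b = a * (q::'a::arithmetic))"
proof
  assume "a dvd b"
  then obtain q where q: "b = a * q" by (elim dvdE)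
  show "\<exists>q\<le>b. b = a * q"
  proof (cases "b = 0")
    case False
    then have "q dvd b" "q \<noteq> 0" using q by auto
    then show ?thesis using q dvd_imp_le'[of q b] False by blast
  qed (auto intro: exI[of _ 0])
qed auto

lemma decidable_dvd [definable_intros]:
  "computable f \<Longrightarrow> computable g \<Longrightarrow> decidable (\<lambda>x. f x dvd g x)"
  unfolding dvd_bounded
  by (intro definable_intros; (assumption | erule computable_subst[OF _ computable_p2_id]))

definition el :: "'a::arithmetic \<Rightarrow> 'a \<Rightarrow> bool" where
  "el i c \<longleftrightarrow> (\<exists>k m n. c = pr k (pr m n) \<and> i < k \<and> (m * (i + 1) + 1) dvd n)"

lemma el_alt: "el i c \<longleftrightarrow> i < p1 c \<and> pr (p1 c) (p2 c) = c \<and> pr (p1 (p2 c)) (p2 (p2 c)) = p2 c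
    \<and> (p1 (p2 c) * (i + 1) + 1) dvd p2 (p2 c)"
  unfolding el_def by (auto, metis)

lemma decidable_el [definable_intros]:
  "computable f \<Longrightarrow> computable g \<Longrightarrow> decidable (\<lambda>x. el (f x) (g x))"
  unfolding el_alt by (intro definable_intros)

lemma el_less: "el i c \<Longrightarrow> i < c"
  unfolding el_def using pr_ge1 by (metis order_less_le_trans)

lemma el_pr_less: "el (pr i y) c \<Longrightarrow> i < c" "el (pr i y) c \<Longrightarrow> y < c"
  using el_less pr_ge1 pr_ge2 by (metis order_le_less_trans)+

text \<open>
  If \<open>m\<close> is a multiple of \<open>1, ..., n\<close>, then the numbers \<open>m (i + 1) + 1\<close> with \<open>i < n\<close> are pairwise coprime:
  \<open>j + 1\<close> times the \<open>i\<close>-th one and \<open>i + 1\<close> times the \<open>j\<close>-th one differ by \<open>\<bar>i - j\<bar>\<close>, which divides \<open>m\<close>.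
\<close>

lemma moduli_coprime:
  fixes m :: "'a::arithmetic"
  assumes m: "\<forall>d<n. (d + 1) dvd m" and ij: "i < n" "j < n" "i \<noteq> j"
    and dvd: "(m * (i + 1) + 1) dvd q * (m * (j + 1) + 1)"
  shows "(m * (i + 1) + 1) dvd q"
proof -
  let ?u = "\<lambda>i. m * (i + 1) + 1"
  have "\<exists>d. (d + 1) dvd m \<and> (j = i + (d + 1) \<or> i = j + (d + 1))"
  proof (cases "i < j")
    case True
    then obtain d where d: "j = i + d + 1" unfolding less_iff_add by blast
    then have "d \<le> j" by (simp add: add.assoc add_increasing)
    then have "d < n" using ij by order
    with d m show ?thesis by (auto simp: add.assoc)
  next
    case False
    with ij have "j < i" by order
    then obtain d where d: "i = j + d + 1" unfolding less_iff_add by blast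
    then have "d \<le> i" by (simp add: add.assoc add_increasing)
    then have "d < n" using ij by order
    with d m show ?thesis by (auto simp: add.assoc)
  qed
  then obtain d where d: "(d + 1) dvd m" "j = i + (d + 1) \<or> i = j + (d + 1)" by blast
  have "?u i dvd (d + 1) * q"
    using d(2)
  proof
    assume j: "j = i + (d + 1)"
    have "?u i * (q * (j + 1)) = q * ?u j * (i + 1) + (d + 1) * q"
      unfolding j by (simp add: algebra_simps)
    then have "?u i dvd q * ?u j * (i + 1) + (d + 1) * q" by (metis dvd_triv_left)
    then show ?thesis using dvd by (metis dvd_add_right_iff dvd_mult2)
  next
    assume i: "i = j + (d + 1)"
    have "q * ?u j * (i + 1) = ?u i * (q * (j + 1)) + (d + 1) * q"
      unfolding i by (simp add: algebra_simps)
    then have "?u i dvd ?u i * (q * (j + 1)) + (d + 1) * q" using dvd by (metis dvd_mult2)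
    then show ?thesis by (metis dvd_add_right_iff dvd_triv_left)
  qed
  then have "?u i dvd m * q" using d(1) by (metis dvd_refl dvd_trans mult_dvd_mono)
  then have "?u i dvd (m * q) * (i + 1)" by (rule dvd_mult2)
  moreover have "?u i * q = (m * q) * (i + 1) + q" by (simp add: algebra_simps)
  ultimately show ?thesis by (metis dvd_add_right_iff dvd_triv_left)
qed

text \<open>
  Among the moduli \<open>m (i + 1) + 1\<close> with \<open>i < n\<close>, exactly those divide \<open>q\<close> that belong to the elements of
  \<open>P\<close> below \<open>j\<close>. Such a \<open>q\<close> is built up in \<open>n\<close> steps, multiplying by one modulus at a time.
\<close>

definition separates :: "('a::arithmetic \<Rightarrow> bool) \<Rightarrow> 'a \<Rightarrow> 'a \<Rightarrow> 'a \<Rightarrow> 'a \<Rightarrow> bool" where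
  "separates P n m j q \<longleftrightarrow> (\<forall>i<n. (m * (i + 1) + 1) dvd q \<longleftrightarrow> i < j \<and> P i)"

lemma separates_zero: "m \<noteq> 0 \<Longrightarrow> separates P n m 0 1"
  unfolding separates_def
proof (intro allI impI iffI)
  fix i assume "m \<noteq> 0" "(m * (i + 1) + 1) dvd 1"
  then have "m * (i + 1) + 1 \<le> 1" by (intro dvd_imp_le') auto
  moreover have "m * (i + 1) \<noteq> 0" using \<open>m \<noteq> 0\<close> by simp
  ultimately show "i < 0 \<and> P i" by simp
qed simp

lemma separates_succ:
  assumes m: "\<forall>d<n. (d + 1) dvd m" and "separates P n m j q"
  shows "separates P n m (j + 1) (if j < n \<and> P j then q * (m * (j + 1) + 1) else q)"
proof (cases "j < n \<and> P j")
  case True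
  have "(m * (i + 1) + 1) dvd q * (m * (j + 1) + 1) \<longleftrightarrow> i \<le> j \<and> P i" if "i < n" for i
  proof (cases "i = j")
    case False
    then have "(m * (i + 1) + 1) dvd q * (m * (j + 1) + 1) \<longleftrightarrow> (m * (i + 1) + 1) dvd q"
      using moduli_coprime[OF m that] True by (auto intro: dvd_mult2)
    then show ?thesis using assms(2) that False unfolding separates_def by (auto simp: le_less)
  qed (use True in auto)
  then show ?thesis using True by (simp add: separates_def)
next
  case False
  then show ?thesis using assms(2) unfolding separates_def by (auto simp: le_less)
qed

lemma decidable_separates:
  assumes "decidable P" "computable f" "computable g"
  shows "decidable (\<lambda>x. separates P n m (f x) (g x))"
  unfolding separates_def
  by (intro definable_intros decidable_subst[OF assms(1)] computable_subst[OF assms(2)] computable_subst[OF assms(3)])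

lemma el_separates: "separates P n m n q \<Longrightarrow> el i (pr n (pr m q)) \<longleftrightarrow> i < n \<and> P i"
  by (auto simp: el_def separates_def)

lemma ex_common_multiple: "\<exists>m. m \<noteq> 0 \<and> (\<forall>d<n. (d + 1) dvd (m::'a::arithmetic))"
proof (rule Sigma1_induct[where P = "\<lambda>n m. m \<noteq> 0 \<and> (\<forall>d<n. (d + 1) dvd m)" and x = n])
  show "decidable (\<lambda>z. p1 z \<noteq> 0 \<and> (\<forall>d<p2 z. (d + 1) dvd (p1 z :: 'a)))"
    by (intro definable_intros)
  fix n :: 'a assume "\<exists>m. m \<noteq> 0 \<and> (\<forall>d<n. (d + 1) dvd (m::'a))"
  then obtain m where m: "m \<noteq> 0" "\<forall>d<n. (d + 1) dvd m" by blast
  then have "m * (n + 1) \<noteq> 0 \<and> (\<forall>d<n + 1. (d + 1) dvd m * (n + 1))"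
    by (auto simp: le_less)
  then show "\<exists>m. m \<noteq> 0 \<and> (\<forall>d<n + 1. (d + 1) dvd (m::'a))" by blast
qed (auto intro: exI[of _ 1])

text \<open>
  The multiple \<open>m\<close> is not bounded here, and so the code is found by \<open>\<Sigma>\<^sub>1\<close> induction.
\<close>

lemma ex_code:
  assumes P: "decidable (P :: 'a::arithmetic \<Rightarrow> bool)"
  shows "\<exists>c. \<forall>i. el i c \<longleftrightarrow> i < n \<and> P i"
proof -
  obtain m where m: "m \<noteq> 0" "\<forall>d<n. (d + 1) dvd (m::'a)" using ex_common_multiple by blast
  have "\<exists>q. separates P n m n q"
  proof (rule Sigma1_induct[where P = "separates P n m" and x = n])
    show "decidable (\<lambda>z. separates P n m (p2 z) (p1 z))"
      by (intro decidable_separates P definable_intros)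
    show "\<exists>q. separates P n m 0 q" using separates_zero[OF m(1)] by (rule exI)
    show "\<exists>q. separates P n m (j + 1) q" if "\<exists>q. separates P n m j q" for j
      using that separates_succ[OF m(2)] by (auto intro: exI)
  qed
  then show ?thesis using el_separates by blast
qed

section \<open>Primitive recursion\<close>

text \<open>
  \<open>c\<close> codes the history of a recursion up to stage \<open>n\<close>. Every entry of a stage has to come from an entry of
  the previous stage; this is what makes any two histories agree.
\<close>

definition computes :: "'a::arithmetic \<Rightarrow> ('a \<Rightarrow> 'a \<Rightarrow> 'a) \<Rightarrow> 'a \<Rightarrow> 'a \<Rightarrow> bool" where
  "computes a g n c \<longleftrightarrow> (\<forall>i\<le>n. \<exists>y\<le>c. el (pr i y) c) \<and> (\<forall>y\<le>c. el (pr 0 y) c \<longrightarrow> y = a)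
    \<and> (\<forall>i<n. \<forall>y\<le>c. el (pr (i + 1) y) c \<longrightarrow> (\<exists>y'\<le>c. el (pr i y') c \<and> y = g i y'))"

lemma computes_alt:
  "computes a g n c \<longleftrightarrow> (\<forall>i\<le>n. \<exists>y. el (pr i y) c) \<and> (\<forall>y. el (pr 0 y) c \<longrightarrow> y = a)
    \<and> (\<forall>i<n. \<forall>y. el (pr (i + 1) y) c \<longrightarrow> (\<exists>y'. el (pr i y') c \<and> y = g i y'))"
proof -
  have le: "el (pr i y) c \<Longrightarrow> y \<le> c" for i y using el_pr_less(2) by (rule order.strict_implies_order)
  have "(\<exists>y\<le>c. el (pr i y) c) \<longleftrightarrow> (\<exists>y. el (pr i y) c)"
    "(\<exists>y\<le>c. el (pr i y) c \<and> Q y) \<longleftrightarrow> (\<exists>y. el (pr i y) c \<and> Q y)"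
    "(\<forall>y\<le>c. el (pr i y) c \<longrightarrow> Q y) \<longleftrightarrow> (\<forall>y. el (pr i y) c \<longrightarrow> Q y)" for i Q
    using le by blast+
  then show ?thesis unfolding computes_def by presburger
qed

lemma computes_mono: "computes a g n c \<Longrightarrow> k \<le> n \<Longrightarrow> computes a g k c"
  unfolding computes_alt by (meson order.trans order_less_le_trans)

lemma decidable_computes:
  assumes a: "computable a" and g: "computable (\<lambda>z. g (p1 z) (p1 (p2 z)) (p2 (p2 z)))"
    and "computable x" "computable n" "computable c"
  shows "decidable (\<lambda>z. computes (a (x z)) (g (x z)) (n z) (c z))"
proof -
  have g': "computable (\<lambda>z. g (u z) (v z) (w z))" if "computable u" "computable v" "computable w" for u v w
    using computable_subst[OF g computable_pr[OF that(1) computable_pr[OF that(2,3)]]] by simp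
  show ?thesis unfolding computes_def
    by (intro definable_intros g' computable_subst[OF a] computable_subst[OF assms(3)]
        computable_subst[OF assms(4)] computable_subst[OF assms(5)])
qed

lemma computes_unique:
  fixes a :: "'a::arithmetic"
  assumes g: "computable (\<lambda>z. g (p1 z) (p2 z))"
    and c: "computes a g n c" and d: "computes a g n d" and "i \<le> n" "el (pr i y) c" "el (pr i y') d"
  shows "y = y'"
proof -
  have "decidable (\<lambda>i. i \<le> n \<longrightarrow> (\<forall>y\<le>c. \<forall>y'\<le>d. el (pr i y) c \<longrightarrow> el (pr i y') d \<longrightarrow> y = y'))"
    by (intro definable_intros)
  then have "i \<le> n \<longrightarrow> (\<forall>y\<le>c. \<forall>y'\<le>d. el (pr i y) c \<longrightarrow> el (pr i y') d \<longrightarrow> y = y')"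
  proof (rule decidable_induct)
    show "0 \<le> n \<longrightarrow> (\<forall>y\<le>c. \<forall>y'\<le>d. el (pr 0 y) c \<longrightarrow> el (pr 0 y') d \<longrightarrow> y = y')"
      using c d unfolding computes_def by auto
    fix i assume IH: "i \<le> n \<longrightarrow> (\<forall>y\<le>c. \<forall>y'\<le>d. el (pr i y) c \<longrightarrow> el (pr i y') d \<longrightarrow> y = y')"
    show "i + 1 \<le> n \<longrightarrow> (\<forall>y\<le>c. \<forall>y'\<le>d. el (pr (i + 1) y) c \<longrightarrow> el (pr (i + 1) y') d \<longrightarrow> y = y')"
    proof (intro allI impI)
      fix y y' assume "i + 1 \<le> n" "y \<le> c" "y' \<le> d" "el (pr (i + 1) y) c" "el (pr (i + 1) y') d"
      then obtain z z' where "z \<le> c" "el (pr i z) c" "y = g i z" "z' \<le> d" "el (pr i z') d" "y' = g i z'"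
        using c d unfolding computes_def by (metis succ_le)
      moreover have "i \<le> n" using \<open>i + 1 \<le> n\<close> by simp
      ultimately show "y = y'" using IH by auto
    qed
  qed
  then show ?thesis using assms(4-6) el_pr_less(2) by (meson order.strict_implies_order)
qed

lemma ex_computes:
  fixes a :: "'a::arithmetic"
  assumes g: "computable (\<lambda>z. g (p1 z) (p2 z))"
  shows "\<exists>c. computes a g n c"
proof (rule Sigma1_induct[where P = "computes a g" and x = n])
  show "decidable (\<lambda>z. computes a g (p2 z) (p1 z))"
    by (rule decidable_computes[where a = "\<lambda>_. a" and g = "\<lambda>_. g" and x = "\<lambda>_. 0"])
      (intro definable_intros computable_subst2[OF g])+
  have "decidable (\<lambda>i. i = pr 0 a)" by (intro definable_intros)
  then obtain c where c: "\<And>i. el i c \<longleftrightarrow> i < pr 0 a + 1 \<and> i = pr 0 a"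
    using ex_code by blast
  have "computes a g 0 c" unfolding computes_alt by (auto simp: c)
  then show "\<exists>c. computes a g 0 c" ..
  fix n assume "\<exists>c. computes a g n c"
  then obtain c where c: "computes a g n c" by blast
  then obtain y where y: "el (pr n y) c" unfolding computes_alt by blast
  define P where "P x \<longleftrightarrow> (el x c \<and> p1 x \<le> n) \<or> x = pr (n + 1) (g n y)" for x
  have "decidable P" unfolding P_def by (intro definable_intros)
  then obtain d where d: "\<And>i. el i d \<longleftrightarrow> i < c + pr (n + 1) (g n y) + 1 \<and> P i" using ex_code by blast
  have d': "el (pr i z) d \<longleftrightarrow> (el (pr i z) c \<and> i \<le> n) \<or> (i = n + 1 \<and> z = g n y)" for i z
  proof -
    have "el (pr i z) c \<Longrightarrow> pr i z \<le> c + pr (n + 1) (g n y)"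
      using el_less by (metis add_increasing2 order.strict_implies_order zero_le)
    then show ?thesis unfolding d P_def by (auto simp: add_increasing)
  qed
  have "computes a g (n + 1) d"
    unfolding computes_alt
  proof (intro conjI allI impI)
    fix i assume "i \<le> n + 1"
    then have "i \<le> n \<or> i = n + 1" by (auto simp: le_less)
    then show "\<exists>y. el (pr i y) d" using c unfolding d' computes_alt by blast
  next
    fix z assume "el (pr 0 z) d"
    then show "z = a" using c unfolding d' computes_alt by (auto simp: succ_neq_zero[symmetric])
  next
    fix i z assume "i < n + 1" "el (pr (i + 1) z) d"
    then consider "i < n" "el (pr (i + 1) z) c" | "i = n" "z = g n y" unfolding d' by auto
    then show "\<exists>y'. el (pr i y') d \<and> z = g i y'"
    proof cases
      case 1
      then obtain z' where "el (pr i z') c" "z = g i z'" using c unfolding computes_alt by blast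
      with 1 show ?thesis unfolding d' by auto
    qed (use y d' in auto)
  qed
  then show "\<exists>c. computes a g (n + 1) c" ..
qed

text \<open>
  The value at \<open>n\<close> is the one in some history and also the one in all histories, which makes the graph of
  the recursive function \<open>\<Delta>\<^sub>1\<close>.
\<close>

theorem primitive_recursion:
  assumes a: "computable a" and g: "computable (\<lambda>z. g (p1 z) (p1 (p2 z)) (p2 (p2 z)))"
  shows "\<exists>h. computable (\<lambda>z. h (p1 z) (p2 z)) \<and> (\<forall>x. h x 0 = a x) \<and>
    (\<forall>x n. h x (n + 1) = g x n (h x n :: 'a::arithmetic))"
proof -
  have gx: "computable (\<lambda>z. g x (p1 z) (p2 z))" for x
    using computable_subst[OF g computable_pr[OF computable_const computable_id], of x] by simp
  define H where "H x n y \<longleftrightarrow> (\<exists>c. computes (a x) (g x) n c \<and> el (pr n y) c)" for x n y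
  have H_all: "H x n y \<longleftrightarrow> (\<forall>c. computes (a x) (g x) n c \<longrightarrow> el (pr n y) c)" for x n y
  proof
    assume "H x n y"
    then obtain c where c: "computes (a x) (g x) n c" "el (pr n y) c" by (auto simp: H_def)
    show "\<forall>c. computes (a x) (g x) n c \<longrightarrow> el (pr n y) c"
    proof (intro allI impI)
      fix d assume d: "computes (a x) (g x) n d"
      then obtain y' where "el (pr n y') d" unfolding computes_alt by blast
      then show "el (pr n y) d" using computes_unique[OF gx c(1) d order_refl c(2)] by simp
    qed
  next
    assume "\<forall>c. computes (a x) (g x) n c \<longrightarrow> el (pr n y) c"
    moreover obtain c where "computes (a x) (g x) n c" using ex_computes[OF gx] by blast
    ultimately show "H x n y" unfolding H_def by blast
  qed
  have H_ex1: "\<exists>!y. H x n y" for x n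
  proof -
    obtain c where c: "computes (a x) (g x) n c" using ex_computes[OF gx] by blast
    then obtain y where "el (pr n y) c" unfolding computes_alt by blast
    then show ?thesis using c H_all computes_unique[OF gx c c order_refl] by (metis H_def)
  qed
  define h where "h x n = (THE y. H x n y)" for x n
  have h: "y = h x n \<longleftrightarrow> H x n y" for x n y
    unfolding h_def using H_ex1[of x n] by (metis the_equality)
  have "computable (\<lambda>z. h (p1 z) (p2 z))"
  proof (rule computableI)
    have "decidable (\<lambda>z. \<exists>c. computes (a (p1 (p1 z))) (g (p1 (p1 z))) (p2 (p1 z)) c \<and> el (pr (p2 (p1 z)) (p2 z)) c)"
      by (rule decidable_delta1[where Q = "\<lambda>z c. computes (a (p1 (p1 z))) (g (p1 (p1 z))) (p2 (p1 z)) c \<longrightarrow> el (pr (p2 (p1 z)) (p2 z)) c"])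
        (intro definable_intros decidable_computes[OF a g], intro definable_intros decidable_computes[OF a g],
         use H_all H_def in blast)
    then show "decidable (\<lambda>z. p2 z = h (p1 (p1 z)) (p2 (p1 z)))" unfolding h H_def .
  qed
  moreover have "h x 0 = a x" for x
    using h[of _ x 0] unfolding H_def computes_alt by blast
  moreover have "h x (n + 1) = g x n (h x n)" for x n
  proof -
    obtain c where c: "computes (a x) (g x) (n + 1) c" "el (pr (n + 1) (h x (n + 1))) c"
      using h[of "h x (n + 1)"] by (auto simp: H_def)
    then obtain y where y: "el (pr n y) c" "h x (n + 1) = g x n y"
      unfolding computes_alt by (metis less_succ order_refl)
    have "computes (a x) (g x) n c" using c(1) by (rule computes_mono) simp
    then have "y = h x n" using y(1) unfolding h H_def by blast
    with y(2) show ?thesis by simp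
  qed
  ultimately show ?thesis by blast
qed

section \<open>Bounds on codes\<close>

definition ipow :: "'a::arithmetic \<Rightarrow> 'a \<Rightarrow> 'a" where
  "ipow = (SOME h. computable (\<lambda>z. h (p1 z) (p2 z)) \<and> (\<forall>x. h x 0 = 1) \<and> (\<forall>x n. h x (n + 1) = h x n * x))"

lemma ipow: "computable (\<lambda>z. ipow (p1 z) (p2 z :: 'a::arithmetic))"
    "ipow x 0 = (1 :: 'a)" "ipow x (n + 1) = ipow x n * (x :: 'a)"
proof -
  have "\<exists>h. computable (\<lambda>z. h (p1 z) (p2 z)) \<and> (\<forall>x. h x 0 = 1) \<and> (\<forall>x n. h x (n + 1) = h x n * (x :: 'a))"
    by (rule primitive_recursion[where a = "\<lambda>_. 1" and g = "\<lambda>x n y. y * x"]) (intro definable_intros)+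
  from someI_ex[OF this]
  show "computable (\<lambda>z. ipow (p1 z) (p2 z :: 'a::arithmetic))"
    "ipow x 0 = (1 :: 'a)" "ipow x (n + 1) = ipow x n * (x :: 'a)" unfolding ipow_def by blast+
qed

definition ifact :: "'a::arithmetic \<Rightarrow> 'a" where
  "ifact = (SOME h. computable h \<and> h 0 = 1 \<and> (\<forall>n. h (n + 1) = h n * (n + 1)))"

lemma ifact: "computable (ifact :: 'a::arithmetic \<Rightarrow> 'a)"
    "ifact 0 = (1 :: 'a)" "ifact (n + 1) = ifact n * (n + 1 :: 'a)"
proof -
  have "\<exists>h. computable (\<lambda>z. h (p1 z) (p2 z)) \<and> (\<forall>x. h x 0 = 1) \<and> (\<forall>x n. h x (n + 1) = h x n * (n + 1 :: 'a))"
    by (rule primitive_recursion[where a = "\<lambda>_. 1" and g = "\<lambda>x n y. y * (n + 1)"]) (intro definable_intros)+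
  then obtain h where h: "computable (\<lambda>z. h (p1 z) (p2 z))" "h 0 0 = 1" "\<And>n. h 0 (n + 1) = h 0 n * (n + 1 :: 'a)"
    by blast
  have "computable (h 0)"
    using computable_subst2[OF h(1) computable_const[of 0] computable_id] by simp
  then have "\<exists>h. computable h \<and> h 0 = 1 \<and> (\<forall>n. h (n + 1) = h n * (n + 1 :: 'a))" using h by blast
  from someI_ex[OF this]
  show "computable (ifact :: 'a::arithmetic \<Rightarrow> 'a)"
    "ifact 0 = (1 :: 'a)" "ifact (n + 1) = ifact n * (n + 1 :: 'a)" unfolding ifact_def by blast+
qed

lemmas [definable_intros] = computable_subst2[OF ipow(1)] computable_subst[OF ifact(1)]

lemma ifact_multiple: "ifact n \<noteq> 0 \<and> (\<forall>d<n. (d + 1) dvd ifact (n::'a::arithmetic))"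
proof (rule decidable_induct[where x = n])
  show "decidable (\<lambda>n. ifact n \<noteq> 0 \<and> (\<forall>d<n. (d + 1) dvd ifact (n::'a)))"
    by (intro definable_intros)
  fix n :: 'a assume "ifact n \<noteq> 0 \<and> (\<forall>d<n. (d + 1) dvd ifact n)"
  then show "ifact (n + 1) \<noteq> 0 \<and> (\<forall>d<n + 1. (d + 1) dvd ifact (n + 1))"
    by (auto simp: ifact le_less)
qed (simp add: ifact)

text \<open>
  Every set of the model that is contained in \<open>{0, ..., n - 1}\<close> has a code up to this bound: \<open>n!\<close> serves as the common multiple, and the
  product of at most \<open>n\<close> moduli is at most the \<open>n\<close>-th power of an upper bound for them.
\<close>

definition code_bound :: "'a::arithmetic \<Rightarrow> 'a" where
  "code_bound n = pr n (pr (ifact n) (ipow (ifact n * (n + 1) + 1) n))"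

lemma computable_code_bound [definable_intros]: "computable f \<Longrightarrow> computable (\<lambda>x. code_bound (f x))"
  unfolding code_bound_def by (intro definable_intros)

lemma pr_mono: "t \<le> t' \<Longrightarrow> pr s t \<le> pr s (t'::'a::arithmetic)"
  using pr_less[of s t s t'] by (auto simp: le_less)

lemma ex_bounded_code:
  assumes P: "decidable (P :: 'a::arithmetic \<Rightarrow> bool)"
  shows "\<exists>c\<le>code_bound n. \<forall>i. el i c \<longleftrightarrow> i < n \<and> P i"
proof -
  let ?m = "ifact n" and ?u = "ifact n * (n + 1) + 1"
  have m: "?m \<noteq> 0" "\<forall>d<n. (d + 1) dvd ?m" using ifact_multiple by auto
  have "\<exists>q\<le>ipow ?u n. separates P n ?m n q"
  proof (rule decidable_induct[where x = n and P = "\<lambda>j. \<exists>q\<le>ipow ?u j. separates P n ?m j q"])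
    show "decidable (\<lambda>j. \<exists>q\<le>ipow ?u j. separates P n ?m j q)"
      by (intro definable_intros decidable_separates P)
    show "\<exists>q\<le>ipow ?u 0. separates P n ?m 0 q"
      using separates_zero[OF m(1)] by (auto simp: ipow)
    fix j assume "\<exists>q\<le>ipow ?u j. separates P n ?m j q"
    then obtain q where q: "q \<le> ipow ?u j" "separates P n ?m j q" by blast
    let ?q = "if j < n \<and> P j then q * (?m * (j + 1) + 1) else q"
    have "?q \<le> ipow ?u (j + 1)"
    proof (cases "j < n \<and> P j")
      case True
      then have "?m * (j + 1) + 1 \<le> ?u" by (intro add_right_mono mult_left_mono) auto
      then show ?thesis using True q(1) by (auto simp: ipow intro!: mult_mono)
    next
      case False
      have "q * 1 \<le> ipow ?u j * ?u" by (rule mult_mono) (use q(1) in auto)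
      with False show ?thesis by (auto simp: ipow)
    qed
    with separates_succ[OF m(2) q(2)] show "\<exists>q\<le>ipow ?u (j + 1). separates P n ?m (j + 1) q" by blast
  qed
  then obtain q where q: "q \<le> ipow ?u n" "separates P n ?m n q" by blast
  have "pr n (pr ?m q) \<le> code_bound n" unfolding code_bound_def using q(1) by (intro pr_mono)
  with el_separates[OF q(2)] show ?thesis by blast
qed

text \<open>
  The canonical code of a finite set is the least one.
\<close>

definition fincode :: "'a::arithmetic \<Rightarrow> bool" where
  "fincode c \<longleftrightarrow> (\<forall>d<c. \<not> (\<forall>i. el i d \<longleftrightarrow> el i c))"

lemma fincode_bounded: "fincode c \<longleftrightarrow> (\<forall>d<c. \<exists>i<c. \<not> (el i d \<longleftrightarrow> el i (c::'a::arithmetic)))"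
  unfolding fincode_def using el_less by (metis order.strict_trans)

lemma decidable_fincode [definable_intros]: "computable f \<Longrightarrow> decidable (\<lambda>x. fincode (f x))"
  unfolding fincode_bounded
  by (intro definable_intros; (assumption | erule computable_subst[OF _ computable_p2_id] |
        erule computable_subst[OF _ computable_p2[OF computable_p2_id]]))

lemma ex_fincode:
  assumes P: "decidable (P :: 'a::arithmetic \<Rightarrow> bool)"
  shows "\<exists>c. fincode c \<and> (\<forall>i. el i c \<longleftrightarrow> i < n \<and> P i)"
proof -
  define D where "D d \<longleftrightarrow> (\<forall>i<n. el i d \<longleftrightarrow> P i) \<and> (\<forall>i<d. el i d \<longrightarrow> i < n)" for d
  have D: "D d \<longleftrightarrow> (\<forall>i. el i d \<longleftrightarrow> i < n \<and> P i)" for d unfolding D_def using el_less by blast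
  have dec: "decidable D" unfolding D_def by (intro definable_intros decidable_subst[OF P])
  obtain c where "D c" using ex_code[OF P] D by blast
  then obtain m where m: "D m" "\<forall>d<m. \<not> D d" using decidable_least[OF dec] by blast
  then have "fincode m" unfolding fincode_def D by simp
  with m(1) show ?thesis unfolding D by blast
qed

lemma fincode_le:
  assumes "fincode s" "\<And>i. el i s \<Longrightarrow> i < n"
  shows "s \<le> code_bound (n::'a::arithmetic)"
proof -
  have "decidable (\<lambda>i. el i s)" by (intro definable_intros)
  then obtain c where "c \<le> code_bound n" "\<forall>i. el i c \<longleftrightarrow> el i s"
    using ex_bounded_code[of "\<lambda>i. el i s" n] assms(2) by auto
  then show ?thesis using assms(1) unfolding fincode_def by (metis not_less order_trans linear)
qed

section \<open>Binary strings\<close>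

text \<open>
  \<open>str s l\<close> is the property expressed by \<open>String\<close>, and \<open>bstr s l\<close> is its restriction to binary strings. A
  binary string is handled through the set of positions at which it has the value 0.
\<close>

definition str :: "'a::arithmetic \<Rightarrow> 'a \<Rightarrow> bool" where
  "str s l \<longleftrightarrow> fincode s \<and> (\<forall>z. el z s \<longrightarrow> (\<exists>i c. i < l \<and> z = pr i c))
    \<and> (\<forall>i<l. \<exists>y. \<forall>z. el (pr i z) s \<longleftrightarrow> z = y)"

definition bstr :: "'a::arithmetic \<Rightarrow> 'a \<Rightarrow> bool" where
  "bstr s l \<longleftrightarrow> str s l \<and> (\<forall>i c. el (pr i c) s \<longrightarrow> c < 2)"

abbreviation zero_at :: "'a::arithmetic \<Rightarrow> 'a \<Rightarrow> bool" where
  "zero_at i s \<equiv> el (pr i 0) s"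

lemma less_two: "c < 2 \<longleftrightarrow> c = 0 \<or> c = (1::'a::arithmetic)"
  using less_succ[of c 1] less_one[of c] by (auto simp: le_less one_add_one[symmetric] simp del: less_succ less_one one_add_one)

text \<open>
  A form of the definition in which all quantifiers are bounded.
\<close>

lemma bstr_alt: "bstr s l \<longleftrightarrow> fincode s \<and> (\<forall>z<s. el z s \<longrightarrow> p1 z < l \<and> (p2 z = 0 \<or> p2 z = 1) \<and> pr (p1 z) (p2 z) = z)
    \<and> (\<forall>i<l. zero_at i s \<longleftrightarrow> \<not> el (pr i 1) (s::'a::arithmetic))"
proof
  assume s: "bstr s l"
  then have f: "fincode s" and e: "\<And>z. el z s \<Longrightarrow> \<exists>i c. i < l \<and> z = pr i c"
    and u: "\<And>i. i < l \<Longrightarrow> \<exists>y. \<forall>z. el (pr i z) s \<longleftrightarrow> z = y" and b: "\<And>i c. el (pr i c) s \<Longrightarrow> c = 0 \<or> c = 1"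
    unfolding bstr_def str_def less_two by blast+
  have "p1 z < l \<and> (p2 z = 0 \<or> p2 z = 1) \<and> pr (p1 z) (p2 z) = z" if z: "el z s" for z
  proof -
    obtain i c where "i < l" "z = pr i c" using e[OF z] by blast
    then show ?thesis using b[of i c] z by simp
  qed
  moreover have "zero_at i s \<longleftrightarrow> \<not> el (pr i 1) s" if "i < l" for i
  proof -
    obtain y where "\<forall>z. el (pr i z) s \<longleftrightarrow> z = y" using u[OF \<open>i < l\<close>] by blast
    then show ?thesis using b[of i y] by auto
  qed
  ultimately show "fincode s \<and> (\<forall>z<s. el z s \<longrightarrow> p1 z < l \<and> (p2 z = 0 \<or> p2 z = 1) \<and> pr (p1 z) (p2 z) = z)
    \<and> (\<forall>i<l. zero_at i s \<longleftrightarrow> \<not> el (pr i 1) s)" using f by blast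
next
  assume *: "fincode s \<and> (\<forall>z<s. el z s \<longrightarrow> p1 z < l \<and> (p2 z = 0 \<or> p2 z = 1) \<and> pr (p1 z) (p2 z) = z)
    \<and> (\<forall>i<l. zero_at i s \<longleftrightarrow> \<not> el (pr i 1) s)"
  then have e: "el z s \<Longrightarrow> p1 z < l \<and> (p2 z = 0 \<or> p2 z = 1) \<and> pr (p1 z) (p2 z) = z" for z
    using el_less by blast
  have b: "el (pr i c) s \<Longrightarrow> c = 0 \<or> c = 1" for i c using e[of "pr i c"] by simp
  have "\<exists>i c. i < l \<and> z = pr i c" if "el z s" for z using e[OF that] by metis
  moreover have "\<exists>y. \<forall>z. el (pr i z) s \<longleftrightarrow> z = y" if "i < l" for i
    using * that b by metis
  ultimately show "bstr s l" unfolding bstr_def str_def less_two using * b by blast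
qed

lemma decidable_bstr [definable_intros]:
  "computable f \<Longrightarrow> computable g \<Longrightarrow> decidable (\<lambda>x. bstr (f x) (g x))"
  unfolding bstr_alt
  by (intro definable_intros; (assumption | erule computable_subst[OF _ computable_p2_id]))

lemma bstr_bit: "bstr s l \<Longrightarrow> i < l \<Longrightarrow> el (pr i c) s \<longleftrightarrow> c = (if zero_at i s then 0 else (1::'a::arithmetic))"
  unfolding bstr_alt using el_less[of "pr i c" s] by (metis p2_pr zero_neq_one)

lemma bstr_index: "bstr s l \<Longrightarrow> el (pr i c) s \<Longrightarrow> i < (l::'a::arithmetic)"
  unfolding bstr_def str_def by auto

lemma str_length_unique: "str s l \<Longrightarrow> str s m \<Longrightarrow> l = (m::'a::arithmetic)"
proof -
  have "\<not> l < m" if "str s l" "str s m" for l m :: 'a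
  proof
    assume "l < m"
    then obtain y where "el (pr l y) s" using \<open>str s m\<close> unfolding str_def by blast
    then show False using \<open>str s l\<close> unfolding str_def by (metis less_irrefl pr_inject)
  qed
  then show "str s l \<Longrightarrow> str s m \<Longrightarrow> l = m" by (metis neqE)
qed

lemma str_le: "str s l \<Longrightarrow> l \<le> (s::'a::arithmetic)"
proof (rule ccontr)
  assume "str s l" "\<not> l \<le> s"
  then have "s < l" by simp
  then obtain y where "el (pr s y) s" using \<open>str s l\<close> unfolding str_def by blast
  then show False using el_pr_less by blast
qed

lemma bstr_str: "bstr s l \<Longrightarrow> str s l"
  by (simp add: bstr_def)

lemma bstr_code_bound: "bstr s l \<Longrightarrow> s \<le> code_bound (pr l (2::'a::arithmetic))"
proof (rule fincode_le)
  assume s: "bstr s l"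
  then show "fincode s" by (simp add: bstr_alt)
  fix z assume "el z s"
  then obtain i c where "z = pr i c" "i < l" "c < 2" using s unfolding bstr_def str_def by blast
  then show "z < pr l 2" by (auto intro: pr_less add_strict_mono)
qed

lemma ex_bstr:
  assumes P: "decidable (P :: 'a::arithmetic \<Rightarrow> bool)"
  shows "\<exists>s. bstr s l \<and> (\<forall>i<l. zero_at i s \<longleftrightarrow> P i)"
proof -
  let ?Q = "\<lambda>x. pr (p1 x) (p2 x) = x \<and> p1 x < l \<and> p2 x = (if P (p1 x) then 0 else 1)"
  have "decidable ?Q" by (intro definable_intros decidable_subst[OF P])
  then obtain s where s: "fincode s" "\<And>z. el z s \<longleftrightarrow> z < pr l 2 \<and> ?Q z" using ex_fincode by blast
  have el: "el z s \<longleftrightarrow> ?Q z" for z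
  proof -
    have "z < pr l 2" if "?Q z"
    proof -
      have "pr (p1 z) (p2 z) < pr l 2"
        using that by (intro pr_less add_strict_mono) (auto simp: less_two)
      then show ?thesis unfolding conjunct1[OF that] .
    qed
    then show ?thesis unfolding s(2) by blast
  qed
  have "bstr s l" unfolding bstr_alt el using s(1) by auto
  moreover have "\<forall>i<l. zero_at i s \<longleftrightarrow> P i" by (auto simp: el)
  ultimately show ?thesis by blast
qed

definition initseg :: "'a::arithmetic \<Rightarrow> 'a \<Rightarrow> bool" where
  "initseg s t \<longleftrightarrow> (\<forall>i c. el (pr i c) s \<longrightarrow> el (pr i c) t)"

lemma initseg_bstr:
  assumes s: "bstr s l" and t: "bstr t m"
  shows "initseg s t \<longleftrightarrow> l \<le> m \<and> (\<forall>i<l. zero_at i s \<longleftrightarrow> zero_at i (t::'a::arithmetic))"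
proof
  assume i: "initseg s t"
  have *: "zero_at i s \<longleftrightarrow> zero_at i t" "i < m" if "i < l" for i
  proof -
    let ?c = "if zero_at i s then 0 else 1"
    have "el (pr i ?c) s" by (rule bstr_bit[OF s that, THEN iffD2]) (rule refl)
    then have e: "el (pr i ?c) t" using i unfolding initseg_def by blast
    then show "i < m" by (rule bstr_index[OF t])
    from bstr_bit[OF t this, THEN iffD1, OF e] show "zero_at i s \<longleftrightarrow> zero_at i t"
      by (auto split: if_splits)
  qed
  have "l \<le> m" using *(2)[of m] by (metis not_less less_irrefl)
  then show "l \<le> m \<and> (\<forall>i<l. zero_at i s \<longleftrightarrow> zero_at i t)" using * by blast
next
  assume *: "l \<le> m \<and> (\<forall>i<l. zero_at i s \<longleftrightarrow> zero_at i t)"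
  show "initseg s t"
    unfolding initseg_def
  proof (intro allI impI)
    fix i c assume e: "el (pr i c) s"
    then have "i < l" by (rule bstr_index[OF s])
    then have "i < m" "zero_at i s \<longleftrightarrow> zero_at i t" using * by auto
    then show "el (pr i c) t"
      using bstr_bit[OF s \<open>i < l\<close>, THEN iffD1, OF e] by (intro bstr_bit[OF t, THEN iffD2]) simp_all
  qed
qed

lemma decidable_initseg [definable_intros]:
  assumes "computable f" "computable g"
  shows "decidable (\<lambda>x. initseg (f x) (g x :: 'a::arithmetic))"
proof -
  have *: "initseg s t \<longleftrightarrow> (\<forall>z<s. pr (p1 z) (p2 z) = z \<longrightarrow> el z s \<longrightarrow> el z t)" for s t :: 'a
    unfolding initseg_def using el_less by (metis p1_pr p2_pr)
  show ?thesis unfolding *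
    by (intro definable_intros computable_subst[OF assms(1)] computable_subst[OF assms(2)] assms)
qed

lemma ex_restriction:
  assumes "bstr t m" "l \<le> (m::'a::arithmetic)"
  shows "\<exists>s. bstr s l \<and> initseg s t"
proof -
  have "decidable (\<lambda>i. zero_at i t)" by (intro definable_intros)
  then obtain s where "bstr s l" "\<forall>i<l. zero_at i s \<longleftrightarrow> zero_at i t" using ex_bstr by blast
  then show ?thesis using assms initseg_bstr by blast
qed

section \<open>Bounded images and increasing enumerations\<close>

lemma bounded_image:
  assumes "computable (f :: 'a::arithmetic \<Rightarrow> 'a)"
  shows "\<exists>b. \<forall>x\<le>n. f x \<le> b"
proof (rule Sigma1_induct[where P = "\<lambda>n b. \<forall>x\<le>n. f x \<le> b" and x = n])
  show "decidable (\<lambda>z. \<forall>x\<le>p2 z. f x \<le> p1 z)"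
    by (intro definable_intros computable_subst[OF assms])
  fix n :: 'a assume "\<exists>b. \<forall>x\<le>n. f x \<le> b"
  then obtain b where b: "\<forall>x\<le>n. f x \<le> b" by blast
  have "f x \<le> b + f (n + 1)" if "x \<le> n + 1" for x
    using that b by (cases "x = n + 1") (auto simp: le_less[of x "n + 1"] add_increasing add_increasing2)
  then show "\<exists>b. \<forall>x\<le>n + 1. f x \<le> b" by blast
qed auto

text \<open>
  Take the first element of \<open>P\<close> at which \<open>f\<close> exceeds its previous value. For the identity function, this is
  the increasing enumeration of an infinite decidable set.
\<close>

lemma increasing_selection:
  assumes P: "decidable P" and f: "computable (f :: 'a::arithmetic \<Rightarrow> 'a)"
    and unbounded: "\<And>b. \<exists>x. P x \<and> b \<le> f x"
  shows "\<exists>h. computable h \<and> (\<forall>n. P (h n)) \<and> (\<forall>m n. m < n \<longrightarrow> f (h m) < f (h n)) \<and> (\<forall>n. n \<le> f (h n))"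
proof -
  define next_elem where "next_elem y = (LEAST x. P x \<and> f y < f x)" for y
  have ex: "\<exists>x. P x \<and> f y < f x" for y using unbounded[of "f y + 1"] by auto
  have d: "decidable (\<lambda>x. P x \<and> f y < f x)" for y by (intro definable_intros P f)
  have next_elem: "P (next_elem y)" "f y < f (next_elem y)" for y
    using decidable_Least(1)[OF d, of _ y] ex[of y] unfolding next_elem_def by blast+
  have cn: "computable next_elem"
    unfolding next_elem_def
    by (rule computable_Least) (intro definable_intros decidable_subst[OF P] computable_subst[OF f], rule ex)
  obtain a where a: "P a" using unbounded by blast
  have "\<exists>h. computable (\<lambda>z. h (p1 z) (p2 z)) \<and> (\<forall>x. h x 0 = a) \<and> (\<forall>x n. h x (n + 1) = next_elem (h x n))"
    by (rule primitive_recursion[where a = "\<lambda>_. a" and g = "\<lambda>x n y. next_elem y"])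
      (intro definable_intros computable_subst[OF cn])+
  then obtain h' where h': "computable (\<lambda>z. h' (p1 z) (p2 z))" "h' 0 0 = a" "\<And>n. h' 0 (n + 1) = next_elem (h' 0 n)"
    by blast
  define h where "h = h' 0"
  have ch: "computable h"
    using computable_subst2[OF h'(1) computable_const[of 0] computable_id] by (simp add: h_def)
  have h: "h 0 = a" "h (n + 1) = next_elem (h n)" for n using h' by (auto simp: h_def)
  have "P (h n)" for n
    using a zero_or_succ[of n] by (auto simp: h next_elem)
  moreover have mono: "m < n \<longrightarrow> f (h m) < f (h n)" for m n
  proof (rule decidable_induct[where x = n])
    show "decidable (\<lambda>n. m < n \<longrightarrow> f (h m) < f (h n))"
      by (intro definable_intros computable_subst[OF f] computable_subst[OF ch] ch)
    fix n assume "m < n \<longrightarrow> f (h m) < f (h n)"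
    then show "m < n + 1 \<longrightarrow> f (h m) < f (h (n + 1))"
      using next_elem(2)[of "h n"] by (auto simp: h le_less)
  qed simp
  moreover have "n \<le> f (h n)" for n
  proof (rule decidable_induct[where x = n])
    show "decidable (\<lambda>n. n \<le> f (h n))"
      by (intro definable_intros computable_subst[OF f] computable_subst[OF ch] ch)
    fix n assume "n \<le> f (h n)"
    then show "n + 1 \<le> f (h (n + 1))"
      using next_elem(2)[of "h n"] by (auto simp: h)
  qed simp
  ultimately show ?thesis using ch by blast
qed

section \<open>The meaning of the formulas\<close>

lemma tval_num [simp]: "tval ambient e (num k) = (of_nat k :: 'a::arithmetic)"
  by (induction k) (simp_all add: add.commute)

lemma sat_Elem [simp]:
  "sat ambient e E (Elem i c) \<longleftrightarrow> el (tval ambient e i) (tval ambient e c :: 'a::arithmetic)"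
  by (simp add: Elem_def Divides_def el_def dvd_def eval_nat_numeral eq_commute[of "_ * _"] cong: conj_cong)

lemma sat_ExUniqueN [simp]:
  "sat M e E (ExUniqueN \<phi>) \<longleftrightarrow> (\<exists>y. \<forall>z. sat M (case_nat z e) E \<phi> \<longleftrightarrow> z = y)"
  by (simp add: ExUniqueN_def sat_subst tval_case_nat)

definition unbounded_set :: "'a::arithmetic set \<Rightarrow> bool" where
  "unbounded_set X \<longleftrightarrow> (\<forall>b. \<exists>x\<in>X. b \<le> x)"

definition bounded_set :: "'a::arithmetic set \<Rightarrow> bool" where
  "bounded_set X \<longleftrightarrow> (\<exists>b. \<forall>x\<in>X. x < b)"

definition is_function :: "nat \<Rightarrow> 'a::arithmetic set \<Rightarrow> 'a set \<Rightarrow> bool" where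
  "is_function k X f \<longleftrightarrow> (\<forall>z\<in>f. \<exists>x y. x \<in> X \<and> y < of_nat k \<and> z = pr x y)
    \<and> (\<forall>x\<in>X. \<exists>y. \<forall>z. pr x z \<in> f \<longleftrightarrow> z = y)"

definition is_graph :: "'a::arithmetic set \<Rightarrow> 'a set \<Rightarrow> bool" where
  "is_graph V E \<longleftrightarrow> (\<forall>z\<in>E. \<exists>x y. x \<in> V \<and> y \<in> V \<and> z = pr x y) \<and> (\<forall>x. pr x x \<notin> E)
    \<and> (\<forall>x y. pr x y \<in> E \<longrightarrow> pr y x \<in> E)"

definition is_coloring :: "nat \<Rightarrow> 'a::arithmetic set \<Rightarrow> 'a set \<Rightarrow> 'a set \<Rightarrow> bool" where
  "is_coloring k V E f \<longleftrightarrow> is_function k V f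
    \<and> (\<forall>x\<in>V. \<forall>y\<in>V. pr x y \<in> E \<longrightarrow> (\<forall>c. pr x c \<in> f \<longrightarrow> pr y c \<notin> f))"

definition locally_colorable :: "nat \<Rightarrow> 'a::arithmetic set \<Rightarrow> 'a set \<Rightarrow> bool" where
  "locally_colorable k V E \<longleftrightarrow> (\<forall>V\<^sub>0\<in>sets. \<forall>E\<^sub>0\<in>sets. is_graph V\<^sub>0 E\<^sub>0 \<and> bounded_set V\<^sub>0 \<and> V\<^sub>0 \<subseteq> V \<and> E\<^sub>0 \<subseteq> E
    \<longrightarrow> (\<exists>f\<in>sets. is_coloring k V\<^sub>0 E\<^sub>0 f))"

definition homogeneous_for_graph :: "nat \<Rightarrow> 'a::arithmetic set \<Rightarrow> 'a set \<Rightarrow> 'a set \<Rightarrow> bool" where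
  "homogeneous_for_graph k V E H \<longleftrightarrow> H \<subseteq> V \<and> (\<forall>V\<^sub>0\<in>sets. bounded_set V\<^sub>0 \<and> V\<^sub>0 \<subseteq> V
    \<longrightarrow> (\<exists>f\<in>sets. is_coloring k V\<^sub>0 E f \<and> (\<forall>x. x \<in> V\<^sub>0 \<and> x \<in> H \<longrightarrow> pr x 0 \<in> f)))"

definition is_tree :: "'a::arithmetic set \<Rightarrow> bool" where
  "is_tree T \<longleftrightarrow> (\<forall>s\<in>T. \<exists>l. bstr s l) \<and> (\<forall>s t l. s \<in> T \<and> bstr t l \<and> initseg t s \<longrightarrow> t \<in> T)"

definition homogeneous_for_string :: "'a::arithmetic set \<Rightarrow> 'a \<Rightarrow> bool" where
  "homogeneous_for_string H s \<longleftrightarrow> (\<exists>c<2. \<exists>l. str s l \<and> (\<forall>i. i \<in> H \<longrightarrow> i < l \<longrightarrow> el (pr i c) s))"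

definition homogeneous_for_tree :: "'a::arithmetic set \<Rightarrow> 'a set \<Rightarrow> bool" where
  "homogeneous_for_tree H T \<longleftrightarrow> unbounded_set {s \<in> T. homogeneous_for_string H s}"

context
  fixes e :: "nat \<Rightarrow> 'a::arithmetic" and E :: "nat \<Rightarrow> 'a set"
begin

lemma sat_Subset [simp]: "sat ambient e E (Subset X Y) \<longleftrightarrow> E X \<subseteq> E Y"
  by (auto simp: Subset_def)

lemma sat_Finite [simp]: "sat ambient e E (Finite X) \<longleftrightarrow> bounded_set (E X)"
  by (auto simp: Finite_def bounded_set_def)

lemma sat_Infinite [simp]: "sat ambient e E (Infinite X) \<longleftrightarrow> unbounded_set (E X)"
  by (auto simp: Infinite_def bounded_set_def unbounded_set_def not_less)

lemma sat_Function [simp]: "sat ambient e E (Function k X f) \<longleftrightarrow> is_function k (E X) (E f)"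
  by (auto simp: Function_def is_function_def)

lemma sat_Graph [simp]: "sat ambient e E (Graph V F) \<longleftrightarrow> is_graph (E V) (E F)"
  by (auto simp: Graph_def is_graph_def)

lemma sat_Coloring [simp]: "sat ambient e E (Coloring k V F f) \<longleftrightarrow> is_coloring k (E V) (E F) (E f)"
  by (auto simp: Coloring_def is_coloring_def)

lemma sat_FinSetCode: "sat ambient e E (FinSetCode c) \<longleftrightarrow> fincode (tval ambient e c)"
  by (simp add: FinSetCode_def fincode_def eval_nat_numeral)

end

lemma sat_LocallyColorable [simp]:
  "sat ambient e E (LocallyColorable k V F) \<longleftrightarrow> locally_colorable k (E V) (E F)"
  by (auto simp: LocallyColorable_def locally_colorable_def Colorable_def eval_nat_numeral)

lemma sat_HomogeneousGraph [simp]: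
  "sat ambient e E (HomogeneousGraph k V F H) \<longleftrightarrow> homogeneous_for_graph k (E V) (E F) (E H)"
  by (auto simp: HomogeneousGraph_def homogeneous_for_graph_def eval_nat_numeral)

lemma sat_String [simp]:
  "sat ambient e E (String s l) \<longleftrightarrow> str (tval ambient e s) (tval ambient e l)"
  by (simp add: String_def str_def sat_FinSetCode eval_nat_numeral)

lemma sat_BinString [simp]:
  "sat ambient e E (BinString s) \<longleftrightarrow> (\<exists>l. bstr (tval ambient e s) l)"
  by (auto simp: BinString_def bstr_def eval_nat_numeral)

lemma sat_InitSeg [simp]:
  "sat ambient e E (InitSeg s t) \<longleftrightarrow> initseg (tval ambient e s) (tval ambient e t)"
  by (simp add: InitSeg_def initseg_def eval_nat_numeral)

lemma sat_BinTree [simp]: "sat ambient e E (BinTree T) \<longleftrightarrow> is_tree (E T)"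
  by (auto simp: BinTree_def is_tree_def)

lemma sat_HomogeneousTree [simp]:
  "sat ambient e E (HomogeneousTree H T) \<longleftrightarrow> homogeneous_for_tree (E H) (E T)"
  by (simp add: HomogeneousTree_def HomogeneousString_def homogeneous_for_tree_def homogeneous_for_string_def
      unbounded_set_def eval_nat_numeral not_less Bex_def conj_assoc)

definition RWKL_holds :: "'a::arithmetic itself \<Rightarrow> bool" where
  "RWKL_holds _ \<longleftrightarrow> (\<forall>T\<in>sets :: 'a set set. is_tree T \<and> unbounded_set T
    \<longrightarrow> (\<exists>H\<in>sets. unbounded_set H \<and> homogeneous_for_tree H T))"

definition RCOLOR_holds :: "nat \<Rightarrow> 'a::arithmetic itself \<Rightarrow> bool" where
  "RCOLOR_holds k _ \<longleftrightarrow> (\<forall>V\<in>sets :: 'a set set. \<forall>E\<in>sets. is_graph V E \<and> unbounded_set V \<and> locally_colorable k V E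
    \<longrightarrow> (\<exists>H\<in>sets. unbounded_set H \<and> homogeneous_for_graph k V E H))"

definition LRCOLOR_holds :: "nat \<Rightarrow> 'a::arithmetic itself \<Rightarrow> bool" where
  "LRCOLOR_holds k _ \<longleftrightarrow> (\<forall>V\<in>sets :: 'a set set. \<forall>E\<in>sets. \<forall>X\<in>sets.
    is_graph V E \<and> unbounded_set V \<and> locally_colorable k V E \<and> X \<subseteq> V \<and> unbounded_set X
    \<longrightarrow> (\<exists>H\<in>sets. unbounded_set H \<and> H \<subseteq> X \<and> homogeneous_for_graph k V E H))"

lemma sat_RWKL: "sat ambient (e :: nat \<Rightarrow> 'a::arithmetic) E RWKL \<longleftrightarrow> RWKL_holds TYPE('a)"
  by (simp add: RWKL_def RWKL_holds_def)

lemma sat_RCOLOR: "sat ambient (e :: nat \<Rightarrow> 'a::arithmetic) E (RCOLOR k) \<longleftrightarrow> RCOLOR_holds k TYPE('a)"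
  by (simp add: RCOLOR_def RCOLOR_holds_def)

lemma sat_LRCOLOR: "sat ambient (e :: nat \<Rightarrow> 'a::arithmetic) E (LRCOLOR k) \<longleftrightarrow> LRCOLOR_holds k TYPE('a)"
  by (simp add: LRCOLOR_def LRCOLOR_holds_def)

lemma LRCOLOR_imp_RCOLOR: "LRCOLOR_holds k TYPE('a::arithmetic) \<Longrightarrow> RCOLOR_holds k TYPE('a)"
  unfolding LRCOLOR_holds_def RCOLOR_holds_def by blast


section \<open>From trees to colourings\<close>

lemma decidable_finite [definable_intros]:
  "finite A \<Longrightarrow> computable f \<Longrightarrow> decidable (\<lambda>x. f x \<in> A)"
  by (induction A rule: finite_induct) (simp_all add: definable_intros)

text \<open>
  There are only boundedly many strings of bounded length, since their codes are bounded.
\<close>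

lemma long_strings: "\<exists>b. \<forall>s l. bstr s l \<and> b \<le> s \<longrightarrow> N < (l :: 'a::arithmetic)"
proof -
  have "computable (\<lambda>l. code_bound (pr l 2))" by (intro definable_intros)
  from bounded_image[OF this] obtain b where b: "\<forall>l\<le>N. code_bound (pr l 2) \<le> b" ..
  have "N < l" if "bstr s l" "b + 1 \<le> s" for s l
  proof (rule ccontr)
    assume "\<not> N < l"
    then have "s \<le> b" using b bstr_code_bound[OF that(1)] by (meson not_less order_trans)
    with that(2) show False by simp
  qed
  then show ?thesis by blast
qed

lemma less_of_nat: "c < of_nat k \<longleftrightarrow> (\<exists>j<k. c = (of_nat j :: 'a::arithmetic))"
proof (induction k)
  case (Suc k)
  have "c < of_nat (Suc k) \<longleftrightarrow> c < of_nat k \<or> c = of_nat k"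
    using less_succ[of c "of_nat k"] by (auto simp: le_less add.commute)
  with Suc show ?case by (auto simp: less_Suc_eq)
qed simp

lemma finite_below_of_nat: "finite {..<of_nat k :: 'a::arithmetic}"
proof -
  have "{..<of_nat k :: 'a} = of_nat ` {..<k}" by (auto simp: less_of_nat)
  then show ?thesis by simp
qed

locale graph_model =
  fixes k :: nat and V E :: "'a::arithmetic set"
  assumes V: "V \<in> sets" and E: "E \<in> sets" and graph: "is_graph V E"
begin

abbreviation K :: 'a where "K \<equiv> of_nat k"

text \<open>
  Only the pairs \<open>pr v c\<close> with \<open>v < N\<close> and \<open>c < K\<close> count, so that the set coded by \<open>y\<close> may be cut down to
  them.
\<close>

definition colors :: "'a \<Rightarrow> 'a \<Rightarrow> bool" where
  "colors N y \<longleftrightarrow> (\<forall>v<N. v \<in> V \<longrightarrow> (\<exists>c<K. el (pr v c) y))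
    \<and> (\<forall>v<N. \<forall>c<K. \<forall>d<K. el (pr v c) y \<longrightarrow> el (pr v d) y \<longrightarrow> c = d)
    \<and> (\<forall>u<N. \<forall>v<N. pr u v \<in> E \<longrightarrow> (\<forall>c<K. \<not> (el (pr u c) y \<and> el (pr v c) y)))"

text \<open>
  The sets \<open>C\<close> interpolate between the set of all colours, for which every set of vertices is good, and the
  set \<open>{0}\<close>, for which the good sets of vertices are the homogeneous ones.
\<close>

definition colors_in :: "'a set \<Rightarrow> 'a set \<Rightarrow> 'a \<Rightarrow> 'a \<Rightarrow> bool" where
  "colors_in C H N y \<longleftrightarrow> (\<forall>v<N. v \<in> H \<longrightarrow> (\<exists>c<K. c \<in> C \<and> el (pr v c) y))"

definition good :: "'a set \<Rightarrow> 'a set \<Rightarrow> bool" where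
  "good C H \<longleftrightarrow> (\<forall>N. \<exists>y. colors N y \<and> colors_in C H N y)"

lemma decidable_colors:
  "computable f \<Longrightarrow> computable g \<Longrightarrow> decidable (\<lambda>x. colors (f x) (g x))"
  unfolding colors_def
  by (intro definable_intros V E; (erule computable_subst[where g = p2] computable_subst[where g = "\<lambda>x. p2 (p2 x)"] computable_subst[where g = "\<lambda>x. p2 (p2 (p2 x))"], intro definable_intros)?)

lemma decidable_colors_in:
  "finite C \<Longrightarrow> H \<in> sets \<Longrightarrow> computable f \<Longrightarrow> computable g \<Longrightarrow> decidable (\<lambda>x. colors_in C H (f x) (g x))"
  unfolding colors_in_def
  by (intro definable_intros; (assumption | (erule computable_subst[where g = p2] computable_subst[where g = "\<lambda>x. p2 (p2 x)"], intro definable_intros))?)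

text \<open>
  A colouring can be cut down to fewer vertices, with a code below the computable bound. This turns the
  unbounded search for a colouring into a bounded one.
\<close>

lemma restrict_code:
  assumes "M \<le> N"
  shows "\<exists>y'\<le>code_bound (pr M K). (\<forall>v<M. \<forall>c<K. el (pr v c) y' \<longleftrightarrow> el (pr v c) y)
    \<and> (colors N y \<longrightarrow> colors M y') \<and> (\<forall>C H. colors_in C H N y \<longrightarrow> colors_in C H M y')"
proof -
  have "decidable (\<lambda>z. el z y)" by (intro definable_intros)
  then obtain y' where y': "y' \<le> code_bound (pr M K)" "\<And>z. el z y' \<longleftrightarrow> z < pr M K \<and> el z y"
    using ex_bounded_code by blast
  have el: "el (pr v c) y' \<longleftrightarrow> el (pr v c) y" if "v < M" "c < K" for v c
    unfolding y'(2) using that by (auto intro!: pr_less add_strict_mono)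
  have N: "v < M \<Longrightarrow> v < N" for v using assms by order
  have "colors M y'" if "colors N y"
    unfolding colors_def
  proof (intro conjI allI impI)
    fix v assume v: "v < M"
    note el = el[OF v]
    show "\<exists>c<K. el (pr v c) y'" if "v \<in> V"
    proof -
      obtain c where "c < K" "el (pr v c) y"
        using \<open>colors N y\<close> N[OF v] \<open>v \<in> V\<close> unfolding colors_def by blast
      then show ?thesis using el by auto
    qed
    show "c = d" if "c < K" "d < K" "el (pr v c) y'" "el (pr v d) y'" for c d
    proof -
      have "el (pr v c) y" "el (pr v d) y" using that el by auto
      then show ?thesis using \<open>colors N y\<close> N[OF v] that(1,2) unfolding colors_def by blast
    qed
  next
    fix u v c assume "u < M" "v < M" "pr u v \<in> E" "c < K"
    moreover from this have "u < N" "v < N" using N by auto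
    ultimately have "\<not> (el (pr u c) y \<and> el (pr v c) y)"
      using \<open>colors N y\<close> unfolding colors_def by blast
    then show "\<not> (el (pr u c) y' \<and> el (pr v c) y')"
      using el[of u c] el[of v c] \<open>u < M\<close> \<open>v < M\<close> \<open>c < K\<close> by simp
  qed
  moreover have "colors_in C H M y'" if "colors_in C H N y" for C H
    unfolding colors_in_def
  proof (intro allI impI)
    fix v assume v: "v < M" "v \<in> H"
    then obtain c where "c < K" "c \<in> C" "el (pr v c) y"
      using \<open>colors_in C H N y\<close> N[OF v(1)] unfolding colors_in_def by blast
    then show "\<exists>c<K. c \<in> C \<and> el (pr v c) y'" using el[OF v(1)] by auto
  qed
  ultimately show ?thesis using y'(1) el by blast
qed

lemma good_start:
  assumes "locally_colorable k V E"
  shows "good {..<K} V"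
  unfolding good_def
proof
  fix N :: 'a
  define V0 where "V0 = {v. v \<in> V \<and> v < N}"
  define E0 where "E0 = {z. z \<in> E \<and> p1 z < N \<and> p2 z < N}"
  have "V0 \<in> sets" "E0 \<in> sets"
    unfolding V0_def E0_def decidable_def[symmetric] by (intro definable_intros V E)+
  moreover have "is_graph V0 E0"
    using graph unfolding is_graph_def V0_def E0_def by fastforce
  moreover have "bounded_set V0" by (auto simp: bounded_set_def V0_def)
  ultimately obtain f where f: "f \<in> sets" "is_coloring k V0 E0 f"
    using assms unfolding locally_colorable_def V0_def E0_def by blast
  have "decidable (\<lambda>z. z \<in> f)" by (intro definable_intros f)
  then obtain y where y: "\<And>z. el z y \<longleftrightarrow> z < pr N K \<and> z \<in> f" using ex_code by blast
  have el: "el (pr v c) y \<longleftrightarrow> pr v c \<in> f" if "v < N" "c < K" for v c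
    unfolding y using that by (auto intro!: pr_less add_strict_mono)
  have fun1: "\<exists>c<K. pr v c \<in> f" and fun2: "pr v c \<in> f \<Longrightarrow> pr v d \<in> f \<Longrightarrow> c = d" if "v \<in> V0" for v c d
  proof -
    obtain a where a: "\<forall>z. pr v z \<in> f \<longleftrightarrow> z = a"
      using f(2) \<open>v \<in> V0\<close> unfolding is_coloring_def is_function_def by blast
    then have "pr v a \<in> f" by blast
    then have "a < K" using f(2) unfolding is_coloring_def is_function_def by fastforce
    then show "\<exists>c<K. pr v c \<in> f" using a by blast
    show "pr v c \<in> f \<Longrightarrow> pr v d \<in> f \<Longrightarrow> c = d" using a by simp
  qed
  have "colors N y"
    unfolding colors_def
  proof (intro conjI allI impI)
    fix v assume v: "v < N"
    then show "\<exists>c<K. el (pr v c) y" if "v \<in> V" using fun1[of v] that el by (auto simp: V0_def)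
    fix c d assume "c < K" "d < K" "el (pr v c) y" "el (pr v d) y"
    then have vc: "pr v c \<in> f" "pr v d \<in> f" using el v by auto
    then have "v \<in> V0" using f(2) unfolding is_coloring_def is_function_def by fastforce
    then show "c = d" using fun2 vc by blast
  next
    fix u v c assume uv: "u < N" "v < N" "pr u v \<in> E" "c < K"
    then have "u \<in> V0" "v \<in> V0" "pr u v \<in> E0" using graph unfolding is_graph_def V0_def E0_def by fastforce+
    then have "\<not> (pr u c \<in> f \<and> pr v c \<in> f)" using f(2) unfolding is_coloring_def by blast
    then show "\<not> (el (pr u c) y \<and> el (pr v c) y)" using uv el by auto
  qed
  moreover have "colors_in {..<K} V N y"
    unfolding colors_in_def
  proof (intro allI impI)
    fix v assume v: "v < N" "v \<in> V"
    then obtain c where "c < K" "pr v c \<in> f" using fun1[of v] by (auto simp: V0_def)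
    then show "\<exists>c<K. c \<in> {..<K} \<and> el (pr v c) y" using el[OF v(1)] by auto
  qed
  ultimately show "\<exists>y. colors N y \<and> colors_in {..<K} V N y" by blast
qed

text \<open>
  One colour is split off by an application of \<open>RWKL\<close>. The strings of the tree record, for an
  increasing enumeration \<open>h\<close> of \<open>H\<close>, which elements of \<open>H\<close> have colour \<open>c\<close> in some colouring with
  colours in \<open>C\<close> on \<open>H\<close>; a set that is homogeneous for the tree is moved back to \<open>H\<close> along \<open>h\<close>.
\<close>

lemma good_split:
  assumes RWKL: "RWKL_holds TYPE('a)"
    and H: "H \<in> sets" "unbounded_set H" and "finite C" "c < K" and good: "good (insert c C) H"
  shows "\<exists>H'\<in>sets. unbounded_set H' \<and> H' \<subseteq> H \<and> (good {c} H' \<or> good C H')"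
proof -
  have "\<exists>h. computable h \<and> (\<forall>n. h n \<in> H) \<and> (\<forall>m n. m < n \<longrightarrow> h m < h n) \<and> (\<forall>n. n \<le> h n)"
    by (rule increasing_selection[OF decidable_mem_id[OF H(1)] computable_id])
      (use H(2) in \<open>auto simp: unbounded_set_def\<close>)
  then obtain h where h: "computable h" "\<And>n. h n \<in> H" "\<And>m n. m < n \<Longrightarrow> h m < h n" "\<And>n. n \<le> h n" by blast
  have h_less: "h m < h n \<longleftrightarrow> m < n" for m n using h(3) by (metis neqE order.asym)
  note [definable_intros] = computable_subst[OF h(1)]
  define Q where "Q s l y \<longleftrightarrow> bstr s l \<and> colors (h l) y \<and> colors_in (insert c C) H (h l) y
    \<and> (\<forall>i<l. zero_at i s \<longleftrightarrow> el (pr (h i) c) y)" for s l y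
  define T where "T = {s. \<exists>l\<le>s. \<exists>y\<le>code_bound (pr (h l) K). Q s l y}"
  have T: "s \<in> T \<longleftrightarrow> (\<exists>l y. Q s l y)" for s
  proof
    assume "\<exists>l y. Q s l y"
    then obtain l y where Q: "Q s l y" by blast
    obtain y' where y': "y' \<le> code_bound (pr (h l) K)"
      "\<forall>v<h l. \<forall>d<K. el (pr v d) y' \<longleftrightarrow> el (pr v d) y"
      "colors (h l) y \<longrightarrow> colors (h l) y'" "\<forall>C H. colors_in C H (h l) y \<longrightarrow> colors_in C H (h l) y'"
      using restrict_code[OF order_refl, of "h l" y] by blast
    have "Q s l y'" using Q y' \<open>c < K\<close> h_less unfolding Q_def by auto
    moreover have "l \<le> s" using Q unfolding Q_def by (blast intro: str_le bstr_str)
    ultimately show "s \<in> T" using y'(1) unfolding T_def by blast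
  qed (auto simp: T_def)
  have "T \<in> sets"
    unfolding T_def decidable_def[symmetric] Q_def
    by (intro definable_intros decidable_colors decidable_colors_in H) (use \<open>finite C\<close> in simp)
  moreover have "is_tree T"
    unfolding is_tree_def
  proof (intro conjI ballI allI impI)
    show "\<exists>l. bstr s l" if "s \<in> T" for s using that unfolding T Q_def by blast
    fix s t m assume *: "s \<in> T \<and> bstr t m \<and> initseg t s"
    then obtain l y where Q: "Q s l y" unfolding T by blast
    then have le: "m \<le> l" and bits: "\<And>i. i < m \<Longrightarrow> zero_at i t \<longleftrightarrow> zero_at i s"
      using * initseg_bstr[of t m s l] unfolding Q_def by auto
    have "h m \<le> h l" using le h_less by (metis not_less)
    then obtain y' where y': "y' \<le> code_bound (pr (h m) K)" "\<forall>v<h m. \<forall>d<K. el (pr v d) y' \<longleftrightarrow> el (pr v d) y"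
      "colors (h l) y \<longrightarrow> colors (h m) y'" "\<forall>C H. colors_in C H (h l) y \<longrightarrow> colors_in C H (h m) y'"
      using restrict_code[where y = y] by blast
    have "Q t m y'"
      using Q * y' le bits \<open>c < K\<close> h_less unfolding Q_def by auto
    then show "t \<in> T" unfolding T by blast
  qed
  moreover have "unbounded_set T"
    unfolding unbounded_set_def
  proof
    fix l
    obtain y where y: "colors (h l) y" "colors_in (insert c C) H (h l) y" using good unfolding good_def by blast
    have "decidable (\<lambda>i. el (pr (h i) c) y)" by (intro definable_intros)
    then obtain s where s: "bstr s l" "\<forall>i<l. zero_at i s \<longleftrightarrow> el (pr (h i) c) y" using ex_bstr by blast
    have "Q s l y" unfolding Q_def by (intro conjI s y)
    then have "s \<in> T" unfolding T by (intro exI)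
    moreover have "l \<le> s" by (rule str_le[OF bstr_str[OF s(1)]])
    ultimately show "\<exists>s\<in>T. l \<le> s" by (rule rev_bexI)
  qed
  ultimately obtain H0 where H0: "H0 \<in> sets" "unbounded_set H0" "homogeneous_for_tree H0 T"
    using RWKL unfolding RWKL_holds_def by blast
  define H' where "H' = {x. \<exists>i\<le>x. x = h i \<and> i \<in> H0}"
  have H': "x \<in> H' \<longleftrightarrow> (\<exists>i\<in>H0. x = h i)" for x using h(4) unfolding H'_def by blast
  have "H' \<in> sets" unfolding H'_def decidable_def[symmetric] by (intro definable_intros H0)
  moreover have "unbounded_set H'"
    unfolding unbounded_set_def
  proof
    fix b
    obtain i where "i \<in> H0" "b \<le> i" using H0(2) unfolding unbounded_set_def by blast
    moreover then have "b \<le> h i" using h(4)[of i] by order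
    ultimately show "\<exists>x\<in>H'. b \<le> x" using H' by blast
  qed
  moreover have "H' \<subseteq> H" using h(2) H' by auto
  moreover have "good {c} H' \<or> good C H'"
  proof -
    \<comment> \<open>One of the two values is taken on \<open>H0\<close> by arbitrarily long strings of the tree.\<close>
    let ?long = "\<lambda>d. \<forall>b. \<exists>s\<in>T. \<exists>l. b \<le> s \<and> bstr s l \<and> (\<forall>i\<in>H0. i < l \<longrightarrow> el (pr i d) s)"
    have "?long 0 \<or> ?long 1"
    proof (rule ccontr)
      assume "\<not> (?long 0 \<or> ?long 1)"
      then obtain b b' where b: "\<And>s l. s \<in> T \<Longrightarrow> b \<le> s \<Longrightarrow> bstr s l \<Longrightarrow> \<exists>i\<in>H0. i < l \<and> \<not> el (pr i 0) s"
        and b': "\<And>s l. s \<in> T \<Longrightarrow> b' \<le> s \<Longrightarrow> bstr s l \<Longrightarrow> \<exists>i\<in>H0. i < l \<and> \<not> el (pr i 1) s"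
        by metis
      obtain s where s: "s \<in> T" "homogeneous_for_string H0 s" "b + b' \<le> s"
        using H0(3) unfolding homogeneous_for_tree_def unbounded_set_def by blast
      then obtain d l where d: "d = 0 \<or> d = 1" "str s l" "\<forall>i\<in>H0. i < l \<longrightarrow> el (pr i d) s"
        unfolding homogeneous_for_string_def less_two by blast
      obtain l' where l': "bstr s l'" using s(1) unfolding T Q_def by blast
      then have "l' = l" using d(2) bstr_str str_length_unique by blast
      moreover have "b \<le> s" "b' \<le> s" using s(3) by (auto intro: order_trans[rotated])
      ultimately show False using d(1,3) b[OF s(1) _ l'] b'[OF s(1) _ l'] by blast
    qed
    moreover have "good D H'" if long: "?long d" and D: "\<And>v s l y. Q s l y \<Longrightarrow> v < l \<Longrightarrow> el (pr v d) s
        \<Longrightarrow> \<exists>c'<K. c' \<in> D \<and> el (pr (h v) c') y" for d D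
      unfolding good_def
    proof
      fix N :: 'a
      obtain b where b: "\<forall>s l. bstr s l \<and> b \<le> s \<longrightarrow> N < l" using long_strings by blast
      obtain s l where s: "s \<in> T" "b \<le> s" "bstr s l" "\<And>i. i \<in> H0 \<Longrightarrow> i < l \<Longrightarrow> el (pr i d) s"
        using long by blast
      then obtain l' y where "Q s l' y" unfolding T by blast
      moreover then have "l' = l" using s(3) bstr_str str_length_unique unfolding Q_def by blast
      ultimately have Q: "Q s l y" by simp
      have "N < l" using b s by blast
      then have "N \<le> h l" using h(4)[of l] by order
      then obtain y' where y': "y' \<le> code_bound (pr N K)" "\<forall>v<N. \<forall>d<K. el (pr v d) y' \<longleftrightarrow> el (pr v d) y"
        "colors (h l) y \<longrightarrow> colors N y'" "\<forall>C H. colors_in C H (h l) y \<longrightarrow> colors_in C H N y'"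
        using restrict_code[where y = y] by blast
      have "colors_in D H' N y'"
        unfolding colors_in_def
      proof (intro allI impI)
        fix v assume v: "v < N" "v \<in> H'"
        then obtain i where i: "i \<in> H0" "v = h i" unfolding H' by blast
        have "h i < h l" using v(1) \<open>N \<le> h l\<close> unfolding i(2) by order
        then have "i < l" using h_less by blast
        then obtain c' where "c' < K" "c' \<in> D" "el (pr v c') y"
          using D[OF Q _ s(4)] i by blast
        then show "\<exists>c<K. c \<in> D \<and> el (pr v c) y'" using y'(2) v(1) by blast
      qed
      then show "\<exists>y. colors N y \<and> colors_in D H' N y" using y'(3) Q unfolding Q_def by blast
    qed
    moreover have "\<exists>c'<K. c' \<in> {c} \<and> el (pr (h v) c') y" if "Q s l y" "v < l" "el (pr v 0) s" for v s l y
      using that \<open>c < K\<close> unfolding Q_def by auto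
    moreover have "\<exists>c'<K. c' \<in> C \<and> el (pr (h v) c') y" if Q: "Q s l y" "v < l" "el (pr v 1) s" for v s l y
    proof -
      have "\<not> el (pr (h v) c) y"
        using Q bstr_alt[of s l] unfolding Q_def by auto
      moreover have "h v < h l" using Q(2) h(3) by blast
      ultimately show ?thesis using Q(1) h(2)[of v] unfolding Q_def colors_in_def by blast
    qed
    ultimately show ?thesis by blast
  qed
  ultimately show ?thesis by blast
qed

lemma good_empty:
  assumes "good {} H" "unbounded_set H"
  shows False
proof -
  obtain v where "v \<in> H" using assms(2) unfolding unbounded_set_def by blast
  moreover obtain y where "colors_in {} H (v + 1) y" using assms(1) unfolding good_def by blast
  ultimately show False unfolding colors_in_def by auto
qed

text \<open>
  As \<open>k\<close> is a standard number, the removal of colours is an induction of the metalogic.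
\<close>

lemma good_singleton:
  assumes RWKL: "RWKL_holds TYPE('a)"
    and "finite C" "C \<subseteq> {..<K}" "H \<in> sets" "unbounded_set H" "good C H"
  shows "\<exists>c<K. \<exists>H'\<in>sets. unbounded_set H' \<and> H' \<subseteq> H \<and> good {c} H'"
  using assms(2-)
proof (induction C arbitrary: H rule: finite_induct)
  case empty
  then show ?case using good_empty by blast
next
  case (insert c C)
  then obtain H' where H': "H' \<in> sets" "unbounded_set H'" "H' \<subseteq> H" "good {c} H' \<or> good C H'"
    using good_split[OF RWKL, of H C c] by auto
  from H'(4) show ?case
  proof
    assume "good {c} H'"
    then show ?thesis using H' insert.prems(1) by auto
  next
    assume "good C H'"
    then have "\<exists>c<K. \<exists>H''\<in>sets. unbounded_set H'' \<and> H'' \<subseteq> H' \<and> good {c} H''"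
      using insert.IH[of H'] insert.prems H' by auto
    then show ?thesis using H'(3) by blast
  qed
qed

text \<open>
  Exchange the colours \<open>c\<close> and 0.
\<close>

lemma good_homogeneous:
  assumes "c < K" "H \<in> sets" "H \<subseteq> V" and good: "good {c} H"
  shows "homogeneous_for_graph k V E H"
  unfolding homogeneous_for_graph_def
proof (intro conjI ballI impI)
  fix V0 assume V0: "V0 \<in> sets" "bounded_set V0 \<and> V0 \<subseteq> V"
  then obtain N where N: "\<And>v. v \<in> V0 \<Longrightarrow> v < N" unfolding bounded_set_def by blast
  obtain y where y: "colors N y" "colors_in {c} H N y" using good unfolding good_def by blast
  define swap where "swap d = (if d = c then 0 else if d = 0 then c else d)" for d
  have swap: "swap (swap d) = d" for d by (auto simp: swap_def)
  have "0 < K" using \<open>c < K\<close> by (rule order_le_less_trans[OF zero_le])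
  then have swap_less: "swap d < K" if "d < K" for d
    using that \<open>c < K\<close> by (simp add: swap_def)
  have cs: "computable swap" unfolding swap_def by (intro definable_intros)
  define f where "f = {z. pr (p1 z) (p2 z) = z \<and> p1 z \<in> V0 \<and> p2 z < K \<and> el (pr (p1 z) (swap (p2 z))) y}"
  have f: "pr v d \<in> f \<longleftrightarrow> v \<in> V0 \<and> d < K \<and> el (pr v (swap d)) y" for v d by (simp add: f_def)
  have "f \<in> sets" unfolding f_def decidable_def[symmetric]
    by (intro definable_intros V0 computable_subst[OF cs])
  moreover have "is_coloring k V0 E f"
    unfolding is_coloring_def is_function_def
  proof (intro conjI ballI allI impI)
    show "\<exists>x y. x \<in> V0 \<and> y < K \<and> z = pr x y" if "z \<in> f" for z
      using that unfolding f_def by (metis (mono_tags, lifting) mem_Collect_eq)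
    fix v assume v: "v \<in> V0"
    then obtain d where d: "d < K" "el (pr v d) y" using y(1) N V0(2) unfolding colors_def by blast
    have "pr v z \<in> f \<longleftrightarrow> z = swap d" for z
    proof
      assume "pr v z \<in> f"
      then have "swap z = d"
        using y(1) d N[OF v] swap_less unfolding colors_def f by blast
      then show "z = swap d" using swap by metis
    qed (use v d swap swap_less in \<open>auto simp: f\<close>)
    then show "\<exists>y. \<forall>z. pr v z \<in> f \<longleftrightarrow> z = y" by (intro exI allI)
    fix u d assume u: "u \<in> V0" "pr v u \<in> E" and "pr v d \<in> f"
    then have d: "d < K" "el (pr v (swap d)) y" unfolding f by auto
    have "\<forall>c<K. \<not> (el (pr v c) y \<and> el (pr u c) y)"
      using y(1) N[OF v] N[OF u(1)] u(2) unfolding colors_def by blast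
    then have "\<not> el (pr u (swap d)) y" using swap_less[OF d(1)] d(2) by blast
    then show "pr u d \<notin> f" unfolding f by blast
  qed
  moreover have "pr x 0 \<in> f" if "x \<in> V0 \<and> x \<in> H" for x
  proof -
    have "el (pr x c) y" using y(2) that N unfolding colors_in_def by blast
    then show ?thesis using that \<open>0 < K\<close> unfolding f by (auto simp: swap_def)
  qed
  ultimately show "\<exists>f\<in>sets. is_coloring k V0 E f \<and> (\<forall>x. x \<in> V0 \<and> x \<in> H \<longrightarrow> pr x 0 \<in> f)" by blast
qed (use assms in auto)

end

theorem RWKL_imp_LRCOLOR:
  assumes "RWKL_holds TYPE('a::arithmetic)"
  shows "LRCOLOR_holds k TYPE('a)"
  unfolding LRCOLOR_holds_def
proof (intro ballI impI)
  fix V E X :: "'a set"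
  assume sets: "V \<in> sets" "E \<in> sets" "X \<in> sets"
    and *: "is_graph V E \<and> unbounded_set V \<and> locally_colorable k V E \<and> X \<subseteq> V \<and> unbounded_set X"
  interpret graph_model k V E using sets * by unfold_locales auto
  have "good {..<K} X"
    using good_start * unfolding good_def colors_in_def by blast
  then obtain c H where "c < K" "H \<in> sets" "unbounded_set H" "H \<subseteq> X" "good {c} H"
    using good_singleton[OF assms finite_below_of_nat order_refl sets(3)] * by blast
  then show "\<exists>H\<in>sets. unbounded_set H \<and> H \<subseteq> X \<and> homogeneous_for_graph k V E H"
    using good_homogeneous * by blast
qed

section \<open>From trees to graphs\<close>

text \<open>
  The second alternative makes the search total; it does no harm, since the length of a string is at most
  its code. In the same spirit, \<open>pd\<close> is the predecessor function.
\<close>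

definition len :: "'a::arithmetic \<Rightarrow> 'a" where
  "len s = (LEAST l. bstr s l \<or> s \<le> l)"

definition pd :: "'a::arithmetic \<Rightarrow> 'a" where
  "pd l = (LEAST n. l \<le> n + 1)"

lemma computable_len_id: "computable (len :: 'a::arithmetic \<Rightarrow> 'a)"
  unfolding len_def by (rule computable_Least) (intro definable_intros, auto)

lemma computable_pd_id: "computable (pd :: 'a::arithmetic \<Rightarrow> 'a)"
  unfolding pd_def by (rule computable_Least) (intro definable_intros, auto intro: less_imp_le intro!: exI[of _ "_ :: 'a"])

lemmas [definable_intros] = computable_subst[OF computable_len_id] computable_subst[OF computable_pd_id]

lemma len_eq [simp]: "bstr s l \<Longrightarrow> len s = (l::'a::arithmetic)"
  unfolding len_def
proof (rule Least_equality)
  assume s: "bstr s l"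
  then show "bstr s l \<or> s \<le> l" ..
  fix m assume "bstr s m \<or> s \<le> m"
  then show "l \<le> m"
    using s str_length_unique[OF bstr_str bstr_str, of s l m] str_le[OF bstr_str, of s l] by auto
qed

lemma pd_succ [simp]: "pd (n + 1) = (n::'a::arithmetic)"
  unfolding pd_def by (rule Least_equality) auto

text \<open>
  The vertices of the graph. The vertices \<open>base j\<close> form a clique, which gives names to the colours: in what
  follows a vertex has colour \<open>j\<close> if it is coloured like \<open>base j\<close>. All other vertices will have a colour
  below 3. The colours named below are those in the colouring that belongs to a path.

  The \<open>n\<close>-th bit of the path is represented three times: for \<open>r < 3\<close>, the vertices \<open>lit r 0 n\<close> and
  \<open>lit r 1 n\<close> have the two colours different from \<open>r\<close>, in an order that depends on the bit. The colour of
  \<open>lit 2 0 n\<close> is the bit itself.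

  For a string \<open>s\<close> of length \<open>n + 1\<close> with last bit \<open>i\<close>, the vertex \<open>onpath s\<close> has colour 2 if the \<open>n\<close>-th bit
  of the path differs from \<open>i\<close>; otherwise, it has colour 0 if \<open>s\<close> is an initial segment of the path, and
  colour 1 if not. If \<open>n > 0\<close>, the vertices \<open>carry s\<close> and \<open>link s\<close> connect \<open>onpath s'\<close> with \<open>onpath s\<close>,
  where \<open>s'\<close> is \<open>s\<close> without its last bit. They pass the colour 0 on: if \<open>onpath s'\<close> has colour 0 and the
  \<open>n\<close>-th bit is \<open>i\<close>, then \<open>carry s\<close> is forced to have colour 2, \<open>link s\<close> colour 1 and \<open>onpath s\<close>
  colour 0. To do so without leaving a vertex whose colour carries no information, \<open>link s\<close> is attached
  to the same bit as \<open>onpath s\<close>, with colour 0 if the bit differs from \<open>i\<close>, and \<open>carry s\<close> is attached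
  to the same bit as \<open>onpath s'\<close>, with colour 1 if that bit differs from the last bit of \<open>s'\<close>.
\<close>

abbreviation base :: "'a::arithmetic \<Rightarrow> 'a" where "base j \<equiv> pr 0 j"
abbreviation lit :: "'a::arithmetic \<Rightarrow> 'a \<Rightarrow> 'a \<Rightarrow> 'a" where "lit r i n \<equiv> pr 1 (pr r (pr i n))"
abbreviation onpath :: "'a::arithmetic \<Rightarrow> 'a" where "onpath s \<equiv> pr 2 s"
abbreviation link :: "'a::arithmetic \<Rightarrow> 'a" where "link s \<equiv> pr 3 s"
abbreviation carry :: "'a::arithmetic \<Rightarrow> 'a" where "carry s \<equiv> pr 4 s"

definition bit_at :: "'a::arithmetic \<Rightarrow> 'a \<Rightarrow> 'a" where
  "bit_at n s = (if zero_at n s then 0 else 1)"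

definition neg_bit_at :: "'a::arithmetic \<Rightarrow> 'a \<Rightarrow> 'a" where
  "neg_bit_at n s = (if zero_at n s then 1 else 0)"

lemma computable_bit_at [definable_intros]:
    "computable f \<Longrightarrow> computable g \<Longrightarrow> computable (\<lambda>x. bit_at (f x) (g x))"
  and computable_neg_bit_at [definable_intros]:
    "computable f \<Longrightarrow> computable g \<Longrightarrow> computable (\<lambda>x. neg_bit_at (f x) (g x))"
  unfolding bit_at_def neg_bit_at_def by (intro definable_intros; assumption)+

inductive vertex :: "nat \<Rightarrow> 'a::arithmetic \<Rightarrow> bool" for k where
  "j < of_nat k \<Longrightarrow> vertex k (base j)"
| "r \<le> 2 \<Longrightarrow> i \<le> 1 \<Longrightarrow> vertex k (lit r i n)"
| "bstr s (n + 1) \<Longrightarrow> vertex k (onpath s)"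
| "bstr s (n + 1) \<Longrightarrow> vertex k (link s)"
| "bstr s (n + 1 + 1) \<Longrightarrow> vertex k (carry s)"

text \<open>
  The edges, each in one direction. A vertex that belongs to a string is adjacent to two literals: they have
  the same colour if the bit has one value, and they leave only one colour if it has the other value. The
  last two rules start the chain of marks at the empty string, which is always on the path, and forbid the
  mark for strings that are not in the tree.
\<close>

inductive arc :: "nat \<Rightarrow> 'a::arithmetic set \<Rightarrow> 'a \<Rightarrow> 'a \<Rightarrow> bool" for k T where
  Base: "i < of_nat k \<Longrightarrow> j < of_nat k \<Longrightarrow> i \<noteq> j \<Longrightarrow> arc k T (base i) (base j)"
| Extra: "p1 u \<noteq> 0 \<Longrightarrow> 3 \<le> j \<Longrightarrow> j < of_nat k \<Longrightarrow> arc k T u (base j)"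
| Lit_base: "r \<le> 2 \<Longrightarrow> i \<le> 1 \<Longrightarrow> arc k T (lit r i n) (base r)"
| Lit_neg: "r \<le> 2 \<Longrightarrow> arc k T (lit r 0 n) (lit r 1 n)"
| Lit1: "i \<le> 1 \<Longrightarrow> arc k T (lit 1 i n) (lit 2 i n)"
| Lit00: "arc k T (lit 0 0 n) (lit 2 1 n)"
| Lit01: "arc k T (lit 0 1 n) (lit 2 0 n)"
| Onpath1: "bstr s (n + 1) \<Longrightarrow> arc k T (onpath s) (lit 1 (bit_at n s) n)"
| Onpath0: "bstr s (n + 1) \<Longrightarrow> arc k T (onpath s) (lit 0 (bit_at n s) n)"
| Link2: "bstr s (n + 1) \<Longrightarrow> arc k T (link s) (lit 2 (bit_at n s) n)"
| Link1: "bstr s (n + 1) \<Longrightarrow> arc k T (link s) (lit 1 (neg_bit_at n s) n)"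
| Carry2: "bstr s (n + 1 + 1) \<Longrightarrow> arc k T (carry s) (lit 2 (neg_bit_at n s) n)"
| Carry0: "bstr s (n + 1 + 1) \<Longrightarrow> arc k T (carry s) (lit 0 (neg_bit_at n s) n)"
| Onpath_carry: "bstr s (n + 1) \<Longrightarrow> bstr s' (n + 1 + 1) \<Longrightarrow> initseg s s' \<Longrightarrow> arc k T (onpath s) (carry s')"
| Carry_link: "bstr s (n + 1 + 1) \<Longrightarrow> arc k T (carry s) (link s)"
| Link_onpath: "bstr s (n + 1) \<Longrightarrow> arc k T (link s) (onpath s)"
| Onpath_first: "bstr s 1 \<Longrightarrow> arc k T (onpath s) (base 1)"
| Onpath_dead: "bstr s (n + 1) \<Longrightarrow> s \<notin> T \<Longrightarrow> arc k T (onpath s) (base 0)"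

lemma bstr_below: "bstr s (n + 1) \<Longrightarrow> n < (s::'a::arithmetic)"
  using str_le[OF bstr_str, of s "n + 1"] by simp

lemma bstr_below2: "bstr s (n + 1 + 1) \<Longrightarrow> n < (s::'a::arithmetic)"
  using bstr_below[of s "n + 1"] by (simp add: less_imp_le order.strict_trans[of n "n+1" s])

lemma bstr_le_pr: "bstr s (n + 1) \<Longrightarrow> n \<le> pr a (s::'a::arithmetic)"
    "bstr s (n + 1 + 1) \<Longrightarrow> n \<le> pr a (s::'a::arithmetic)"
  by (meson bstr_below order_trans pr_ge2 less_imp_le) (meson bstr_below2 order_trans pr_ge2 less_imp_le)

text \<open>
  Bounded forms of the two inductive definitions, from which their decidability can be read off.
\<close>

lemma vertex_alt: "vertex k v \<longleftrightarrow>
    (p1 v = 0 \<and> v = base (p2 v) \<and> p2 v < of_nat k)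
  \<or> (\<exists>r\<le>2. \<exists>i\<le>1. \<exists>n\<le>v. v = lit r i (n::'a::arithmetic))
  \<or> (\<exists>s\<le>v. \<exists>n\<le>v. bstr s (n + 1) \<and> (v = onpath s \<or> v = link s))
  \<or> (\<exists>s\<le>v. \<exists>n\<le>v. bstr s (n + 1 + 1) \<and> v = carry s)"
  (is "_ \<longleftrightarrow> ?R")
proof
  assume "vertex k v"
  then show ?R
  proof cases
    case (2 r i n)
    have "n \<le> v" unfolding 2 by (meson order_trans pr_ge2)
    with 2 show ?thesis by blast
  next
    case (3 s n)
    then show ?thesis using bstr_le_pr(1)[of s n 2] pr_ge2[of s 2] by blast
  next
    case (4 s n)
    then show ?thesis using bstr_le_pr(1)[of s n 3] pr_ge2[of s 3] by blast
  next
    case (5 s n)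
    then show ?thesis using bstr_le_pr(2)[of s n 4] pr_ge2[of s 4] by blast
  qed auto
next
  have "vertex k v" if "p1 v = 0 \<and> v = base (p2 v) \<and> p2 v < of_nat k"
    using vertex.intros(1)[of "p2 v" k] that by simp
  then show "?R \<Longrightarrow> vertex k v" by (auto intro: vertex.intros(2-))
qed

lemma arc_alt: "arc k T u v \<longleftrightarrow>
    (p1 u = 0 \<and> u = base (p2 u) \<and> p1 v = 0 \<and> v = base (p2 v) \<and> p2 u < of_nat k \<and> p2 v < of_nat k \<and> p2 u \<noteq> p2 v)
  \<or> (p1 u \<noteq> 0 \<and> p1 v = 0 \<and> v = base (p2 v) \<and> 3 \<le> p2 v \<and> p2 v < of_nat k)
  \<or> (\<exists>r\<le>2. \<exists>i\<le>1. \<exists>n\<le>u. u = lit r i n \<and> (v = base r \<or> i = 0 \<and> v = lit r 1 n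
        \<or> r = 1 \<and> v = lit 2 i n \<or> r = 0 \<and> i = 0 \<and> v = lit 2 1 n \<or> r = 0 \<and> i = 1 \<and> v = lit 2 0 n))
  \<or> (\<exists>s\<le>u. \<exists>n\<le>u. bstr s (n + 1) \<and> u = onpath s \<and> (v = lit 1 (bit_at n s) n \<or> v = lit 0 (bit_at n s) n
        \<or> (\<exists>s'\<le>v. bstr s' (n + 1 + 1) \<and> initseg s s' \<and> v = carry s') \<or> n = 0 \<and> v = base 1 \<or> s \<notin> T \<and> v = base 0))
  \<or> (\<exists>s\<le>u. \<exists>n\<le>u. bstr s (n + 1) \<and> u = link s
        \<and> (v = lit 2 (bit_at n s) n \<or> v = lit 1 (neg_bit_at n s) n \<or> v = onpath s))
  \<or> (\<exists>s\<le>u. \<exists>n\<le>u. bstr s (n + 1 + 1) \<and> u = carry s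
        \<and> (v = lit 2 (neg_bit_at n s) n \<or> v = lit 0 (neg_bit_at n s) n \<or> v = link (s::'a::arithmetic)))"
  (is "_ \<longleftrightarrow> ?base \<or> ?extra \<or> ?lit \<or> ?onpath \<or> ?link \<or> ?carry")
proof
  have n: "n \<le> lit r i n" for r i n :: 'a by (meson order_trans pr_ge2)
  assume "arc k T u v"
  then show "?base \<or> ?extra \<or> ?lit \<or> ?onpath \<or> ?link \<or> ?carry"
  proof cases
    case (Base i j)
    then have ?base
      by simp
    then show ?thesis by blast
  next
    case (Extra j)
    then have ?extra
      by simp
    then show ?thesis by blast
  next
    case (Lit_base r i n)
    then have ?lit
      by - (rule exI[of _ "r"], rule conjI, simp, rule exI[of _ "i"], rule conjI, simp, rule exI[of _ n], simp add: n)
    then show ?thesis by blast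
  next
    case (Lit_neg r n)
    then have ?lit
      by - (rule exI[of _ "r"], rule conjI, simp, rule exI[of _ "0"], rule conjI, simp, rule exI[of _ n], simp add: n)
    then show ?thesis by blast
  next
    case (Lit1 i n)
    then have ?lit
      by - (rule exI[of _ "1"], rule conjI, simp, rule exI[of _ "i"], rule conjI, simp, rule exI[of _ n], simp add: n)
    then show ?thesis by blast
  next
    case (Lit00 n)
    then have ?lit
      by - (rule exI[of _ "0"], rule conjI, simp, rule exI[of _ "0"], rule conjI, simp, rule exI[of _ n], simp add: n)
    then show ?thesis by blast
  next
    case (Lit01 n)
    then have ?lit
      by - (rule exI[of _ "0"], rule conjI, simp, rule exI[of _ "1"], rule conjI, simp, rule exI[of _ n], simp add: n)
    then show ?thesis by blast
  next
    case (Onpath1 s n)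
    then have ?onpath
      by - (rule exI[of _ s], rule conjI, simp, rule exI[of _ n], simp add: bstr_le_pr)
    then show ?thesis by blast
  next
    case (Onpath0 s n)
    then have ?onpath
      by - (rule exI[of _ s], rule conjI, simp, rule exI[of _ n], simp add: bstr_le_pr)
    then show ?thesis by blast
  next
    case (Link2 s n)
    then have ?link
      by - (rule exI[of _ s], rule conjI, simp, rule exI[of _ n], simp add: bstr_le_pr)
    then show ?thesis by blast
  next
    case (Link1 s n)
    then have ?link
      by - (rule exI[of _ s], rule conjI, simp, rule exI[of _ n], simp add: bstr_le_pr)
    then show ?thesis by blast
  next
    case (Carry2 s n)
    then have ?carry
      by - (rule exI[of _ s], rule conjI, simp, rule exI[of _ n], simp add: bstr_le_pr)
    then show ?thesis by blast
  next
    case (Carry0 s n)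
    then have ?carry
      by - (rule exI[of _ s], rule conjI, simp, rule exI[of _ n], simp add: bstr_le_pr)
    then show ?thesis by blast
  next
    case (Carry_link s n)
    then have ?carry
      by - (rule exI[of _ s], rule conjI, simp, rule exI[of _ n], simp add: bstr_le_pr)
    then show ?thesis by blast
  next
    case (Link_onpath s n)
    then have ?link
      by - (rule exI[of _ s], rule conjI, simp, rule exI[of _ n], simp add: bstr_le_pr)
    then show ?thesis by blast
  next
    case (Onpath_dead s n)
    then have ?onpath
      by - (rule exI[of _ s], rule conjI, simp, rule exI[of _ n], simp add: bstr_le_pr)
    then show ?thesis by blast
  next
    case (Onpath_first s)
    then have ?onpath
      by - (rule exI[of _ s], rule conjI, simp, rule exI[of _ 0], simp)
    then show ?thesis by blast
  next
    case (Onpath_carry s n s')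
    then have ?onpath
      by - (rule exI[of _ s], rule conjI, simp, rule exI[of _ n], simp add: bstr_le_pr)
    then show ?thesis by blast
  qed
next
  show "?base \<or> ?extra \<or> ?lit \<or> ?onpath \<or> ?link \<or> ?carry \<Longrightarrow> arc k T u v"
  proof (elim disjE exE conjE)
    assume "u = base (p2 u)" "v = base (p2 v)" "p2 u < of_nat k" "p2 v < of_nat k" "p2 u \<noteq> p2 v"
    then show ?thesis using arc.Base[of "p2 u" k "p2 v" T] by simp
  next
    assume "p1 u \<noteq> 0" "v = base (p2 v)" "3 \<le> p2 v" "p2 v < of_nat k"
    then show ?thesis using arc.Extra[of u "p2 v" k T] by simp
  qed (auto intro: arc.intros)
qed

lemma decidable_vertex: "decidable (vertex k :: 'a::arithmetic \<Rightarrow> bool)"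
  unfolding vertex_alt by (intro definable_intros)

lemma decidable_arc:
  assumes "T \<in> sets" "computable f" "computable g"
  shows "decidable (\<lambda>x. arc k T (f x) (g x :: 'a::arithmetic))"
proof (rule decidable_subst2[OF _ assms(2,3)])
  show "decidable (\<lambda>z. arc k T (p1 z) (p2 z))"
    unfolding arc_alt by (intro definable_intros assms(1))
qed

lemma arc_irrefl: "\<not> arc k T u (u::'a::arithmetic)"
  by (auto elim: arc.cases)

section \<open>The colouring of a path\<close>

definition agree :: "'a::arithmetic \<Rightarrow> 'a \<Rightarrow> 'a \<Rightarrow> bool" where
  "agree s \<tau> n \<longleftrightarrow> (zero_at n s \<longleftrightarrow> zero_at n \<tau>)"

definition agree_below :: "'a::arithmetic \<Rightarrow> 'a \<Rightarrow> 'a \<Rightarrow> bool" where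
  "agree_below s \<tau> n \<longleftrightarrow> (\<forall>m<n. agree s \<tau> m)"

text \<open>
  The colouring that belongs to a path of which \<open>\<tau>\<close> is a long initial segment. For \<open>onpath_color\<close> and
  \<open>link_color\<close>, \<open>n\<close> is the position of the last bit of \<open>s\<close>, and for \<open>carry_color\<close> the position before.
\<close>

definition lit_color :: "'a::arithmetic \<Rightarrow> 'a \<Rightarrow> 'a \<Rightarrow> 'a \<Rightarrow> 'a" where
  "lit_color \<tau> r i n = (if zero_at n \<tau> \<longleftrightarrow> i = 0 then if r = 2 then 0 else 2 else if r = 1 then 0 else 1)"

definition onpath_color :: "'a::arithmetic \<Rightarrow> 'a \<Rightarrow> 'a \<Rightarrow> 'a" where
  "onpath_color \<tau> s n = (if \<not> agree s \<tau> n then 2 else if agree_below s \<tau> n then 0 else 1)"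

definition link_color :: "'a::arithmetic \<Rightarrow> 'a \<Rightarrow> 'a \<Rightarrow> 'a" where
  "link_color \<tau> s n = (if \<not> agree s \<tau> n then 0 else if agree_below s \<tau> n then 1 else 2)"

definition carry_color :: "'a::arithmetic \<Rightarrow> 'a \<Rightarrow> 'a \<Rightarrow> 'a" where
  "carry_color \<tau> s n = (if \<not> agree s \<tau> n then 1 else if \<not> agree s \<tau> (n + 1) then 2
    else if agree_below s \<tau> n then 2 else 0)"

definition path_color :: "'a::arithmetic \<Rightarrow> 'a \<Rightarrow> 'a" where
  "path_color \<tau> v = (if p1 v = 0 then p2 v
    else if p1 v = 1 then lit_color \<tau> (p1 (p2 v)) (p1 (p2 (p2 v))) (p2 (p2 (p2 v)))
    else if p1 v = 2 then onpath_color \<tau> (p2 v) (pd (len (p2 v)))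
    else if p1 v = 3 then link_color \<tau> (p2 v) (pd (len (p2 v)))
    else carry_color \<tau> (p2 v) (pd (pd (len (p2 v)))))"

lemma computable_path_color: "computable (path_color \<tau>)"
  unfolding path_color_def lit_color_def onpath_color_def link_color_def carry_color_def agree_below_def agree_def
  by (intro definable_intros)

lemma path_color_simps [simp]:
  "path_color \<tau> (base j) = j"
  "path_color \<tau> (lit r i n) = lit_color \<tau> r i n"
  "bstr s (n + 1) \<Longrightarrow> path_color \<tau> (onpath s) = onpath_color \<tau> s n"
  "bstr s (n + 1) \<Longrightarrow> path_color \<tau> (link s) = link_color \<tau> s n"
  "bstr s (n + 1 + 1) \<Longrightarrow> path_color \<tau> (carry s) = carry_color \<tau> s n"
  by (simp_all add: path_color_def)

lemma agree_below_succ: "agree_below s \<tau> (n + 1) \<longleftrightarrow> agree_below s \<tau> n \<and> agree s \<tau> n"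
  by (auto simp: agree_below_def le_less)

lemma path_color_le: "vertex k v \<Longrightarrow> p1 v \<noteq> 0 \<Longrightarrow> path_color \<tau> v \<le> 2"
  by (auto elim!: vertex.cases simp: lit_color_def onpath_color_def link_color_def carry_color_def)

text \<open>
  The tree and the length of \<open>\<tau>\<close> matter for one kind of edges only: a marked string is an initial segment of
  \<open>\<tau>\<close>, and so it belongs to the tree.
\<close>

lemma path_color_proper:
  assumes T: "is_tree T" "\<tau> \<in> T" "bstr \<tau> L" and arc: "arc k T u v" and "vertex k u" "u < L"
  shows "path_color \<tau> u \<noteq> path_color \<tau> v"
  using arc
proof cases
  case (Base i j)
  then show ?thesis by simp
next
  case (Extra j)
  have "path_color \<tau> u < 3"
    using path_color_le[OF \<open>vertex k u\<close> Extra(2), of \<tau>] by (rule order_le_less_trans) simp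
  then show ?thesis using Extra by auto
next
  case (Lit_base r i n)
  then show ?thesis by (auto simp: lit_color_def)
next
  case (Lit_neg r n)
  then show ?thesis by (auto simp: lit_color_def)
next
  case (Lit1 i n)
  then show ?thesis by (auto simp: lit_color_def)
next
  case (Lit00 n)
  then show ?thesis by (auto simp: lit_color_def)
next
  case (Lit01 n)
  then show ?thesis by (auto simp: lit_color_def)
next
  case (Onpath1 s n)
  then show ?thesis by (auto simp: lit_color_def onpath_color_def agree_def bit_at_def)
next
  case (Onpath0 s n)
  then show ?thesis by (auto simp: lit_color_def onpath_color_def agree_def bit_at_def)
next
  case (Link2 s n)
  then show ?thesis by (auto simp: lit_color_def link_color_def agree_def bit_at_def)
next
  case (Link1 s n)
  then show ?thesis by (auto simp: lit_color_def link_color_def agree_def neg_bit_at_def)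
next
  case (Carry2 s n)
  then show ?thesis by (auto simp: lit_color_def carry_color_def agree_def neg_bit_at_def)
next
  case (Carry0 s n)
  then show ?thesis by (auto simp: lit_color_def carry_color_def agree_def neg_bit_at_def)
next
  case (Onpath_carry s n s')
  then have eq: "\<forall>i<n + 1. zero_at i s \<longleftrightarrow> zero_at i s'" using initseg_bstr by blast
  then have "agree s \<tau> n \<longleftrightarrow> agree s' \<tau> n" by (simp add: agree_def)
  moreover have "agree_below s \<tau> n \<longleftrightarrow> agree_below s' \<tau> n"
    using eq by (auto simp: agree_below_def agree_def less_imp_le)
  ultimately show ?thesis using Onpath_carry by (auto simp: onpath_color_def carry_color_def)
next
  case (Carry_link s n)
  then have "path_color \<tau> (link s) = link_color \<tau> s (n + 1)" by simp
  with Carry_link show ?thesis by (auto simp: carry_color_def link_color_def agree_below_succ)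
next
  case (Link_onpath s n)
  then show ?thesis by (auto simp: onpath_color_def link_color_def)
next
  case (Onpath_first s)
  then have "bstr s (0 + 1)" by simp
  then have "path_color \<tau> (onpath s) = onpath_color \<tau> s 0" by (rule path_color_simps)
  then show ?thesis using Onpath_first by (simp add: onpath_color_def agree_below_def)
next
  case (Onpath_dead s n)
  have "\<not> (agree s \<tau> n \<and> agree_below s \<tau> n)"
  proof
    assume *: "agree s \<tau> n \<and> agree_below s \<tau> n"
    have "n < s" using Onpath_dead by (intro bstr_below)
    then have "n < L" using \<open>u < L\<close> pr_ge2[of s 2] unfolding Onpath_dead by order
    moreover have "\<forall>m<n + 1. zero_at m s \<longleftrightarrow> zero_at m \<tau>"
      using * agree_below_succ[of s \<tau> n] unfolding agree_below_def agree_def by blast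
    ultimately have "initseg s \<tau>" using initseg_bstr[OF Onpath_dead(3) T(3)] by simp
    then have "s \<in> T" using T Onpath_dead(3) unfolding is_tree_def by blast
    with Onpath_dead show False by blast
  qed
  then show ?thesis using Onpath_dead by (auto simp: onpath_color_def)
qed

locale tree_model =
  fixes k :: nat and T :: "'a::arithmetic set"
  assumes k: "3 \<le> k" and T: "T \<in> sets" "is_tree T" "unbounded_set T"
begin

definition V :: "'a set" where "V = {v. vertex k v}"

definition E :: "'a set" where
  "E = {z. z = pr (p1 z) (p2 z) \<and> p1 z \<in> V \<and> p2 z \<in> V \<and> (arc k T (p1 z) (p2 z) \<or> arc k T (p2 z) (p1 z))}"

lemma V_sets: "V \<in> sets"
  using decidable_vertex[of k] by (simp add: V_def decidable_def)

lemma E_sets: "E \<in> sets"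
  unfolding E_def decidable_def[symmetric]
  by (intro definable_intros decidable_arc T V_sets) 

lemma in_E: "pr u v \<in> E \<longleftrightarrow> u \<in> V \<and> v \<in> V \<and> (arc k T u v \<or> arc k T v u)"
  by (simp add: E_def)

lemma is_graph: "is_graph V E"
  unfolding is_graph_def
proof (intro conjI ballI allI impI)
  fix z assume "z \<in> E"
  then show "\<exists>x y. x \<in> V \<and> y \<in> V \<and> z = pr x y" unfolding E_def by blast
qed (auto simp: in_E arc_irrefl)

lemma unbounded_V: "unbounded_set V"
  unfolding unbounded_set_def
proof
  fix b
  have "lit 0 0 b \<in> V" unfolding V_def by (auto intro: vertex.intros)
  moreover have "b \<le> lit 0 0 b" by (meson order_trans pr_ge2)
  ultimately show "\<exists>x\<in>V. b \<le> x" by blast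
qed

lemma three_le: "3 \<le> (of_nat k :: 'a)"
  using k of_nat_mono[of 3 k, where 'a = 'a] by simp

text \<open>
  A finite subgraph only mentions bits and strings below some number, and so it is coloured by any string of
  the tree that is longer than this number.
\<close>

lemma locally_colorable: "locally_colorable k V E"
  unfolding locally_colorable_def
proof (intro ballI impI)
  fix V0 E0 assume sets: "V0 \<in> sets" "E0 \<in> sets"
    and *: "is_graph V0 E0 \<and> bounded_set V0 \<and> V0 \<subseteq> V \<and> E0 \<subseteq> E"
  then obtain N where N: "\<And>v. v \<in> V0 \<Longrightarrow> v < N" unfolding bounded_set_def by blast
  obtain b where b: "\<forall>s l. bstr s l \<and> b \<le> s \<longrightarrow> N < (l::'a)" using long_strings by blast
  obtain \<tau> where \<tau>: "\<tau> \<in> T" "b \<le> \<tau>" using T(3) unfolding unbounded_set_def by blast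
  then obtain L where L: "bstr \<tau> L" using T(2) unfolding is_tree_def by blast
  then have "N < L" using b \<tau> by blast
  define f where "f = {z. z = pr (p1 z) (p2 z) \<and> p1 z \<in> V0 \<and> p2 z = path_color \<tau> (p1 z)}"
  have f: "pr v c \<in> f \<longleftrightarrow> v \<in> V0 \<and> c = path_color \<tau> v" for v c by (simp add: f_def)
  have "f \<in> sets" unfolding f_def decidable_def[symmetric]
    by (intro definable_intros sets computable_subst[OF computable_path_color])
  moreover have "is_coloring k V0 E0 f"
    unfolding is_coloring_def is_function_def
  proof (intro conjI ballI allI impI)
    fix z assume "z \<in> f"
    then have z: "z = pr (p1 z) (path_color \<tau> (p1 z))" "p1 z \<in> V0" unfolding f_def by auto
    have v: "vertex k (p1 z)" using z(2) * by (auto simp: V_def)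
    have "path_color \<tau> (p1 z) < of_nat k"
    proof (cases "p1 (p1 z) = 0")
      case True
      then show ?thesis using v by (auto elim: vertex.cases)
    next
      case False
      have "(2::'a) < 3" by simp
      then show ?thesis using path_color_le[OF v False, of \<tau>] three_le by order
    qed
    then show "\<exists>x y. x \<in> V0 \<and> y < of_nat k \<and> z = pr x y" using z by blast
  next
    fix u v c assume uv: "u \<in> V0" "v \<in> V0" "pr u v \<in> E0" "pr u c \<in> f"
    then have "pr u v \<in> E" using * by blast
    then have "vertex k u" "vertex k v" "arc k T u v \<or> arc k T v u" unfolding in_E by (auto simp: V_def)
    moreover have "u < L" "v < L" using N uv \<open>N < L\<close> by (meson order.strict_trans)+
    ultimately have "path_color \<tau> u \<noteq> path_color \<tau> v"
      using path_color_proper[OF T(2) \<tau>(1) L] by metis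
    then show "pr v c \<notin> f" using uv(4) unfolding f by auto
  qed (auto simp: f)
  ultimately show "\<exists>f\<in>sets. is_coloring k V0 E0 f" by blast
qed

end

section \<open>Reading a path off from a colouring\<close>

text \<open>
  The vertex \<open>v\<close> is attached to bit number \<open>level v\<close>. It has colour \<open>odd_color v\<close> for one value of this bit,
  which is 0 if \<open>odd_bit v\<close> holds and 1 otherwise, and one of the two other colours for the other value.
\<close>

definition level :: "'a::arithmetic \<Rightarrow> 'a" where
  "level v = (if p1 v = 1 then p2 (p2 (p2 v)) else if p1 v = 4 then pd (pd (len (p2 v))) else pd (len (p2 v)))"

definition odd_color :: "'a::arithmetic \<Rightarrow> 'a" where
  "odd_color v = (if p1 v = 1 then if p1 (p2 v) = 2 then 0 else 2 else if p1 v = 2 then 2 else if p1 v = 3 then 0 else 1)"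

definition odd_bit :: "'a::arithmetic \<Rightarrow> bool" where
  "odd_bit v \<longleftrightarrow> (p1 v = 1 \<longrightarrow> p1 (p2 (p2 v)) = 0) \<and> (p1 v \<noteq> 1 \<longrightarrow> \<not> zero_at (level v) (p2 v))"

lemma level_simps [simp]:
  "level (lit r i n) = n"
  "bstr s (n + 1) \<Longrightarrow> level (onpath s) = n"
  "bstr s (n + 1) \<Longrightarrow> level (link s) = n"
  "bstr s (n + 1 + 1) \<Longrightarrow> level (carry s) = n"
  by (simp_all add: level_def)

lemma computable_level_id: "computable (level :: 'a::arithmetic \<Rightarrow> 'a)"
  unfolding level_def by (intro definable_intros)

lemmas [definable_intros] = computable_subst[OF computable_level_id]

lemma pr_mono2: "s \<le> s' \<Longrightarrow> t \<le> t' \<Longrightarrow> pr s t \<le> pr s' (t'::'a::arithmetic)"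
  unfolding pr_def by (intro add_mono mult_mono) auto

context tree_model
begin

text \<open>
  Strings of bounded length have bounded codes, and therefore a finite part of the graph contains everything
  that is attached to the first bits.
\<close>

lemma ex_low_bound:
  "\<exists>M. (\<forall>j<of_nat k. base j < M) \<and> (\<forall>n\<le>L. \<forall>r\<le>2. \<forall>i\<le>1. lit r i n < M)
    \<and> (\<forall>v. vertex k v \<and> p1 v \<noteq> 0 \<and> level v \<le> L \<longrightarrow> v < (M::'a))"
proof -
  have "computable (\<lambda>l. code_bound (pr l 2))" by (intro definable_intros)
  from bounded_image[OF this] obtain b where b: "\<forall>l\<le>L + 1 + 1. code_bound (pr l 2) \<le> b" ..
  let ?M = "pr 0 (of_nat k) + pr 1 (pr 2 (pr 1 L)) + pr 4 b + 1"
  have le: "pr 0 (of_nat k) \<le> pr 0 (of_nat k) + pr 1 (pr 2 (pr 1 L)) + pr 4 b"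
    "pr 1 (pr 2 (pr 1 L)) \<le> pr 0 (of_nat k) + pr 1 (pr 2 (pr 1 L)) + pr 4 b"
    "pr 4 b \<le> pr 0 (of_nat k) + pr 1 (pr 2 (pr 1 L)) + pr 4 b"
    by (simp_all add: add_increasing add_increasing2 add.assoc)
  have base_less: "base j < ?M" if "j < of_nat k" for j
    using order_trans[OF pr_mono2[OF order_refl less_imp_le[OF that]] le(1)] by simp
  have lit_less: "lit r i n < ?M" if "r \<le> 2" "i \<le> 1" "n \<le> L" for r i n
    using order_trans[OF pr_mono2[OF order_refl pr_mono2[OF that(1) pr_mono2[OF that(2,3)]]] le(2)] by simp
  have str_less: "pr a s < ?M" if "a \<le> 4" "bstr s l" "l \<le> L + 1 + 1" for a s l
  proof -
    have "s \<le> b" using b that(3) bstr_code_bound[OF that(2)] by (meson order_trans)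
    then show ?thesis using order_trans[OF pr_mono2[OF that(1)] le(3)] by simp
  qed
  have L: "n + 1 \<le> L + 1 + 1" "n + 1 + 1 \<le> L + 1 + 1" if "n \<le> L" for n :: 'a
    using that by (auto simp: add_right_mono order.strict_implies_order intro: order_le_less_trans)
  have "v < ?M" if "vertex k v \<and> p1 v \<noteq> 0 \<and> level v \<le> L" for v
    using that[THEN conjunct1]
  proof cases
    case (2 r i n)
    then show ?thesis using that lit_less by simp
  next
    case (3 s n)
    then show ?thesis using that str_less[of 2 s "n + 1"] L(1)[of n] by simp
  next
    case (4 s n)
    then show ?thesis using that str_less[of 3 s "n + 1"] L(1)[of n] by simp
  next
    case (5 s n)
    then show ?thesis using that str_less[of 4 s "n + 1 + 1"] L(2)[of n] by simp
  qed (use that in simp)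
  with base_less lit_less show ?thesis by blast
qed

end

locale colored_part = tree_model k T for k and T :: "'a::arithmetic set" +
  fixes M :: 'a and f
  assumes f_sets: "f \<in> sets" and f: "is_coloring k {v \<in> V. v < M} E f"
    and base_M: "\<And>j. j < of_nat k \<Longrightarrow> base j < M"
begin

abbreviation part :: "'a set" where "part \<equiv> {v \<in> V. v < M}"

lemma color_ex1: "v \<in> part \<Longrightarrow> \<exists>c. \<forall>z. pr v z \<in> f \<longleftrightarrow> z = c"
  using f unfolding is_coloring_def is_function_def by blast

lemma color_less: "pr v c \<in> f \<Longrightarrow> c < of_nat k"
  using f unfolding is_coloring_def is_function_def by fastforce

lemma color_neq: "u \<in> part \<Longrightarrow> v \<in> part \<Longrightarrow> arc k T u v \<Longrightarrow> pr u c \<in> f \<Longrightarrow> pr v c \<notin> f"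
  using f unfolding is_coloring_def in_E by blast

lemma base_part: "j < of_nat k \<Longrightarrow> base j \<in> part"
  using base_M by (auto simp: V_def intro: vertex.intros)

lemma small_less: "r \<le> 2 \<Longrightarrow> r < (of_nat k :: 'a)"
proof -
  assume "r \<le> 2"
  also have "(2::'a) < 3" by simp
  also note three_le
  finally show ?thesis .
qed

definition shares :: "'a \<Rightarrow> 'a \<Rightarrow> bool" where
  "shares v r \<longleftrightarrow> (\<exists>c. pr v c \<in> f \<and> pr (base r) c \<in> f)"

text \<open>
  The colours are normalised by the base clique: it uses every colour once, and the vertices outside of
  it are adjacent to all of the clique but its first three vertices.
\<close>

lemma shares_small:
  assumes v: "v \<in> part" "p1 v \<noteq> 0"
  shows "shares v 0 \<or> shares v 1 \<or> shares v 2"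
proof -
  define F :: "nat \<Rightarrow> 'a" where "F j = (THE c. pr (base (of_nat j)) c \<in> f)" for j
  have F: "pr (base (of_nat j)) c \<in> f \<longleftrightarrow> c = F j" if "j < k" for j c
    unfolding F_def using color_ex1[OF base_part, of "of_nat j"] that by (auto intro: theI2)
  have "inj_on F {..<k}"
  proof (rule inj_onI)
    fix i j assume ij: "i \<in> {..<k}" "j \<in> {..<k}" "F i = F j"
    show "i = j"
    proof (rule ccontr)
      assume "i \<noteq> j"
      then have "arc k T (base (of_nat i)) (base (of_nat j))" using ij by (intro arc.Base) auto
      then have "\<not> (pr (base (of_nat i)) (F i) \<in> f \<and> pr (base (of_nat j)) (F i) \<in> f)"
        using color_neq[OF base_part base_part, of "of_nat i" "of_nat j"] ij by simp
      then show False using F ij by auto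
    qed
  qed
  moreover have small: "c \<in> of_nat ` {..<k}" if "pr v c \<in> f" for v c
    using color_less[OF that, unfolded less_of_nat] by auto
  have "F ` {..<k} \<subseteq> of_nat ` {..<k}"
    using F by (intro image_subsetI small) auto
  moreover have "card (of_nat ` {..<k} :: 'a set) = k" by (simp add: card_image inj_on_def)
  ultimately have "F ` {..<k} = of_nat ` {..<k}"
    using \<open>F ` {..<k} \<subseteq> of_nat ` {..<k}\<close> by (intro card_subset_eq) (auto simp: card_image)
  moreover obtain c where c: "pr v c \<in> f" using color_ex1[OF v(1)] by blast
  moreover from c have "c \<in> of_nat ` {..<k}" by (rule small)
  ultimately obtain j where j: "j < k" "c = F j" by auto
  have "j < 3"
  proof (rule ccontr)
    assume "\<not> j < 3"
    then have "(3::'a) \<le> of_nat j" using of_nat_mono[of 3 j, where 'a = 'a] by simp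
    then have "arc k T v (base (of_nat j))" using v(2) j(1) by (intro arc.Extra) auto
    then show False using color_neq[OF v(1) base_part, of "of_nat j" c] c F[OF j(1)] j by simp
  qed
  then have "j = 0 \<or> j = 1 \<or> j = 2" by auto
  moreover have "shares v (of_nat j)" using c j F[OF j(1)] unfolding shares_def by auto
  ultimately show ?thesis by auto
qed

lemma shares_unique:
  assumes "v \<in> part" "shares v r" "shares v r'" "r \<le> 2" "r' \<le> 2"
  shows "r = r'"
proof (rule ccontr)
  assume "r \<noteq> r'"
  then have "arc k T (base r) (base r')" using assms small_less by (intro arc.Base) auto
  moreover obtain c where "pr (base r) c \<in> f" "pr (base r') c \<in> f"
    using assms(2,3) color_ex1[OF assms(1)] unfolding shares_def by auto
  ultimately show False using color_neq base_part small_less assms(4,5) by blast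
qed

definition g :: "'a \<Rightarrow> 'a" where
  "g v = (if shares v 0 then 0 else if shares v 1 then 1 else 2)"

lemma g_range: "g v = 0 \<or> g v = 1 \<or> g v = 2"
  by (simp add: g_def)

lemma g_eq: "v \<in> part \<Longrightarrow> p1 v \<noteq> 0 \<Longrightarrow> r \<le> 2 \<Longrightarrow> g v = r \<longleftrightarrow> shares v r"
  using shares_small[of v] shares_unique[of v] by (auto simp: g_def)

lemma g_neq:
  assumes "arc k T u v" "u \<in> part" "v \<in> part" "p1 u \<noteq> 0" "p1 v \<noteq> 0"
  shows "g u \<noteq> g v"
proof
  assume eq: "g u = g v"
  have le: "g u \<le> 2" using g_range[of u] by auto
  have "shares u (g u)" "shares v (g u)"
    using g_eq[OF assms(2,4) le] g_eq[OF assms(3,5) le] eq by auto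
  then obtain c where "pr u c \<in> f" "pr v c \<in> f"
    using color_ex1[OF base_part[OF small_less[OF le]]] unfolding shares_def by auto
  then show False using color_neq[OF assms(2,3,1)] by blast
qed

lemma g_neq_base:
  assumes "arc k T v (base r)" "v \<in> part" "p1 v \<noteq> 0" "r \<le> 2"
  shows "g v \<noteq> r"
  using g_eq[OF assms(2-4)] color_neq[OF assms(2) base_part[OF small_less[OF assms(4)]] assms(1)]
  unfolding shares_def by blast

definition bit0 :: "'a \<Rightarrow> bool" where
  "bit0 n \<longleftrightarrow> g (lit 2 0 n) = 0"

lemma lit_part: "r \<le> 2 \<Longrightarrow> i \<le> 1 \<Longrightarrow> lit r i n < M \<Longrightarrow> lit r i n \<in> part"
  by (auto simp: V_def intro: vertex.intros)

context
  fixes n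
  assumes low: "\<And>r i. r \<le> 2 \<Longrightarrow> i \<le> 1 \<Longrightarrow> lit r i n < M"
begin

text \<open>
  All six literals are determined by the first one.
\<close>

lemma g_lit:
  "g (lit 2 0 n) = (if bit0 n then 0 else 1)" "g (lit 2 1 n) = (if bit0 n then 1 else 0)"
  "g (lit 1 0 n) = (if bit0 n then 2 else 0)" "g (lit 1 1 n) = (if bit0 n then 0 else 2)"
  "g (lit 0 0 n) = (if bit0 n then 2 else 1)" "g (lit 0 1 n) = (if bit0 n then 1 else 2)"
proof -
  have part: "lit r i n \<in> part" if "r \<le> 2" "i \<le> 1" for r i using that low by (intro lit_part)
  have base: "g (lit r i n) \<noteq> r" if "r \<le> 2" "i \<le> 1" for r i
    using that part by (intro g_neq_base arc.intros) auto
  have neg: "g (lit r 0 n) \<noteq> g (lit r 1 n)" if "r \<le> 2" for r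
    using that part by (intro g_neq arc.intros) auto
  have 1: "g (lit 1 i n) \<noteq> g (lit 2 i n)" if "i \<le> 1" for i
    using that part by (intro g_neq arc.intros) auto
  have 2: "g (lit 0 0 n) \<noteq> g (lit 2 1 n)" "g (lit 0 1 n) \<noteq> g (lit 2 0 n)"
    using part by (intro g_neq arc.intros; simp)+
  note facts = base[of 2 0] base[of 2 1] base[of 1 0] base[of 1 1] base[of 0 0] base[of 0 1]
    neg[of 2] neg[of 1] neg[of 0] 1[of 0] 1[of 1] 2
    g_range[of "lit 2 0 n"] g_range[of "lit 2 1 n"] g_range[of "lit 1 0 n"] g_range[of "lit 1 1 n"]
    g_range[of "lit 0 0 n"] g_range[of "lit 0 1 n"]
  show "g (lit 2 0 n) = (if bit0 n then 0 else 1)" using facts by (auto simp: bit0_def)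
  moreover show "g (lit 2 1 n) = (if bit0 n then 1 else 0)" using facts by (auto simp: bit0_def)
  ultimately show "g (lit 1 0 n) = (if bit0 n then 2 else 0)" "g (lit 1 1 n) = (if bit0 n then 0 else 2)"
    "g (lit 0 0 n) = (if bit0 n then 2 else 1)" "g (lit 0 1 n) = (if bit0 n then 1 else 2)"
    using facts by (auto split: if_splits)
qed

lemma g_onpath:
  assumes "bstr s (n + 1)" "onpath s < M"
  shows "g (onpath s) = 2 \<longleftrightarrow> (bit0 n \<longleftrightarrow> \<not> zero_at n s)"
proof -
  have "onpath s \<in> part" using assms by (auto simp: V_def intro: vertex.intros)
  moreover have "bit_at n s \<le> 1" by (simp add: bit_at_def)
  ultimately have "g (onpath s) \<noteq> g (lit 1 (bit_at n s) n)" "g (onpath s) \<noteq> g (lit 0 (bit_at n s) n)"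
    using assms low by (intro g_neq arc.intros lit_part; simp)+
  then show ?thesis using g_lit g_range[of "onpath s"] by (auto simp: bit_at_def split: if_splits)
qed

lemma g_link:
  assumes "bstr s (n + 1)" "link s < M"
  shows "g (link s) = 0 \<longleftrightarrow> (bit0 n \<longleftrightarrow> \<not> zero_at n s)"
proof -
  have "link s \<in> part" using assms by (auto simp: V_def intro: vertex.intros)
  moreover have "bit_at n s \<le> 1" "neg_bit_at n s \<le> 1" by (simp_all add: bit_at_def neg_bit_at_def)
  ultimately have "g (link s) \<noteq> g (lit 2 (bit_at n s) n)" "g (link s) \<noteq> g (lit 1 (neg_bit_at n s) n)"
    using assms low by (intro g_neq arc.intros lit_part; simp)+
  then show ?thesis using g_lit g_range[of "link s"] by (auto simp: bit_at_def neg_bit_at_def split: if_splits)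
qed

lemma g_carry:
  assumes "bstr s (n + 1 + 1)" "carry s < M"
  shows "g (carry s) = 1 \<longleftrightarrow> (bit0 n \<longleftrightarrow> \<not> zero_at n s)"
proof -
  have "carry s \<in> part" using assms by (auto simp: V_def intro: vertex.intros)
  moreover have "neg_bit_at n s \<le> 1" by (simp add: neg_bit_at_def)
  ultimately have "g (carry s) \<noteq> g (lit 2 (neg_bit_at n s) n)" "g (carry s) \<noteq> g (lit 0 (neg_bit_at n s) n)"
    using assms low by (intro g_neq arc.intros lit_part; simp)+
  then show ?thesis using g_lit g_range[of "carry s"] by (auto simp: neg_bit_at_def split: if_splits)
qed

end

lemma decode:
  assumes "v \<in> part" "p1 v \<noteq> 0" and low: "\<And>r i. r \<le> 2 \<Longrightarrow> i \<le> 1 \<Longrightarrow> lit r i (level v) < M"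
  shows "g v = odd_color v \<longleftrightarrow> (bit0 (level v) \<longleftrightarrow> odd_bit v)"
proof -
  have "vertex k v" "v < M" using assms(1) by (auto simp: V_def)
  from this(1) show ?thesis
  proof cases
    case (2 r i n)
    have r: "r = 0 \<or> r = 1 \<or> r = 2" using 2(2) less_succ[of r 1] by (auto simp: le_less less_two)
    have i: "i = 0 \<or> i = 1" using 2(3) by (auto simp: le_less)
    have "\<And>r i. r \<le> 2 \<Longrightarrow> i \<le> 1 \<Longrightarrow> lit r i n < M" using low 2 by simp
    note g_lit[OF this]
    then show ?thesis using r i unfolding 2(1) by (cases "bit0 n") (auto simp: odd_color_def odd_bit_def)
  next
    case (3 s n)
    then show ?thesis using g_onpath[of n s] low \<open>v < M\<close> by (simp add: odd_color_def odd_bit_def)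
  next
    case (4 s n)
    then show ?thesis using g_link[of n s] low \<open>v < M\<close> by (simp add: odd_color_def odd_bit_def)
  next
    case (5 s n)
    then show ?thesis using g_carry[of n s] low \<open>v < M\<close> by (simp add: odd_color_def odd_bit_def)
  qed (use assms(2) in simp)
qed

text \<open>
  By induction on \<open>n\<close>, the initial segment of length \<open>n + 1\<close> of \<open>s\<close> has colour 0, and a string with this
  colour is in the tree.
\<close>

lemma onpath_in_tree:
  assumes low: "\<And>v. vertex k v \<Longrightarrow> p1 v \<noteq> 0 \<Longrightarrow> level v \<le> L \<Longrightarrow> v < M"
    and s: "bstr s (L + 1)" "\<And>n. n \<le> L \<Longrightarrow> zero_at n s \<longleftrightarrow> bit0 n"
  shows "s \<in> T"
proof -
  have lits: "lit r i n < M" if "r \<le> 2" "i \<le> 1" "n \<le> L" for r i n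
    using that by (intro low vertex.intros) auto
  obtain c where c: "\<And>z. pr (base 0) z \<in> f \<longleftrightarrow> z = c"
    using color_ex1[OF base_part[OF small_less, of 0]] by auto
  have shares0: "shares v 0 \<longleftrightarrow> pr v c \<in> f" for v by (simp add: shares_def c)
  have strings: "onpath t \<in> part" "link t \<in> part" "onpath t < M" "link t < M" if "bstr t (n + 1)" "n \<le> L" for t n
    using that by (auto simp: V_def intro!: low intro: vertex.intros)
  have carries: "carry t \<in> part" "carry t < M" if "bstr t (n + 1 + 1)" "n \<le> L" for t n
    using that by (auto simp: V_def intro!: low intro: vertex.intros)
  have "decidable (\<lambda>n. n \<le> L \<longrightarrow> (\<forall>t\<le>M. bstr t (n + 1) \<and> initseg t s \<longrightarrow> pr (onpath t) c \<in> f))"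
    by (intro definable_intros f_sets)
  then have "L \<le> L \<longrightarrow> (\<forall>t\<le>M. bstr t (L + 1) \<and> initseg t s \<longrightarrow> pr (onpath t) c \<in> f)"
  proof (rule decidable_induct)
    show "0 \<le> L \<longrightarrow> (\<forall>t\<le>M. bstr t (0 + 1) \<and> initseg t s \<longrightarrow> pr (onpath t) c \<in> f)"
    proof (intro allI impI)
      fix t assume t: "bstr t (0 + 1) \<and> initseg t s"
      then have "zero_at 0 t \<longleftrightarrow> bit0 0" using s initseg_bstr[of t "0 + 1" s] by auto
      then have "g (onpath t) \<noteq> 2" using g_onpath[of 0 t] lits strings[of t 0] t by auto
      moreover have "g (onpath t) \<noteq> 1"
        using strings[of t 0] t by (intro g_neq_base arc.intros) auto
      ultimately have "g (onpath t) = 0" using g_range by blast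
      then show "pr (onpath t) c \<in> f" using g_eq[of "onpath t" 0] strings[of t 0] t shares0 by auto
    qed
  next
    fix n assume IH: "n \<le> L \<longrightarrow> (\<forall>t\<le>M. bstr t (n + 1) \<and> initseg t s \<longrightarrow> pr (onpath t) c \<in> f)"
    show "n + 1 \<le> L \<longrightarrow> (\<forall>t\<le>M. bstr t (n + 1 + 1) \<and> initseg t s \<longrightarrow> pr (onpath t) c \<in> f)"
    proof (intro allI impI)
      fix t assume n: "n + 1 \<le> L" and t': "bstr t (n + 1 + 1) \<and> initseg t s"
      then have t: "bstr t (n + 1 + 1)" and ts: "initseg t s" by auto
      have nL: "n \<le> L" "n < L + 1" "n + 1 < L + 1" using n by auto
      have bits: "zero_at i t \<longleftrightarrow> bit0 i" if "i < n + 1 + 1" for i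
      proof -
        have "i \<le> L" using that n by (auto intro: order_trans)
        then show ?thesis using s(2) ts that initseg_bstr[OF t s(1)] by auto
      qed
      obtain t0 where t0: "bstr t0 (n + 1)" "initseg t0 t" using ex_restriction[OF t, of "n + 1"] by auto
      then have "initseg t0 s" using ts unfolding initseg_def by blast
      have t0M: "t0 \<le> M" using strings(3)[OF t0(1) nL(1)] pr_ge2[of t0 2] by order
      then have "pr (onpath t0) c \<in> f" using IH t0 \<open>initseg t0 s\<close> nL(1) by blast
      then have g0: "g (onpath t0) = 0" using g_eq[of "onpath t0" 0] strings[OF t0(1) nL(1)] shares0 by auto
      note str = strings[OF t n] carries[OF t nL(1)] strings[OF t0(1) nL(1)]
      \<comment> \<open>The mark travels along the path from \<open>onpath t0\<close> to \<open>onpath t\<close>.\<close>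
      have "g (carry t) \<noteq> 1" using g_carry[of n t] lits nL t str bits[of n] by (auto simp: less_imp_le)
      moreover have "g (onpath t0) \<noteq> g (carry t)" using t t0 str by (intro g_neq arc.intros) auto
      ultimately have "g (carry t) = 2" using g0 g_range[of "carry t"] by auto
      moreover have "g (carry t) \<noteq> g (link t)" using t str by (intro g_neq arc.intros) auto
      moreover have "g (link t) \<noteq> 0" using g_link[of "n + 1" t] lits n t str bits[of "n + 1"] by auto
      ultimately have "g (link t) = 1" using g_range[of "link t"] by auto
      moreover have "g (link t) \<noteq> g (onpath t)" using t str by (intro g_neq arc.intros) auto
      moreover have "g (onpath t) \<noteq> 2" using g_onpath[of "n + 1" t] lits n t str bits[of "n + 1"] by auto
      ultimately have "g (onpath t) = 0" using g_range[of "onpath t"] by auto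
      then show "pr (onpath t) c \<in> f" using g_eq[of "onpath t" 0] str shares0 by auto
    qed
  qed
  moreover have "s \<le> M" using strings(3)[OF s(1)] pr_ge2[of s 2] by (meson order_refl order_trans less_imp_le)
  moreover have "initseg s s" by (simp add: initseg_def)
  ultimately have "pr (onpath s) c \<in> f" using s(1) by blast
  then have "g (onpath s) = 0" using g_eq[of "onpath s" 0] strings[OF s(1)] shares0 by auto
  moreover have "g (onpath s) \<noteq> 0" if "s \<notin> T"
    using that s(1) strings[OF s(1)] by (intro g_neq_base arc.intros) auto
  ultimately show "s \<in> T" by blast
qed

end

context tree_model
begin

text \<open>
  The colour of the homogeneous set is the colour of one of the first three base vertices. Which one it is may
  vary with the colouring, but one of the three occurs in arbitrarily large finite parts.
\<close>

lemma homogeneous_color: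
  assumes H: "unbounded_set H" "homogeneous_for_graph k V E H"
  shows "\<exists>\<kappa>\<le>2. \<forall>M. \<exists>M'\<ge>M. \<exists>f. colored_part k T M' f \<and> (\<forall>v\<in>H. v < M' \<longrightarrow> pr v 0 \<in> f) \<and> pr (base \<kappa>) 0 \<in> f"
proof -
  define Q where "Q \<kappa> M' \<longleftrightarrow> (\<exists>f. colored_part k T M' f \<and> (\<forall>v\<in>H. v < M' \<longrightarrow> pr v 0 \<in> f) \<and> pr (base \<kappa>) 0 \<in> f)" for \<kappa> M'
  obtain B :: 'a where "\<forall>j<of_nat k. base j < B" using ex_low_bound[of 0] by blast
  then have B: "\<And>j. j < of_nat k \<Longrightarrow> base j < B" by blast
  have HV: "H \<subseteq> V" using H(2) by (simp add: homogeneous_for_graph_def)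
  obtain v where v: "v \<in> H" "B \<le> v" using H(1) unfolding unbounded_set_def by blast
  then have "vertex k v" using HV by (auto simp: V_def)
  then have "p1 v \<noteq> 0"
  proof cases
    case (1 j)
    then show ?thesis using B[of j] v(2) by auto
  qed auto
  have "(\<forall>M. \<exists>M'\<ge>M. Q 0 M') \<or> (\<forall>M. \<exists>M'\<ge>M. Q 1 M') \<or> (\<forall>M. \<exists>M'\<ge>M. Q 2 M')"
  proof (rule ccontr)
    assume "\<not> ?thesis"
    then obtain m0 m1 m2 where m: "\<And>M'. m0 \<le> M' \<Longrightarrow> \<not> Q 0 M'" "\<And>M'. m1 \<le> M' \<Longrightarrow> \<not> Q 1 M'"
      "\<And>M'. m2 \<le> M' \<Longrightarrow> \<not> Q 2 M'" by blast
    define M where "M = m0 + m1 + m2 + v + 1"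
    have "m0 \<le> M" "m1 \<le> M" "m2 \<le> M"
      unfolding M_def by (simp_all add: add_increasing add_increasing2 add.assoc)
    moreover have "v < M" unfolding M_def by (simp add: add_increasing)
    ultimately have M: "m0 \<le> M" "m1 \<le> M" "m2 \<le> M" "v < M" .
    let ?V0 = "{v \<in> V. v < M}"
    have "?V0 \<in> sets"
      unfolding decidable_def[symmetric] by (intro definable_intros V_sets)
    moreover have "bounded_set ?V0" by (auto simp: bounded_set_def)
    ultimately obtain f where fH: "f \<in> sets" "is_coloring k ?V0 E f" "\<forall>x. x \<in> ?V0 \<and> x \<in> H \<longrightarrow> pr x 0 \<in> f"
      using H(2) unfolding homogeneous_for_graph_def by blast
    have "base j < M" if "j < of_nat k" for j using B[OF that] v(2) M(4) by order
    then interpret colored_part k T M f using fH by unfold_locales auto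
    have part: "v \<in> part" using v(1) HV M(4) by auto
    then have "pr v 0 \<in> f" using fH(3) v(1) by blast
    then have "shares v \<kappa> \<Longrightarrow> pr (base \<kappa>) 0 \<in> f" for \<kappa>
      using color_ex1[OF part] unfolding shares_def by auto
    moreover have "\<forall>v\<in>H. v < M \<longrightarrow> pr v 0 \<in> f" using fH(3) HV by blast
    ultimately have "shares v \<kappa> \<Longrightarrow> Q \<kappa> M" for \<kappa>
      unfolding Q_def using colored_part_axioms by blast
    then show False using shares_small[OF part \<open>p1 v \<noteq> 0\<close>] m M by blast
  qed
  moreover have "(0::'a) \<le> 2" "(1::'a) \<le> 2" "(2::'a) \<le> 2" by simp_all
  ultimately show ?thesis unfolding Q_def by blast
qed

text \<open>
  Every vertex of \<open>H\<close> fixes one bit, and the vertices of bounded level are bounded; hence infinitely many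
  bits are fixed, and infinitely many of them to the same value.
\<close>

lemma homogeneous_tree:
  assumes H: "H \<in> sets" "unbounded_set H" "homogeneous_for_graph k V E H"
  shows "\<exists>H'\<in>sets. unbounded_set H' \<and> homogeneous_for_tree H' T"
proof -
  have HV: "H \<subseteq> V" using H(3) by (simp add: homogeneous_for_graph_def)
  obtain \<kappa> where \<kappa>: "\<kappa> \<le> 2" "\<And>M. \<exists>M'\<ge>M. \<exists>f. colored_part k T M' f
      \<and> (\<forall>v\<in>H. v < M' \<longrightarrow> pr v 0 \<in> f) \<and> pr (base \<kappa>) 0 \<in> f"
    using homogeneous_color[OF H(2,3)] by blast
  define P where "P d v \<longleftrightarrow> v \<in> H \<and> p1 v \<noteq> 0 \<and> ((\<kappa> = odd_color v \<longleftrightarrow> odd_bit v) \<longleftrightarrow> d)" for d v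
  have dP: "decidable (P d)" for d
    unfolding P_def odd_color_def odd_bit_def by (intro definable_intros H)
  have "\<exists>d. \<forall>b. \<exists>v. P d v \<and> b \<le> level v"
  proof (rule ccontr)
    assume "\<nexists>d. \<forall>b. \<exists>v. P d v \<and> b \<le> level v"
    then obtain b where b: "\<And>d v. P d v \<Longrightarrow> level v < b d" by (metis not_less)
    obtain M :: 'a where "\<forall>j<of_nat k. base j < M"
      "\<forall>v. vertex k v \<and> p1 v \<noteq> 0 \<and> level v \<le> b True + b False \<longrightarrow> v < M"
      using ex_low_bound[of "b True + b False"] by blast
    then have M: "\<And>j. j < of_nat k \<Longrightarrow> base j < M"
      "\<And>v. vertex k v \<Longrightarrow> p1 v \<noteq> 0 \<Longrightarrow> level v \<le> b True + b False \<Longrightarrow> v < M" by blast+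
    obtain v where v: "v \<in> H" "M \<le> v" using H(2) unfolding unbounded_set_def by blast
    then have vertex: "vertex k v" using HV by (auto simp: V_def)
    then have "p1 v \<noteq> 0"
    proof cases
      case (1 j)
      then show ?thesis using M(1)[of j] v(2) by auto
    qed auto
    then have "P True v \<or> P False v" using v(1) unfolding P_def by blast
    then have "level v < b True \<or> level v < b False" using b by blast
    then have "level v \<le> b True + b False"
      by (auto intro: add_increasing add_increasing2 less_imp_le)
    then show False using M(2)[OF vertex \<open>p1 v \<noteq> 0\<close>] v(2) by auto
  qed
  then obtain d where "\<And>b. \<exists>v. P d v \<and> b \<le> level v" by blast
  from increasing_selection[OF dP computable_level_id this]
  obtain h where h: "computable h" "\<And>n. P d (h n)" "\<And>n. n \<le> level (h n)" by blast
  define H' where "H' = {n. \<exists>m\<le>n. n = level (h m)}"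
  have H': "n \<in> H' \<longleftrightarrow> (\<exists>m. n = level (h m))" for n using h(3) unfolding H'_def by blast
  have "H' \<in> sets"
    unfolding H'_def decidable_def[symmetric] by (intro definable_intros computable_subst[OF h(1)])
  moreover have "unbounded_set H'" using h(3) H' unfolding unbounded_set_def by blast
  moreover have "homogeneous_for_tree H' T"
    unfolding homogeneous_for_tree_def unbounded_set_def
  proof
    fix L :: 'a
    obtain M :: 'a where "\<forall>n\<le>L. \<forall>r\<le>2. \<forall>i\<le>1. lit r i n < M"
      "\<forall>v. vertex k v \<and> p1 v \<noteq> 0 \<and> level v \<le> L \<longrightarrow> v < M"
      using ex_low_bound[of L] by blast
    then have M: "\<And>n r i. n \<le> L \<Longrightarrow> r \<le> 2 \<Longrightarrow> i \<le> 1 \<Longrightarrow> lit r i n < M"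
      "\<And>v. vertex k v \<Longrightarrow> p1 v \<noteq> 0 \<Longrightarrow> level v \<le> L \<Longrightarrow> v < M" by blast+
    obtain M' f where M': "M \<le> M'" and cp: "colored_part k T M' f"
      and f0: "\<And>v. v \<in> H \<Longrightarrow> v < M' \<Longrightarrow> pr v 0 \<in> f" "pr (base \<kappa>) 0 \<in> f"
      using \<kappa>(2)[of M] by blast
    interpret colored_part k T M' f by (rule cp)
    obtain c where c: "\<And>z. pr (base 0) z \<in> f \<longleftrightarrow> z = c"
      using color_ex1[OF base_part[OF small_less, of 0]] by auto
    have bit0: "bit0 n \<longleftrightarrow> pr (lit 2 0 n) c \<in> f" for n
      by (auto simp: bit0_def g_def shares_def c)
    have "decidable bit0" unfolding bit0 by (intro definable_intros f_sets)
    then obtain s where s: "bstr s (L + 1)" "\<And>n. n < L + 1 \<Longrightarrow> zero_at n s \<longleftrightarrow> bit0 n" using ex_bstr by blast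
    have "s \<in> T"
      by (rule onpath_in_tree[OF _ s(1)]) (use M(2) M' s(2) in \<open>auto intro: order_less_le_trans\<close>)
    moreover have "homogeneous_for_string H' s"
      unfolding homogeneous_for_string_def
    proof (intro exI conjI allI impI)
      show "(if d then 0 else 1) < (2::'a)" by simp
      show "str s (L + 1)" using s(1) by (rule bstr_str)
      fix i assume i: "i \<in> H'" "i < L + 1"
      from i(1)[unfolded H'] obtain m where "i = level (h m)" ..
      with h(2)[of m] obtain v where v: "P d v" "level v = i" by blast
      then have "v \<in> V" "p1 v \<noteq> 0" "v \<in> H" using HV by (auto simp: P_def)
      then have "v < M'" using M(2)[of v] M' v(2) i(2) by (auto simp: V_def)
      with \<open>v \<in> V\<close> have part: "v \<in> part" by simp
      have "shares v \<kappa>" using f0(1)[OF \<open>v \<in> H\<close> \<open>v < M'\<close>] f0(2) unfolding shares_def by blast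
      then have "g v = \<kappa>" using g_eq[OF part \<open>p1 v \<noteq> 0\<close> \<kappa>(1)] by blast
      moreover have "g v = odd_color v \<longleftrightarrow> (bit0 i \<longleftrightarrow> odd_bit v)"
        using decode[OF part \<open>p1 v \<noteq> 0\<close>] M(1) M' i(2) v(2) by (auto intro: order_less_le_trans)
      ultimately have "bit0 i \<longleftrightarrow> d" using v(1) unfolding P_def by blast
      then show "el (pr i (if d then 0 else 1)) s"
        using s(2)[OF i(2)] by (intro bstr_bit[OF s(1) i(2), THEN iffD2]) simp
    qed
    moreover have "L \<le> s" using str_le[OF bstr_str[OF s(1)]] by (simp add: less_imp_le)
    ultimately show "\<exists>s\<in>{s \<in> T. homogeneous_for_string H' s}. L \<le> s" by blast
  qed
  ultimately show ?thesis by blast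
qed

end

theorem RCOLOR_imp_RWKL:
  assumes "3 \<le> k" "RCOLOR_holds k TYPE('a::arithmetic)"
  shows "RWKL_holds TYPE('a)"
  unfolding RWKL_holds_def
proof (intro ballI impI)
  fix T :: "'a set" assume "T \<in> sets" "is_tree T \<and> unbounded_set T"
  then interpret tree_model k T using assms(1) by unfold_locales auto
  obtain H where "H \<in> sets" "unbounded_set H" "homogeneous_for_graph k V E H"
    using assms(2) V_sets E_sets is_graph unbounded_V locally_colorable unfolding RCOLOR_holds_def by blast
  then show "\<exists>H\<in>sets. unbounded_set H \<and> homogeneous_for_tree H T" by (rule homogeneous_tree)
qed


section \<open>A critical model\<close>

text \<open>
  Results about a type class apply to types, and an arbitrary model is not a type. Therefore one type is
  fixed for the numbers, and its operations are chosen as those of a model of \<open>RCA\<^sub>0\<close> that refutes the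
  equivalences, provided that there is such a model at all. As the standard model is available otherwise, the
  type belongs to the class \<open>arithmetic\<close> in any case. The equivalences hold in it, and hence they are
  refuted nowhere.
\<close>

datatype model_number = Nr nat

text \<open>
  The terms form a countable set, and the numerals are pairwise distinct in \<open>RCA\<^sub>0\<close>; therefore a term model
  has a countably infinite domain.
\<close>

lemma infinite_term_model:
  assumes \<Theta>: "henkin_theory RCA0 \<Theta>"
  shows "\<exists>d :: tm \<Rightarrow> model_number. surj d \<and> (\<forall>s t. d s = d t \<longleftrightarrow> (s \<^bold>= t) \<in> \<Theta>)"
proof -
  have prov: "RCA0 \<turnstile> \<phi> \<Longrightarrow> \<phi> \<in> \<Theta>" and FF: "FF \<notin> \<Theta>"
    and imp: "(\<phi> \<^bold>\<longrightarrow> \<psi>) \<in> \<Theta> \<Longrightarrow> \<phi> \<in> \<Theta> \<Longrightarrow> \<psi> \<in> \<Theta>" for \<phi> \<psi>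
    using \<Theta> by (auto simp: henkin_theory_def)
  have eq: "instN t \<phi> \<in> \<Theta>" if "(s \<^bold>= t) \<in> \<Theta>" "instN s \<phi> \<in> \<Theta>" for s t \<phi>
    using imp[OF imp[OF prov[OF EqSubst] that(1)] that(2)] .
  have refl: "(t \<^bold>= t) \<in> \<Theta>" for t by (rule prov[OF EqRefl])
  have sym: "(t \<^bold>= s) \<in> \<Theta>" if "(s \<^bold>= t) \<in> \<Theta>" for s t
    using eq[OF that, of "Var 0 \<^bold>= s \<up> Suc 0"] refl by (simp add: instN_def)
  have trans: "(s \<^bold>= u) \<in> \<Theta>" if "(s \<^bold>= t) \<in> \<Theta>" "(t \<^bold>= u) \<in> \<Theta>" for s t u
    using eq[OF that(2), of "s \<up> Suc 0 \<^bold>= Var 0"] that(1) by (simp add: instN_def)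
  define cls where "cls t = {s. (s \<^bold>= t) \<in> \<Theta>}" for t
  have cls: "cls s = cls t \<longleftrightarrow> (s \<^bold>= t) \<in> \<Theta>" for s t
    unfolding cls_def using refl sym trans by blast
  have ax: "subst \<sigma> (\<lambda>X. X) \<phi> \<in> \<Theta>" if "\<phi> \<in> basic_axioms" for \<sigma> \<phi>
    using that by (intro prov provable_subst Axiom) (simp add: RCA0_def)
  have zero: "(t \<^bold>+ One \<^bold>= Zero) \<notin> \<Theta>" for t
    using ax[of "\<^bold>\<not> (Var 0 \<^bold>+ One \<^bold>= Zero)" "\<lambda>_. t"] imp FF by (auto simp: basic_axioms_def Neg_def)
  have succ: "(s \<^bold>= t) \<in> \<Theta>" if "(s \<^bold>+ One \<^bold>= t \<^bold>+ One) \<in> \<Theta>" for s t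
    using ax[of "Var 0 \<^bold>+ One \<^bold>= Var 1 \<^bold>+ One \<^bold>\<longrightarrow> Var 0 \<^bold>= Var 1" "case_nat s (\<lambda>_. t)"] imp that
    by (auto simp: basic_axioms_def)
  have "(num m \<^bold>= num n) \<in> \<Theta> \<Longrightarrow> m = n" for m n
  proof (induction m arbitrary: n)
    case 0
    then show ?case using zero sym by (cases n) auto
  next
    case (Suc m)
    then show ?case using zero succ by (cases n) auto
  qed
  then have "inj (\<lambda>n. cls (num n))" by (auto simp: inj_on_def cls)
  then have inf: "infinite (range cls)"
    by (metis finite_subset image_subsetI infinite_UNIV_nat rangeI finite_imageD)
  have count: "countable (range cls)" by simp
  define d where "d t = Nr (to_nat_on (range cls) (cls t))" for t
  have b: "bij_betw (to_nat_on (range cls)) (range cls) UNIV"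
    by (rule to_nat_on_infinite[OF count inf])
  have "d s = d t \<longleftrightarrow> (s \<^bold>= t) \<in> \<Theta>" for s t
    by (simp only: d_def model_number.inject inj_on_eq_iff[OF bij_betw_imp_inj_on[OF b] rangeI rangeI] cls)
  moreover have "\<exists>t. y = d t" for y
  proof (cases y)
    case (Nr n)
    have "n \<in> to_nat_on (range cls) ` range cls" using b by (simp add: bij_betw_def)
    then show ?thesis unfolding Nr d_def by blast
  qed
  ultimately show ?thesis unfolding surj_def by blast
qed

lemma countermodel:
  assumes "\<not> (RCA0 \<turnstile> \<phi>)"
  shows "\<exists>M :: model_number so_structure. models M RCA0
    \<and> (\<exists>e E. range E \<subseteq> sets_of M \<and> \<not> sat M e E \<phi>)"
proof -
  have "consistent RCA0 {\<^bold>\<not> \<phi>}"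
    using assms consistent_Neg[of RCA0 \<phi> "{}"] derivable_empty by blast
  then obtain \<Theta> where \<Theta>: "(\<^bold>\<not> \<phi>) \<in> \<Theta>" "henkin_theory RCA0 \<Theta>"
    using henkin_extension[of "{\<^bold>\<not> \<phi>}" RCA0] by auto
  obtain d :: "tm \<Rightarrow> model_number" where "surj d" "\<And>s t. d s = d t \<longleftrightarrow> (s \<^bold>= t) \<in> \<Theta>"
    using infinite_term_model[OF \<Theta>(2)] by blast
  from henkin_model[OF \<Theta>(2) this] obtain M :: "model_number so_structure" where
    M: "models M RCA0" "\<forall>\<phi>\<in>\<Theta>. \<exists>e E. range E \<subseteq> sets_of M \<and> sat M e E \<phi>" by (elim exE conjE)
  from M(2)[rule_format, OF \<Theta>(1)] obtain e E where "range E \<subseteq> sets_of M" "sat M e E (\<^bold>\<not> \<phi>)"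
    by (elim exE conjE)
  then have "range E \<subseteq> sets_of M \<and> \<not> sat M e E \<phi>" by simp
  with M(1) show ?thesis by blast
qed

primrec nat_of :: "model_number \<Rightarrow> nat" where
  "nat_of (Nr n) = n"

definition standard_model :: "model_number so_structure" where
  "standard_model = \<lparr>zero_of = Nr 0, one_of = Nr 1, plus_of = (\<lambda>x y. Nr (nat_of x + nat_of y)),
    times_of = (\<lambda>x y. Nr (nat_of x * nat_of y)), less_of = (\<lambda>x y. nat_of x < nat_of y), sets_of = UNIV\<rparr>"

lemma nat_of_inject: "nat_of x = nat_of y \<longleftrightarrow> x = y"
  by (cases x; cases y) auto

lemma models_standard: "models standard_model RCA0"
  unfolding models_def
proof (intro conjI ballI allI impI)
  show "sets_of standard_model \<noteq> {}" by (simp add: standard_model_def)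
  fix \<phi> and e :: "nat \<Rightarrow> model_number" and E :: "nat \<Rightarrow> model_number set" assume "\<phi> \<in> RCA0"
  then consider "\<phi> \<in> basic_axioms" | \<psi> where "\<phi> = induction_axiom \<psi>"
    | \<psi> \<chi> where "\<phi> = Delta1_comprehension_axiom \<psi> \<chi>" unfolding RCA0_def by blast
  then show "sat standard_model e E \<phi>"
  proof cases
    case 1
    then show ?thesis
      by (auto simp: basic_axioms_def standard_model_def nat_of_inject[symmetric] less_Suc_eq)
  next
    case (2 \<psi>)
    let ?P = "\<lambda>x. sat standard_model (case_nat x e) E \<psi>"
    have "?P x" if "?P (Nr 0)" "\<And>x. ?P x \<Longrightarrow> ?P (Nr (nat_of x + 1))" for x
    proof -
      have "?P (Nr n)" for n
      proof (induction n)
        case (Suc n)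
        then show ?case using that(2)[of "Nr n"] by simp
      qed (rule that(1))
      then show ?thesis by (cases x) auto
    qed
    moreover have "zero_of standard_model = Nr 0" "one_of standard_model = Nr 1"
      "plus_of standard_model = (\<lambda>x y. Nr (nat_of x + nat_of y))"
      by (simp_all add: standard_model_def)
    ultimately show ?thesis
      unfolding 2 induction_axiom_def instN_def sat_connectives sat_subst tval_case_nat sat.simps tval.simps
        nat.case by simp
  next
    case (3 \<psi> \<chi>)
    have "\<exists>X\<in>sets_of standard_model. \<forall>x. x \<in> X \<longleftrightarrow> sat standard_model (case_nat x e) E \<psi>"
      by (rule bexI[of _ "{x. sat standard_model (case_nat x e) E \<psi>}"]) (auto simp: standard_model_def)
    then show ?thesis
      unfolding 3 Delta1_comprehension_axiom_def liftS_def sat_connectives sat_subst sat.simps tval.simps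
        nat.case by (rule impI)
  qed
qed

definition equivalences :: "nat \<Rightarrow> fm" where
  "equivalences k = ((RWKL \<^bold>\<longleftrightarrow> RCOLOR k) \<^bold>\<and> (RCOLOR k \<^bold>\<longleftrightarrow> LRCOLOR k) \<^bold>\<and> (RWKL \<^bold>\<longleftrightarrow> LRCOLOR k))"

definition refutes :: "model_number so_structure \<Rightarrow> bool" where
  "refutes M \<longleftrightarrow> (\<exists>k\<ge>3. \<exists>e E. range E \<subseteq> sets_of M \<and> \<not> sat M e E (equivalences k))"

definition critical_model :: "model_number so_structure" where
  "critical_model = (SOME M. models M RCA0 \<and> ((\<exists>M'. models M' RCA0 \<and> refutes M') \<longrightarrow> refutes M))"

lemma critical_model:
  "models critical_model RCA0" "models M' RCA0 \<Longrightarrow> refutes M' \<Longrightarrow> refutes critical_model"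
proof -
  have "\<exists>M. models M RCA0 \<and> ((\<exists>M'. models M' RCA0 \<and> refutes M') \<longrightarrow> refutes M)"
    using models_standard by blast
  from someI_ex[OF this] show "models critical_model RCA0"
    "models M' RCA0 \<Longrightarrow> refutes M' \<Longrightarrow> refutes critical_model"
    unfolding critical_model_def by blast+
qed

instantiation model_number :: second_order
begin

definition "0 = zero_of critical_model"
definition "1 = one_of critical_model"
definition "x + y = plus_of critical_model x y"
definition "x * y = times_of critical_model x y"
definition "x < y \<longleftrightarrow> less_of critical_model x y"
definition "x \<le> y \<longleftrightarrow> less_of critical_model x y \<or> x = y"
definition "sets = sets_of critical_model"

instance ..

end

lemma ambient_critical: "ambient = critical_model"
proof -
  have "(+) = plus_of critical_model" "(*) = times_of critical_model" "(<) = less_of critical_model"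
    by (intro ext; simp add: plus_model_number_def times_model_number_def less_model_number_def)+
  then show ?thesis
    by (simp add: ambient_def zero_model_number_def one_model_number_def sets_model_number_def)
qed

instance model_number :: rca0
  by standard (simp_all add: ambient_critical critical_model(1) less_eq_model_number_def less_model_number_def)

instantiation model_number :: minus
begin

definition "x - y = monus x (y :: model_number)"

instance ..

end

lemma rca0_order:
  fixes a b c :: "'a::rca0"
  shows "a < b \<longleftrightarrow> a \<le> b \<and> \<not> b \<le> a" "a \<le> a" "a \<le> b \<Longrightarrow> b \<le> c \<Longrightarrow> a \<le> c"
    "a \<le> b \<Longrightarrow> b \<le> a \<Longrightarrow> a = b" "a \<le> b \<or> b \<le> a"
proof -
  have irrefl: "\<not> x < x" for x :: 'a
    unfolding less_iff_add using add_succ_neq[of x] by (auto dest: sym)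
  show "a < b \<longleftrightarrow> a \<le> b \<and> \<not> b \<le> a" "a \<le> a" "a \<le> b \<Longrightarrow> b \<le> c \<Longrightarrow> a \<le> c"
    "a \<le> b \<Longrightarrow> b \<le> a \<Longrightarrow> a = b" "a \<le> b \<or> b \<le> a"
    unfolding le_iff_less_or_eq using irrefl less_trans'[of a b c] less_trans'[of a b a] less_linear'[of a b]
    by auto
qed

lemma monus_monus: "monus (monus a b) c = monus a (b + (c::'a::rca0))"
proof (cases "b + c \<le> a")
  case True
  then obtain z where "a = b + (c + z)" unfolding le_iff_add by (auto simp: add_assoc')
  then show ?thesis by (metis add_assoc' monus_add)
next
  case False
  show ?thesis
  proof (cases "b \<le> a")
    case True
    then obtain z where z: "a = b + z" unfolding le_iff_add by blast
    then have "\<not> c \<le> z" using False unfolding le_iff_add by (metis add_assoc')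
    then show ?thesis using False z by (simp add: monus_zero)
  next
    case b: False
    have "monus 0 c = 0"
    proof (cases "c \<le> 0")
      case True
      then have "c = 0" unfolding le_iff_less_or_eq using not_less_zero by blast
      then show ?thesis using monus_add[of 0 0] by (simp add: add_zero)
    qed (rule monus_zero)
    then show ?thesis using False b by (simp add: monus_zero)
  qed
qed

lemma monus_distrib: "a * monus b c = monus (a * b) (a * (c::'a::rca0))"
proof (cases "c \<le> b")
  case True
  then obtain z where "b = c + z" unfolding le_iff_add by blast
  then show ?thesis by (simp add: distrib_left')
next
  case False
  then have "b < c" unfolding le_iff_less_or_eq using less_linear' by blast
  show ?thesis
  proof (cases "a = 0")
    case True
    then show ?thesis using monus_add[of 0 0] by (simp add: zero_mult add_zero)
  next
    case a: False
    then have "0 < a" using less_linear'[of 0 a] not_less_zero by blast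
    then have "a * b < a * c" using mult_less \<open>b < c\<close> by blast
    then have "\<not> a * c \<le> a * b" using rca0_order(1) by blast
    then show ?thesis using False by (simp add: monus_zero mult_zero)
  qed
qed

instance model_number :: linordered_semidom
proof
  fix a b c :: model_number
  show "a + b + c = a + (b + c)" by (rule add_assoc')
  show "a + b = b + a" by (rule add_comm')
  show "0 + a = a" by (rule zero_add)
  show "a * b * c = a * (b * c)" by (rule mult_assoc')
  show "a * b = b * a" by (rule mult_comm')
  show "1 * a = a" by (rule one_mult)
  show "(a + b) * c = a * c + b * c" by (simp add: mult_comm'[of _ c] distrib_left')
  show "a * (b + c) = a * b + a * c" by (rule distrib_left')
  show "0 * a = 0" "a * 0 = 0" by (rule zero_mult mult_zero)+
  show "(0::model_number) \<noteq> 1" using succ_neq_zero[of 0] by (metis zero_add)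
  show "a + b - a = b" by (simp add: minus_model_number_def)
  show "a - b - c = a - (b + c)" by (simp add: minus_model_number_def monus_monus)
  show "a * (b - c) = a * b - a * c" by (simp add: minus_model_number_def monus_distrib)
  show "a < b \<longleftrightarrow> a \<le> b \<and> \<not> b \<le> a" by (rule rca0_order(1))
  show "a \<le> a" by (rule rca0_order(2))
  show "a \<le> b \<Longrightarrow> b \<le> c \<Longrightarrow> a \<le> c" by (rule rca0_order(3))
  show "a \<le> b \<Longrightarrow> b \<le> a \<Longrightarrow> a = b" by (rule rca0_order(4))
  show "a \<le> b \<or> b \<le> a" by (rule rca0_order(5))
  show "a \<le> b \<Longrightarrow> c + a \<le> c + b" unfolding le_iff_add by (metis add_assoc')
  show "(0::model_number) < 1" unfolding less_iff_add by (metis zero_add)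
  show "a < b \<Longrightarrow> 0 < c \<Longrightarrow> c * a < c * b" by (rule mult_less)
  show "b \<le> a \<Longrightarrow> a - b + b = a"
    unfolding le_iff_add by (auto simp: minus_model_number_def) (simp add: add_comm')
  show "a \<noteq> 0 \<Longrightarrow> b \<noteq> 0 \<Longrightarrow> a * b \<noteq> 0"
    using mult_less[of 0 b a] less_linear' not_less_zero by (metis mult_zero)
qed

instance model_number :: canonically_ordered_monoid_add
  by standard (rule le_iff_add)

instance model_number :: arithmetic ..

theorem corollary5p14:
  fixes k :: nat
  assumes "k \<ge> 3"
  shows "(RCA0 \<turnstile> RWKL \<^bold>\<longleftrightarrow> RCOLOR k) \<and>
         (RCA0 \<turnstile> RCOLOR k \<^bold>\<longleftrightarrow> LRCOLOR k) \<and>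
         (RCA0 \<turnstile> RWKL \<^bold>\<longleftrightarrow> LRCOLOR k)"
proof -
  have "RWKL_holds TYPE(model_number) \<longleftrightarrow> RCOLOR_holds k TYPE(model_number)"
    "RCOLOR_holds k TYPE(model_number) \<longleftrightarrow> LRCOLOR_holds k TYPE(model_number)" if "3 \<le> k" for k
    using RWKL_imp_LRCOLOR LRCOLOR_imp_RCOLOR RCOLOR_imp_RWKL[OF that] by blast+
  then have "sat ambient (e :: nat \<Rightarrow> model_number) E (equivalences k)" if "3 \<le> k" for k e E
    using that by (simp add: equivalences_def sat_RWKL sat_RCOLOR sat_LRCOLOR)
  then have "\<not> refutes critical_model" by (auto simp: refutes_def ambient_critical)
  then have not_refuted: "\<not> refutes M" if "models M RCA0" for M
    using critical_model(2)[OF that] by (rule contrapos_nn)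
  have provable: "RCA0 \<turnstile> \<phi>"
    if imp: "\<And>(M :: model_number so_structure) e E. sat M e E (equivalences k) \<Longrightarrow> sat M e E \<phi>" for \<phi>
  proof (rule ccontr)
    assume "\<not> (RCA0 \<turnstile> \<phi>)"
    from countermodel[OF this] obtain M :: "model_number so_structure" and e E
      where M: "models M RCA0" "range E \<subseteq> sets_of M" "\<not> sat M e E \<phi>"
      by (elim exE conjE)
    have "\<not> sat M e E (equivalences k)" using M(3) imp by (rule contrapos_nn)
    then have "refutes M" unfolding refutes_def using assms M(2) by (intro exI conjI)
    with not_refuted[OF M(1)] show False ..
  qed
  show ?thesis
    by (intro conjI provable) (simp_all add: equivalences_def)
qed

end
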